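(* Let $S$ be a smooth surface, let $C(k)$ be a regularizable focal curve germ located at $p_k\in S(k)$, $k\ge0$, with regularization level $r$, and let $m_k,m_{k+1},\dots$ be its multiplicity sequence. Then for $k\le j\le r-2$ the vertical orders satisfy $$\operatorname{VO}_{j+2}=m_j-m_{j+1}.$$ Thus the vertical orders depend only on the RVT code word associated with the focal curve germ.
   Context: **Monster tower.** If $D$ is a distribution (subbundle of $TM$) on a manifold $M$, its prolongation is the distribution $\widetilde D$ on $\widetilde M=\mathbf P D$ (with projection $\pi:\widetilde M\to M$) consisting of the tangent vectors at $\widetilde p$ which $d\pi$ maps into the line in $D(\pi(\widetilde p))$ represented by $\widetilde p$. Put $S(0)=S$, $\Delta(0)=TS$, $S(k)=\mathbf P\Delta(k-1)$, and let $\Delta(k)$ (the rank 2 focal bundle) be the prolongation of $\Delta(k-1)$. **Divisors at infinity.** Let $j\ge2$. On $N_0=S(j-1)$ let $E_0\subset\Delta(j-1)$ be the line bundle of vectors vertical over $S(j-2)$. Iterating the prolongation construction on $(N_0,E_0)$ ($N_{i+1}=\mathbf P E_i$, $E_{i+1}$ the prolongation of $E_i$) gives submanifolds $N_i\subset S(j-1+i)$. Put $I_j=N_1\subset S(j)$ (divisor at infinity) and $I_j[\ell]=N_{\ell+1}\subset S(j+\ell)$ (its $\ell$th prolongation). **Focal curve germs.** A focal curve germ on $S(k)$ located at $p\in S(k)$ is a locally irreducible germ at $p$ of a curve with nonconstant smooth parameterization that is tangent to $\Delta(k)$ at each nonsingular point. Its lift to $S(k+1)=\mathbf P\Delta(k)$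 is the closure of the curve of tangent directions at nonsingular points; it is again a focal curve germ. Iterated lifts of $C(k)$ are written $C(j)$, $j\ge k$, located at $p_j\in S(j)$. A germ is critical if it projects to a single point of $S$; a tangent direction to a critical germ is also called critical. A focal curve germ is regular if it is nonsingular and its tangent direction at its location is not critical. $C(k)$ is regularizable if some $C(r)$, $r\ge k$, is regular; the least such $r$ is the regularization level. **RVT code word of a germ.** The code word of a regularizable focal curve germ $C(k)$ with regularization level $r$ is the word of length $r-k$ in $R,V,T$ obtained thus: (1) for $j=k+1,\dots,r$ record in position $j-k$ the symbol $V$ if $j\ge2$ and $p_j\in I_j$; the symbol $T$ if $p_j\in I_h[\ell]$ with $h\ge k+1$, $h\geq 2$, $\ell\ge1$, $h+\ell=j$; and $R$ otherwise; (2) if the resulting word begins with a $V$, replace this $V$ and all immediately succeeding $T$'s by $R$'s. **Multiplicities and vertical orders.** $m_j$ ($j\ge k$) is the multiplicity of $C(j)$ at $p_j$ on $S(j)$. For $k+2\le j\le r$, the vertical order $\operatorname{VO}_j=(C(r)\cdot I_j)_{p_r}$ is the intersection number at $p_r$ of $C(r)$ with the complete inverse image of $I_j$ on $S(r)$; equivalently, it is the order of vanishing, along a parameterization of $C(r)$, of a function locally defining $I_j$ (so it is $0$ if $p_r$ does not lie on this inverse image). *)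

theory Defs
  imports "HOL-Analysis.Analysis"
begin

text \<open>
  The ground field is a type of class \<open>real_normed_field\<close>; up to isomorphism these are exactly the
  real and the complex numbers, so ``smooth'' means infinitely differentiable over the reals and
  holomorphic over the complex numbers.

  The dimension of the space \<open>S(k)\<close> depends on the number \<open>k\<close>, so coordinate vectors are functions
  on the natural numbers which vanish from the dimension on.
\<close>

definition coord_space :: "nat \<Rightarrow> (nat \<Rightarrow> 'k::real_normed_field) set" where
  "coord_space n = {x. \<forall>i\<ge>n. x i = 0}"

definition partial :: "nat \<Rightarrow> ((nat \<Rightarrow> 'k::real_normed_field) \<Rightarrow> 'k) \<Rightarrow> (nat \<Rightarrow> 'k) \<Rightarrow> 'k" where
  "partial i f x = deriv (\<lambda>h. f (x(i := h))) (x i)"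

text \<open>\<open>C_on n m W f\<close>: \<open>f\<close> is \<open>m\<close> times continuously differentiable on the open subset \<open>W\<close>
  of the \<open>n\<close>-dimensional coordinate space.\<close>

primrec C_on :: "nat \<Rightarrow> nat \<Rightarrow> (nat \<Rightarrow> 'k::real_normed_field) set \<Rightarrow> ((nat \<Rightarrow> 'k) \<Rightarrow> 'k) \<Rightarrow> bool" where
  "C_on n 0 W f \<longleftrightarrow> continuous_on W f"
| "C_on n (Suc m) W f \<longleftrightarrow> continuous_on W f \<and>
     (\<forall>i<n. (\<forall>x\<in>W. (\<lambda>h. f (x(i := h))) field_differentiable at (x i)) \<and>
            C_on n m W (partial i f))"

definition smooth_on :: "nat \<Rightarrow> (nat \<Rightarrow> 'k::real_normed_field) set \<Rightarrow> ((nat \<Rightarrow> 'k) \<Rightarrow> 'k) \<Rightarrow> bool" where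
  "smooth_on n W f \<longleftrightarrow> (\<forall>m. C_on n m W f)"

text \<open>Smoothness and order of vanishing at \<open>0\<close> of a function germ of one variable.\<close>

definition smooth_germ :: "('k::real_normed_field \<Rightarrow> 'k) \<Rightarrow> bool" where
  "smooth_germ f \<longleftrightarrow> (\<forall>\<^sub>F t in nhds 0. \<forall>m. (deriv ^^ m) f field_differentiable at t)"

definition has_order :: "('k::real_normed_field \<Rightarrow> 'k) \<Rightarrow> nat \<Rightarrow> bool" where
  "has_order f n \<longleftrightarrow> (deriv ^^ n) f 0 \<noteq> 0 \<and> (\<forall>i<n. (deriv ^^ i) f 0 = 0)"


section \<open>Charts and tangent vectors\<close>

text \<open>A chart is a domain together with a coordinate map.\<close>

type_synonym ('p, 'k) chart = "'p set \<times> ('p \<Rightarrow> nat \<Rightarrow> 'k)"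

definition smooth_surface :: "('a::{t2_space,second_countable_topology}, 'k::real_normed_field) chart set \<Rightarrow> bool" where
  "smooth_surface S \<longleftrightarrow>
     (\<forall>(U, x)\<in>S. open U \<and> openin (top_of_set (coord_space 2)) (x ` U) \<and>
                 (\<exists>y. homeomorphism U (x ` U) x y)) \<and>
     (\<forall>(U, x)\<in>S. \<forall>(V, y)\<in>S. \<forall>i<2. smooth_on 2 (x ` (U \<inter> V)) (\<lambda>c. y (inv_into U x c) i))"

text \<open>
  A tangent vector at \<open>p\<close> is given by its coordinates in one fixed chart around \<open>p\<close>, the preferred
  chart at \<open>p\<close>. Tangent vectors and differentials are computed with smooth curves.
\<close>

definition chart_at :: "('p, 'k) chart set \<Rightarrow> 'p \<Rightarrow> ('p, 'k) chart" where
  "chart_at \<A> p = (SOME c. c \<in> \<A> \<and> p \<in> fst c)"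

definition velocity :: "('p, 'k::real_normed_field) chart \<Rightarrow> ('k \<Rightarrow> 'p) \<Rightarrow> 'k \<Rightarrow> nat \<Rightarrow> 'k" where
  "velocity c \<gamma> t = (\<lambda>i. deriv (\<lambda>s. snd c (\<gamma> s) i) t)"

definition tangent :: "('p, 'k::real_normed_field) chart set \<Rightarrow> ('k \<Rightarrow> 'p) \<Rightarrow> 'k \<Rightarrow> nat \<Rightarrow> 'k" where
  "tangent \<A> \<gamma> t = velocity (chart_at \<A> (\<gamma> t)) \<gamma> t"

definition smooth_curve :: "('p, 'k::real_normed_field) chart set \<Rightarrow> ('k \<Rightarrow> 'p) \<Rightarrow> bool" where
  "smooth_curve \<A> \<gamma> \<longleftrightarrow>
     (\<exists>c\<in>\<A>. (\<forall>\<^sub>F t in nhds 0. \<gamma> t \<in> fst c) \<and> (\<forall>i. smooth_germ (\<lambda>t. snd c (\<gamma> t) i)))"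

text \<open>The tangent space at \<open>p\<close> of a submanifold \<open>N\<close> of the manifold with atlas \<open>\<A>\<close>.\<close>

definition tangent_space :: "('p, 'k::real_normed_field) chart set \<Rightarrow> 'p set \<Rightarrow> 'p \<Rightarrow> (nat \<Rightarrow> 'k) set" where
  "tangent_space \<A> N p =
     {tangent \<A> \<gamma> 0 |\<gamma>. smooth_curve \<A> \<gamma> \<and> \<gamma> 0 = p \<and> (\<forall>\<^sub>F t in nhds 0. \<gamma> t \<in> N)}"

text \<open>A curve through \<open>p\<close> with tangent vector \<open>v\<close>: a straight line in the preferred chart.\<close>

definition curve_along :: "('p, 'k::real_normed_field) chart set \<Rightarrow> 'p \<Rightarrow> (nat \<Rightarrow> 'k) \<Rightarrow> 'k \<Rightarrow> 'p" where
  "curve_along \<A> p v h =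
     (let (U, x) = chart_at \<A> p in inv_into U x (\<lambda>i. x p i + h * v i))"

text \<open>The coordinates in the chart \<open>c\<close> of the tangent vector \<open>v\<close> at \<open>p\<close>: \<open>d_coord \<A> c p v i\<close> is the
  value on \<open>v\<close> of the differential of the \<open>i\<close>th coordinate function of \<open>c\<close>.\<close>

definition d_coord :: "('p, 'k::real_normed_field) chart set \<Rightarrow> ('p, 'k) chart \<Rightarrow> 'p \<Rightarrow> (nat \<Rightarrow> 'k) \<Rightarrow> nat \<Rightarrow> 'k" where
  "d_coord \<A> c p v = velocity c (curve_along \<A> p v) 0"

definition line_through :: "(nat \<Rightarrow> 'k::real_normed_field) \<Rightarrow> (nat \<Rightarrow> 'k) set" where
  "line_through v = {(\<lambda>i. a * v i) |a. True}"


section \<open>Prolongation\<close>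

text \<open>The points of all spaces of the tower: \<open>Dir p L\<close> is the line \<open>L\<close> of tangent vectors at \<open>p\<close>.\<close>

datatype ('a, 'k) pt = Base 'a | Dir "('a, 'k) pt" "(nat \<Rightarrow> 'k) set"

primrec proj :: "('a, 'k) pt \<Rightarrow> ('a, 'k) pt" where
  "proj (Base a) = Base a"
| "proj (Dir p L) = p"

primrec base_point :: "('a, 'k) pt \<Rightarrow> 'a" where
  "base_point (Base a) = a"
| "base_point (Dir p L) = base_point p"

type_synonym ('a, 'k) distr = "('a, 'k) pt \<Rightarrow> (nat \<Rightarrow> 'k) set"

definition d_proj :: "(('a, 'k) pt, 'k::real_normed_field) chart set \<Rightarrow> (('a, 'k) pt, 'k) chart set \<Rightarrow>
    ('a, 'k) pt \<Rightarrow> (nat \<Rightarrow> 'k) \<Rightarrow> nat \<Rightarrow> 'k" where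
  "d_proj \<A>' \<A> p v = tangent \<A> (proj \<circ> curve_along \<A>' p v) 0"

text \<open>The total space of the projectivization of a distribution \<open>D\<close> on \<open>N\<close>.\<close>

definition projectivization :: "('a, 'k::real_normed_field) pt set \<Rightarrow> ('a, 'k) distr \<Rightarrow> ('a, 'k) pt set" where
  "projectivization N D = {Dir p (line_through v) |p v. p \<in> N \<and> v \<in> D p \<and> v \<noteq> (\<lambda>_. 0)}"

text \<open>
  The prolongation of a distribution \<open>D\<close> on \<open>N\<close>. Here \<open>N\<close> is a submanifold of a manifold with
  atlas \<open>\<A>\<close>, and its projectivization is a submanifold of a manifold with atlas \<open>\<A>'\<close>.
\<close>

definition prolong_distr :: "(('a, 'k) pt, 'k::real_normed_field) chart set \<Rightarrow> (('a, 'k) pt, 'k) chart set \<Rightarrow>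
    ('a, 'k) pt set \<Rightarrow> ('a, 'k) distr \<Rightarrow> ('a, 'k) distr" where
  "prolong_distr \<A> \<A>' N D q =
     (case q of
        Base a \<Rightarrow> {}
      | Dir p L \<Rightarrow> {v \<in> tangent_space \<A>' (projectivization N D) q. d_proj \<A>' \<A> q v \<in> L})"

text \<open>
  Charts on the projectivization of a rank 2 distribution \<open>D\<close> on an \<open>n\<close>-dimensional manifold \<open>M\<close>.
  Let \<open>x\<close> be a chart of \<open>M\<close> such that \<open>dx\<^sub>a\<close>, \<open>dx\<^sub>b\<close> are independent on \<open>D\<close>. On the set
  of lines where \<open>dx\<^sub>a\<close> does not vanish, add to the coordinates
  \<open>x\<^sub>0, \<dots>, x\<^sub>n\<^sub>-\<^sub>1\<close> the affine fiber coordinate \<open>x\<^sub>n = dx\<^sub>b / dx\<^sub>a\<close>.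
\<close>

definition prolong_chart :: "nat \<Rightarrow> (('a, 'k) pt, 'k::real_normed_field) chart set \<Rightarrow> ('a, 'k) pt set \<Rightarrow>
    ('a, 'k) distr \<Rightarrow> (('a, 'k) pt, 'k) chart \<Rightarrow> nat \<Rightarrow> nat \<Rightarrow> (('a, 'k) pt, 'k) chart" where
  "prolong_chart n \<A> M D c a b =
     ({Dir p (line_through v) |p v. p \<in> M \<and> p \<in> fst c \<and> v \<in> D p \<and>
         (\<forall>w\<in>D p. d_coord \<A> c p w a = 0 \<and> d_coord \<A> c p w b = 0 \<longrightarrow> w = (\<lambda>_. 0)) \<and>
         d_coord \<A> c p v a \<noteq> 0},
      \<lambda>q. case q of
            Base s \<Rightarrow> (\<lambda>_. 0)
          | Dir p L \<Rightarrow> (snd c p)(n := (THE m. \<forall>v\<in>L. d_coord \<A> c p v b = m * d_coord \<A> c p v a)))"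

definition prolong_atlas :: "nat \<Rightarrow> (('a, 'k) pt, 'k::real_normed_field) chart set \<Rightarrow> ('a, 'k) pt set \<Rightarrow>
    ('a, 'k) distr \<Rightarrow> (('a, 'k) pt, 'k) chart set" where
  "prolong_atlas n \<A> M D = {prolong_chart n \<A> M D c a b |c a b. c \<in> \<A> \<and> a < n \<and> b < n}"


section \<open>The monster tower and the divisors at infinity\<close>

record ('a, 'k) stage =
  points :: "('a, 'k) pt set"
  atlas :: "(('a, 'k) pt, 'k) chart set"
  focal :: "('a, 'k) distr"

definition base_points :: "('a, 'k) chart set \<Rightarrow> ('a, 'k) pt set" where
  "base_points S = (\<Union>(U, x)\<in>S. Base ` U)"

definition base_atlas :: "('a, 'k) chart set \<Rightarrow> (('a, 'k) pt, 'k) chart set" where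
  "base_atlas S = (\<lambda>(U, x). (Base ` U, x \<circ> base_point)) ` S"

definition base_stage :: "('a, 'k::real_normed_field) chart set \<Rightarrow> ('a, 'k) stage" where
  "base_stage S = \<lparr>points = base_points S, atlas = base_atlas S,
                   focal = tangent_space (base_atlas S) (base_points S)\<rparr>"

definition prolong_stage :: "nat \<Rightarrow> ('a, 'k::real_normed_field) stage \<Rightarrow> ('a, 'k) stage" where
  "prolong_stage n X =
     (let \<A>' = prolong_atlas n (atlas X) (points X) (focal X) in
      \<lparr>points = projectivization (points X) (focal X), atlas = \<A>',
       focal = prolong_distr (atlas X) \<A>' (points X) (focal X)\<rparr>)"

text \<open>\<open>tower S k\<close> consists of the \<open>(k+2)\<close>-dimensional manifold \<open>S(k)\<close> and its focal bundle.\<close>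

primrec tower :: "('a, 'k::real_normed_field) chart set \<Rightarrow> nat \<Rightarrow> ('a, 'k) stage" where
  "tower S 0 = base_stage S"
| "tower S (Suc k) = prolong_stage (k + 2) (tower S k)"

text \<open>The submanifolds \<open>N\<^sub>i\<close> of \<open>S(j-1+i)\<close> with their line bundles \<open>E\<^sub>i\<close>, for \<open>j \<ge> 2\<close>.\<close>

primrec vertical_prolongation :: "('a, 'k::real_normed_field) chart set \<Rightarrow> nat \<Rightarrow> nat \<Rightarrow>
    ('a, 'k) pt set \<times> ('a, 'k) distr" where
  "vertical_prolongation S j 0 =
     (points (tower S (j - 1)),
      \<lambda>p. {v \<in> focal (tower S (j - 1)) p.
             d_proj (atlas (tower S (j - 1))) (atlas (tower S (j - 2))) p v = (\<lambda>_. 0)})"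
| "vertical_prolongation S j (Suc i) =
     (let (N, E) = vertical_prolongation S j i in
      (projectivization N E,
       prolong_distr (atlas (tower S (j - 1 + i))) (atlas (tower S (j + i))) N E))"

text \<open>The prolonged divisor \<open>I\<^sub>j[l]\<close> on \<open>S(j+l)\<close>; the divisor \<open>I\<^sub>j\<close> itself is \<open>I\<^sub>j[0]\<close>.\<close>

definition divisor :: "('a, 'k::real_normed_field) chart set \<Rightarrow> nat \<Rightarrow> nat \<Rightarrow> ('a, 'k) pt set" where
  "divisor S j l = fst (vertical_prolongation S j (Suc l))"


section \<open>Focal curve germs\<close>

text \<open>
  A curve germ is given by a parameterization, with parameter value \<open>0\<close> at the location of the
  germ. Local irreducibility is expressed by an injective parameterization: over the complex
  numbers this is the normalization of an irreducible germ, so that singular points of the germ are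
  the points where the parameterization has zero velocity. Over the real numbers the latter is not
  automatic (consider \<open>t\<^sup>3\<close> on the real line), but it does hold for parameterizations of which some
  iterated lift is regular in the sense below, and only those occur for regularizable germs.
\<close>

definition nonsingular_at :: "('a, 'k::real_normed_field) chart set \<Rightarrow> nat \<Rightarrow> ('k \<Rightarrow> ('a, 'k) pt) \<Rightarrow> 'k \<Rightarrow> bool" where
  "nonsingular_at S k \<gamma> t \<longleftrightarrow> tangent (atlas (tower S k)) \<gamma> t \<noteq> (\<lambda>_. 0)"

definition focal_germ :: "('a, 'k::real_normed_field) chart set \<Rightarrow> nat \<Rightarrow> ('k \<Rightarrow> ('a, 'k) pt) \<Rightarrow> bool" where
  "focal_germ S k \<gamma> \<longleftrightarrow>
     smooth_curve (atlas (tower S k)) \<gamma> \<and>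
     (\<exists>e>0. inj_on \<gamma> (ball 0 e)) \<and>
     (\<forall>\<^sub>F t in nhds 0. nonsingular_at S k \<gamma> t \<longrightarrow>
        tangent (atlas (tower S k)) \<gamma> t \<in> focal (tower S k) (\<gamma> t))"

text \<open>The point of \<open>S(k+1)\<close> given by the tangent direction at the parameter value \<open>t\<close>.\<close>

definition tangent_direction :: "('a, 'k::real_normed_field) chart set \<Rightarrow> nat \<Rightarrow> ('k \<Rightarrow> ('a, 'k) pt) \<Rightarrow> 'k \<Rightarrow> ('a, 'k) pt" where
  "tangent_direction S k \<gamma> t = Dir (\<gamma> t) (line_through (tangent (atlas (tower S k)) \<gamma> t))"

text \<open>
  \<open>\<delta>\<close> is the lift of \<open>\<gamma>\<close>. Since \<open>\<delta>\<close> is continuous, \<open>\<delta> 0\<close> is the limit of the tangent directions at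
  nearby nonsingular points. Over the complex numbers every focal curve germ has a lift, and its
  points near the location are nonsingular, except possibly the location itself.
\<close>

definition is_lift :: "('a, 'k::real_normed_field) chart set \<Rightarrow> nat \<Rightarrow> ('k \<Rightarrow> ('a, 'k) pt) \<Rightarrow> ('k \<Rightarrow> ('a, 'k) pt) \<Rightarrow> bool" where
  "is_lift S k \<gamma> \<delta> \<longleftrightarrow>
     focal_germ S (Suc k) \<delta> \<and>
     (\<forall>\<^sub>F t in at 0. nonsingular_at S k \<gamma> t \<and> \<delta> t = tangent_direction S k \<gamma> t)"

text \<open>\<open>C j\<close>, for \<open>j \<ge> k\<close>, are the iterated lifts of the focal curve germ \<open>C k\<close> on \<open>S(k)\<close>.\<close>

definition lifted_germ :: "('a, 'k::real_normed_field) chart set \<Rightarrow> nat \<Rightarrow> (nat \<Rightarrow> 'k \<Rightarrow> ('a, 'k) pt) \<Rightarrow> bool" where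
  "lifted_germ S k C \<longleftrightarrow> focal_germ S k (C k) \<and> (\<forall>j\<ge>k. is_lift S j (C j) (C (Suc j)))"

definition critical_germ :: "('a, 'k::real_normed_field) chart set \<Rightarrow> nat \<Rightarrow> ('k \<Rightarrow> ('a, 'k) pt) \<Rightarrow> bool" where
  "critical_germ S k \<gamma> \<longleftrightarrow>
     focal_germ S k \<gamma> \<and> (\<exists>s. \<forall>\<^sub>F t in nhds 0. base_point (\<gamma> t) = s)"

text \<open>Tangent directions on \<open>S(k)\<close> are points of \<open>S(k+1)\<close>; a possibly singular germ is tangent at
  its location to the direction given by the location of its lift.\<close>

definition critical_direction :: "('a, 'k::real_normed_field) chart set \<Rightarrow> nat \<Rightarrow> ('a, 'k) pt \<Rightarrow> bool" where
  "critical_direction S k q \<longleftrightarrow> (\<exists>\<gamma> \<delta>. critical_germ S k \<gamma> \<and> is_lift S k \<gamma> \<delta> \<and> \<delta> 0 = q)"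

definition regular_germ :: "('a, 'k::real_normed_field) chart set \<Rightarrow> nat \<Rightarrow> ('k \<Rightarrow> ('a, 'k) pt) \<Rightarrow> bool" where
  "regular_germ S k \<gamma> \<longleftrightarrow>
     focal_germ S k \<gamma> \<and> nonsingular_at S k \<gamma> 0 \<and>
     \<not> critical_direction S k (tangent_direction S k \<gamma> 0)"

definition regularizable :: "('a, 'k::real_normed_field) chart set \<Rightarrow> nat \<Rightarrow> (nat \<Rightarrow> 'k \<Rightarrow> ('a, 'k) pt) \<Rightarrow> bool" where
  "regularizable S k C \<longleftrightarrow> (\<exists>r\<ge>k. regular_germ S r (C r))"

definition reg_level :: "('a, 'k::real_normed_field) chart set \<Rightarrow> nat \<Rightarrow> (nat \<Rightarrow> 'k \<Rightarrow> ('a, 'k) pt) \<Rightarrow> nat" where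
  "reg_level S k C = (LEAST r. k \<le> r \<and> regular_germ S r (C r))"


section \<open>Code words\<close>

datatype rvt = R | V | T

definition raw_symbol :: "('a, 'k::real_normed_field) chart set \<Rightarrow> nat \<Rightarrow> (nat \<Rightarrow> 'k \<Rightarrow> ('a, 'k) pt) \<Rightarrow> nat \<Rightarrow> rvt" where
  "raw_symbol S k C j =
     (if 2 \<le> j \<and> C j 0 \<in> divisor S j 0 then V
      else if \<exists>h l. k + 1 \<le> h \<and> 2 \<le> h \<and> 1 \<le> l \<and> h + l = j \<and> C j 0 \<in> divisor S h l then T
      else R)"

fun adjust_word :: "rvt list \<Rightarrow> rvt list" where
  "adjust_word (V # w) =
     R # map (\<lambda>_. R) (takeWhile (\<lambda>s. s = T) w) @ dropWhile (\<lambda>s. s = T) w"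
| "adjust_word w = w"

definition code_word :: "('a, 'k::real_normed_field) chart set \<Rightarrow> nat \<Rightarrow> (nat \<Rightarrow> 'k \<Rightarrow> ('a, 'k) pt) \<Rightarrow> rvt list" where
  "code_word S k C = adjust_word (map (raw_symbol S k C) [k + 1..<reg_level S k C + 1])"


section \<open>Multiplicities and vertical orders\<close>

definition smooth_function :: "('a, 'k::real_normed_field) chart set \<Rightarrow> nat \<Rightarrow> (('a, 'k) pt \<Rightarrow> 'k) \<Rightarrow> ('a, 'k) pt \<Rightarrow> bool" where
  "smooth_function S k f p \<longleftrightarrow>
     (\<exists>(U, x)\<in>atlas (tower S k). \<exists>W. p \<in> U \<and> x p \<in> W \<and> W \<subseteq> x ` U \<and>
        openin (top_of_set (coord_space (k + 2))) W \<and> smooth_on (k + 2) W (f \<circ> inv_into U x))"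

text \<open>The multiplicity of an irreducible germ is the least order of vanishing, along the
  parameterization, of a function vanishing at its location.\<close>

definition germ_multiplicity :: "('a, 'k::real_normed_field) chart set \<Rightarrow> nat \<Rightarrow> ('k \<Rightarrow> ('a, 'k) pt) \<Rightarrow> nat" where
  "germ_multiplicity S k \<gamma> =
     (LEAST n. \<exists>f. smooth_function S k f (\<gamma> 0) \<and> f (\<gamma> 0) = 0 \<and> has_order (f \<circ> \<gamma>) n)"

text \<open>\<open>f\<close> locally defines the divisor \<open>I\<^sub>j\<close> near the point \<open>p\<close> of \<open>S(j)\<close>: its zero set is
  \<open>I\<^sub>j\<close>, and its differential does not vanish there. If \<open>p\<close> is not on \<open>I\<^sub>j\<close>, this is a unit.\<close>

definition local_equation :: "('a, 'k::real_normed_field) chart set \<Rightarrow> nat \<Rightarrow> (('a, 'k) pt \<Rightarrow> 'k) \<Rightarrow> ('a, 'k) pt \<Rightarrow> bool" where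
  "local_equation S j f p \<longleftrightarrow>
     (\<exists>(U, x)\<in>atlas (tower S j). \<exists>W. p \<in> U \<and> x p \<in> W \<and> W \<subseteq> x ` U \<and>
        openin (top_of_set (coord_space (j + 2))) W \<and> smooth_on (j + 2) W (f \<circ> inv_into U x) \<and>
        (\<forall>q\<in>U. x q \<in> W \<longrightarrow> (q \<in> divisor S j 0 \<longleftrightarrow> f q = 0)) \<and>
        (p \<in> divisor S j 0 \<longrightarrow> (\<exists>i<j + 2. partial i (f \<circ> inv_into U x) (x p) \<noteq> 0)))"

text \<open>The intersection number at \<open>p\<^sub>r\<close> of \<open>C(r)\<close> with the inverse image of \<open>I\<^sub>j\<close> on \<open>S(r)\<close>,
  where \<open>r\<close> is the regularization level.\<close>

definition vertical_order :: "('a, 'k::real_normed_field) chart set \<Rightarrow> nat \<Rightarrow> (nat \<Rightarrow> 'k \<Rightarrow> ('a, 'k) pt) \<Rightarrow> nat \<Rightarrow> nat" where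
  "vertical_order S k C j =
     (let r = reg_level S k C; \<pi> = proj ^^ (r - j) in
      THE n. \<exists>f. local_equation S j f (\<pi> (C r 0)) \<and> has_order (f \<circ> \<pi> \<circ> C r) n)"

end

theory Submission
  imports Defs
begin

text \<open>
  Along the germ, use charts of the tower in which the focal bundle of each level \<open>S(i)\<close> is parametrized
  by the differentials of two coordinates: one retained from the level below, of order \<open>e\<^sub>i\<close> along \<open>C(i)\<close>,
  and the newest one, of order \<open>d\<^sub>i\<close>. The differential of the coordinate retained at level \<open>i + 1\<close>
  divides all others along \<open>C(i)\<close>, hence \<open>m\<^sub>i = e\<^sub>i\<^sub>+\<^sub>1\<close>. If \<open>p\<^sub>i\<^sub>+\<^sub>1 \<in> I\<^sub>i\<^sub>+\<^sub>1\<close>, then the coordinate that gets newest at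
  level \<open>i + 1\<close> is the quotient of the differentials of the retained and the newest coordinate of level \<open>i\<close>,
  and it is a local equation of \<open>I\<^sub>i\<^sub>+\<^sub>1\<close>; so its order \<open>d\<^sub>i\<^sub>+\<^sub>1 = e\<^sub>i - e\<^sub>i\<^sub>+\<^sub>1\<close> is the vertical order. Otherwise
  \<open>e\<^sub>i = e\<^sub>i\<^sub>+\<^sub>1\<close> and the vertical order vanishes.

  The prolonged divisor \<open>I\<^sub>h[l]\<close> is cut out one level up by the condition that the differential of the
  newest coordinate vanishes. So the code word tells how \<open>(e\<^sub>i, d\<^sub>i)\<close> arises from \<open>(e\<^sub>i\<^sub>+\<^sub>1, d\<^sub>i\<^sub>+\<^sub>1)\<close>, where
  \<open>d\<^sub>i\<close> matters only at points of prolonged divisors, and the recursion starts with \<open>(1, 1)\<close> at the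
  regularization level, since the directions tangent to prolonged divisors are critical.
\<close>

section \<open>Functions of one variable\<close>

text \<open>No coordinate has an order a priori, since a smooth function along the curve may be
  flat. Finiteness is created at the regularization level, where a nonvanishing differential gives
  order 1, and it descends because each step either keeps a coordinate or multiplies a velocity by a
  slope of known order.

  That slope is the obstacle. On a (prolonged) divisor it vanishes at the location, so it is itself
  the centered newest coordinate of the next level, whose order is known; just after leaving a
  prolonged divisor it is a unit. At an \<open>R\<close> preceded by an \<open>R\<close> neither
  holds, and the order of the newest coordinate may be anything from \<open>e\<close> on, or not
  exist. Hence its order is claimed only for \<open>raw i \<noteq> R\<close>, and this weaker claim
  still feeds the recursion.

  Orders are handled as nonzero limits of \<open>f t / t ^ n\<close>: these multiply, and they need
  equations only for \<open>t \<noteq> 0\<close>, where a lift is prescribed. The parameter 0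
  follows by continuity, once smooth curves in the tower that agree off 0 are known to agree at 0.
  Points of the tower carry no topology, so this is proved level by level.\<close>

primrec times_diff :: "nat \<Rightarrow> 'k::real_normed_field set \<Rightarrow> ('k \<Rightarrow> 'k) \<Rightarrow> bool" where
  "times_diff 0 G h \<longleftrightarrow> True"
| "times_diff (Suc m) G h \<longleftrightarrow> (\<forall>t\<in>G. h field_differentiable at t) \<and> times_diff m G (deriv h)"

lemma deriv_cong_open:
  assumes "open G" "t \<in> G" "\<And>s. s \<in> G \<Longrightarrow> f s = g s"
  shows "deriv f t = deriv g t"
  by (rule deriv_cong_ev) (use assms in \<open>auto simp: eventually_nhds\<close>)

lemma field_differentiable_cong_ev:
  assumes "eventually (\<lambda>s. f s = g s) (nhds t)" "f field_differentiable at t"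
  shows "g field_differentiable at t"
  using assms unfolding field_differentiable_def by (metis DERIV_cong_ev)

lemma field_differentiable_cong_open:
  assumes "open G" "t \<in> G" "\<And>s. s \<in> G \<Longrightarrow> f s = g s" "f field_differentiable at t"
  shows "g field_differentiable at t"
  by (rule field_differentiable_cong_ev[OF _ assms(4)]) (use assms in \<open>auto simp: eventually_nhds\<close>)

lemma times_diff_cong:
  assumes "open G" "\<And>s. s \<in> G \<Longrightarrow> f s = g s" "times_diff m G f"
  shows "times_diff m G g"
  using assms(2,3)
proof (induction m arbitrary: f g)
  case (Suc m)
  have "times_diff m G (deriv g)"
    by (rule Suc.IH[of "deriv f"]) (use Suc.prems in \<open>auto intro: deriv_cong_open[OF assms(1)]\<close>)
  then show ?case using Suc.prems field_differentiable_cong_open[OF assms(1)] by fastforce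
qed auto

lemma times_diff_SucD: "times_diff (Suc m) G h \<Longrightarrow> times_diff m G h"
  by (induction m arbitrary: h) auto

lemma times_diff_add:
  assumes "open G" "times_diff m G f" "times_diff m G g"
  shows "times_diff m G (\<lambda>t. f t + g t)"
  using assms(2,3)
proof (induction m arbitrary: f g)
  case (Suc m)
  have "times_diff m G (deriv (\<lambda>t. f t + g t))"
    by (rule times_diff_cong[OF assms(1) _ Suc.IH[of "deriv f" "deriv g"]])
       (use Suc.prems in auto)
  then show ?case using Suc.prems by (auto intro: derivative_intros)
qed auto

lemma times_diff_mult:
  assumes "open G" "times_diff m G f" "times_diff m G g"
  shows "times_diff m G (\<lambda>t. f t * g t)"
  using assms(2,3)
proof (induction m arbitrary: f g)
  case (Suc m)
  then have *: "times_diff m G f" "times_diff m G g" by (blast dest: times_diff_SucD)+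
  have "times_diff m G (deriv (\<lambda>t. f t * g t))"
    by (rule times_diff_cong[OF assms(1) _
          times_diff_add[OF assms(1) Suc.IH[of f "deriv g"] Suc.IH[of "deriv f" g]]])
       (use Suc.prems * in auto)
  then show ?case using Suc.prems by (auto intro: derivative_intros)
qed auto

lemma times_diff_const: "times_diff m G (\<lambda>t. c)"
proof (induction m arbitrary: c)
  case (Suc m)
  have "deriv (\<lambda>t. c) = (\<lambda>t. 0)" by auto
  then show ?case using Suc by auto
qed auto

lemma times_diff_sum:
  assumes "open G" "\<And>i. i \<in> I \<Longrightarrow> times_diff m G (f i)"
  shows "times_diff m G (\<lambda>t. \<Sum>i\<in>I. f i t)"
  using assms(2)
  by (induction I rule: infinite_finite_induct)
     (auto intro: times_diff_const times_diff_add[OF assms(1)])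

text \<open>The condition under the eventuality in \<open>smooth_germ\<close>; stated at a single
  point, it lets finitely many germs be given a common neighbourhood.\<close>

definition smooth_at_pt :: "('k::real_normed_field \<Rightarrow> 'k) \<Rightarrow> 'k \<Rightarrow> bool" where
  "smooth_at_pt h t \<longleftrightarrow> (\<forall>m. (deriv ^^ m) h field_differentiable at t)"

lemma times_diff_iff:
  "times_diff m G h \<longleftrightarrow> (\<forall>j<m. \<forall>t\<in>G. (deriv ^^ j) h field_differentiable at t)"
proof (induction m arbitrary: h)
  case (Suc m)
  have *: "(\<forall>j<Suc m. P j) \<longleftrightarrow> P 0 \<and> (\<forall>j<m. P (Suc j))" for P
    using less_Suc_eq_0_disj by auto
  show ?case by (subst *) (simp add: Suc funpow_Suc_right del: funpow.simps)
qed auto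

lemma smooth_at_pt_iff: "(\<forall>t\<in>G. smooth_at_pt h t) \<longleftrightarrow> (\<forall>m. times_diff m G h)"
  unfolding smooth_at_pt_def times_diff_iff by blast

lemma smooth_germ_iff:
  "smooth_germ h \<longleftrightarrow> (\<exists>G. open G \<and> 0 \<in> G \<and> (\<forall>m. times_diff m G h))"
  unfolding smooth_germ_def eventually_nhds smooth_at_pt_iff[symmetric] smooth_at_pt_def by blast

lemma smooth_germ_cong:
  assumes "\<forall>\<^sub>F t in nhds 0. f t = g t" "smooth_germ f"
  shows "smooth_germ g"
proof -
  obtain G where G: "open G" "0 \<in> G" "\<And>m. times_diff m G f"
    using assms(2) by (auto simp: smooth_germ_iff)
  obtain G' where G': "open G'" "0 \<in> G'" "\<And>t. t \<in> G' \<Longrightarrow> f t = g t"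
    using assms(1) by (auto simp: eventually_nhds)
  have "times_diff m (G \<inter> G') g" for m
    by (rule times_diff_cong[of _ f]) (use G G' in \<open>auto simp: times_diff_iff\<close>)
  then show ?thesis unfolding smooth_germ_iff using G G' by (intro exI[of _ "G \<inter> G'"]) auto
qed

lemma smooth_germ_const: "smooth_germ (\<lambda>t. c)"
  unfolding smooth_germ_iff by (rule exI[of _ UNIV]) (auto intro: times_diff_const)

lemma smooth_germ_affine: "smooth_germ (\<lambda>t. c + d * t)"
proof -
  have d: "((\<lambda>t. c + d * t) has_field_derivative d) (at t)" for t
    using DERIV_add[OF DERIV_const[of c] DERIV_cmult_Id[of d]] by simp
  have eq: "deriv (\<lambda>t. c + d * t) = (\<lambda>t. d)"
    by (rule ext) (rule DERIV_imp_deriv[OF d])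
  have diff: "(\<lambda>t. c + d * t) field_differentiable at t" for t
    unfolding field_differentiable_def by (rule exI) (rule d)
  have "times_diff m UNIV (\<lambda>t. c + d * t)" for m
  proof (cases m)
    case (Suc j)
    show ?thesis unfolding Suc times_diff.simps eq by (intro conjI ballI diff times_diff_const)
  qed simp
  then show ?thesis unfolding smooth_germ_iff by (intro exI[of _ UNIV]) simp
qed

lemma smooth_germ_deriv:
  assumes "smooth_germ h" shows "smooth_germ (deriv h)"
proof -
  obtain G where G: "open G" "0 \<in> G" "\<forall>m. times_diff m G h"
    using assms unfolding smooth_germ_iff by (elim exE conjE)
  from G(3) have "times_diff m G (deriv h)" for m by (auto dest: spec[of _ "Suc m"])
  then show ?thesis using G(1,2) unfolding smooth_germ_iff by (intro exI[of _ G]) simp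
qed

lemma smooth_germ_differentiable:
  assumes "smooth_germ h"
  shows "\<forall>\<^sub>F t in nhds 0. h field_differentiable at t"
proof -
  obtain G where "open G" "0 \<in> G" "times_diff (Suc 0) G h"
    using assms unfolding smooth_germ_iff by blast
  then show ?thesis by (auto simp: eventually_nhds)
qed

lemma smooth_germ_isCont: "smooth_germ h \<Longrightarrow> isCont h 0"
  by (rule field_differentiable_imp_continuous_at)
     (rule eventually_nhds_x_imp_x[OF smooth_germ_differentiable])

text \<open>Lifts are prescribed only for parameters different from 0; continuity carries their
  equations to the parameter 0.\<close>

lemma tendsto_unique_zero:
  fixes f g :: "'k::real_normed_field \<Rightarrow> 'k"
  assumes "\<forall>\<^sub>F t in at 0. f t = g t" "isCont f 0" "isCont g 0"
  shows "f 0 = g 0"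
proof -
  have "(g \<longlongrightarrow> f 0) (at 0)"
    using assms(1,2) tendsto_cong[of f g] by (simp add: isCont_def)
  from LIM_unique[OF this] show ?thesis using assms(3) by (simp add: isCont_def)
qed

lemma eventually_nhds_nhds: "eventually P (nhds a) \<Longrightarrow> \<forall>\<^sub>F t in nhds a. eventually P (nhds t)"
  by (simp add: eventually_eventually)

section \<open>Orders of vanishing as limits of quotients by powers\<close>

lemma has_order_unique: "has_order h n \<Longrightarrow> has_order h m \<Longrightarrow> n = m"
  by (cases n m rule: linorder_cases) (simp_all add: has_order_def)

lemma has_order_0: "has_order h 0 \<longleftrightarrow> h 0 \<noteq> 0"
  by (auto simp: has_order_def)

lemma has_order_Suc: "has_order h (Suc n) \<longleftrightarrow> h 0 = 0 \<and> has_order (deriv h) n"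
proof -
  have *: "(\<forall>j<Suc n. P j) \<longleftrightarrow> P 0 \<and> (\<forall>j<n. P (Suc j))" for P :: "nat \<Rightarrow> bool"
    using less_Suc_eq_0_disj by auto
  have **: "(deriv ^^ Suc j) h = (deriv ^^ j) (deriv h)" for j
    by (simp only: funpow_Suc_right o_apply)
  show ?thesis
    unfolding has_order_def *[of "\<lambda>i. (deriv ^^ i) h 0 = 0"] ** by auto
qed

text \<open>Both sides are choices from the same set of possible derivatives, so the equation also
  covers points where no derivative exists.\<close>

lemma deriv_diff_const:
  fixes h :: "'k::real_normed_field \<Rightarrow> 'k"
  shows "deriv (\<lambda>t. h t - c) = deriv h"
proof -
  have *: "((\<lambda>t. h t - c) has_field_derivative D) (at t) \<longleftrightarrow> (h has_field_derivative D) (at t)" for D t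
  proof
    assume "((\<lambda>t. h t - c) has_field_derivative D) (at t)"
    from DERIV_add[OF this DERIV_const[of c]] show "(h has_field_derivative D) (at t)" by simp
  qed (auto intro!: derivative_eq_intros)
  show ?thesis unfolding deriv_def * ..
qed

text \<open>The mean value inequality replaces Taylor's formula, which is not available over a general field.\<close>

lemma tendsto_div_power_of_deriv:
  fixes h :: "'k::real_normed_field \<Rightarrow> 'k"
  assumes d: "\<forall>\<^sub>F t in nhds 0. h field_differentiable at t" and "h 0 = 0" "isCont (deriv h) 0"
    and lim: "((\<lambda>t. deriv h t / t ^ n) \<longlongrightarrow> c) (at 0)"
  shows "((\<lambda>t. h t / t ^ Suc n) \<longlongrightarrow> c / of_nat (Suc n)) (at 0)"
proof (rule tendstoI)
  fix e :: real assume "e > 0"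
  let ?c = "c / of_nat (Suc n) :: 'k"
  define D where "D t = deriv h t - c * t ^ n" for t
  \<comment> \<open>\<open>D\<close> is the derivative of the remainder
    \<open>h t - ?c * t ^ Suc n\<close>. Its value at 0 matters because the closed ball in the mean
    value inequality contains 0; for \<open>n = 0\<close> it says that \<open>c\<close> is the
    derivative of \<open>h\<close> at 0.\<close>
  have D0: "D 0 = 0"
  proof -
    have "((\<lambda>t. deriv h t / t ^ n * t ^ n) \<longlongrightarrow> c * 0 ^ n) (at 0)"
      by (intro tendsto_intros lim)
    moreover have "\<forall>\<^sub>F t in at 0. deriv h t / t ^ n * t ^ n = deriv h t"
      unfolding eventually_at_filter by (intro always_eventually) simp
    ultimately have "(deriv h \<longlongrightarrow> c * 0 ^ n) (at 0)" by (rule Lim_transform_eventually)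
    from LIM_unique[OF _ this] have "deriv h 0 = c * 0 ^ n" using assms(3) by (simp add: isCont_def)
    then show ?thesis by (simp add: D_def)
  qed
  have "\<forall>\<^sub>F t in at 0. h field_differentiable at t \<and> dist (deriv h t / t ^ n) c < e / 2"
    using d tendstoD[OF lim, of "e/2"] \<open>e > 0\<close>
    by (intro eventually_conj) (auto simp: eventually_nhds_conv_at)
  then obtain r where r: "r > 0"
    "\<And>t. t \<noteq> 0 \<Longrightarrow> dist t 0 < r \<Longrightarrow> h field_differentiable at t \<and> dist (deriv h t / t ^ n) c < e / 2"
    by (auto simp: eventually_at)
  have d0: "h field_differentiable at 0" using d eventually_nhds_x_imp_x by blast
  have Db: "norm (D t) \<le> e / 2 * norm t ^ n" if "norm t < r" for t
  proof (cases "t = 0")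
    case False
    have "norm (deriv h t / t ^ n - c) * norm t ^ n \<le> e / 2 * norm t ^ n"
      using r(2)[of t] that False by (intro mult_right_mono) (auto simp: dist_norm)
    moreover have "norm (deriv h t / t ^ n - c) * norm t ^ n = norm ((deriv h t / t ^ n - c) * t ^ n)"
      by (simp add: norm_mult norm_power)
    moreover have "(deriv h t / t ^ n - c) * t ^ n = D t"
      using False by (simp add: left_diff_distrib D_def)
    ultimately show ?thesis by simp
  qed (use D0 \<open>e > 0\<close> in auto)
  have bound: "norm (h t - ?c * t ^ Suc n) \<le> e / 2 * norm t ^ Suc n" if "norm t < r" for t
  proof -
    have der: "((\<lambda>t. h t - ?c * t ^ Suc n) has_field_derivative D s) (at s)" if "norm s < r" for s
    proof -
      have "(h has_field_derivative deriv h s) (at s)"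
        using d0 r(2)[of s] that by (cases "s = 0") (auto simp: DERIV_deriv_iff_field_differentiable)
      moreover have "((\<lambda>t. t ^ Suc n) has_field_derivative of_nat (Suc n) * s ^ n) (at s)"
        using DERIV_power_Suc[OF DERIV_ident, of n s UNIV] by simp
      ultimately have "((\<lambda>t. h t - ?c * t ^ Suc n) has_field_derivative
          deriv h s - ?c * (of_nat (Suc n) * s ^ n)) (at s)"
        by (intro DERIV_diff DERIV_cmult)
      then show ?thesis unfolding D_def by (simp del: of_nat_Suc power_Suc)
    qed
    have "norm ((h t - ?c * t ^ Suc n) - (h 0 - ?c * 0 ^ Suc n)) \<le> (e / 2 * norm t ^ n) * norm (t - 0)"
    proof (rule field_differentiable_bound[where S = "cball (0::'k) (norm t)" and f' = D])
      fix s assume "s \<in> cball (0::'k) (norm t)"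
      then have s: "norm s \<le> norm t" "norm s < r" using that by auto
      show "((\<lambda>t. h t - ?c * t ^ Suc n) has_field_derivative D s) (at s within cball (0::'k) (norm t))"
        using der[OF s(2)] by (rule has_field_derivative_at_within)
      have "norm (D s) \<le> e / 2 * norm s ^ n" using Db[OF s(2)] .
      also have "\<dots> \<le> e / 2 * norm t ^ n" using s \<open>e > 0\<close> by (intro mult_left_mono power_mono) auto
      finally show "norm (D s) \<le> e / 2 * norm t ^ n" .
    qed auto
    then show ?thesis using \<open>h 0 = 0\<close> by (simp add: algebra_simps)
  qed
  have "dist (h t / t ^ Suc n) ?c < e" if t: "t \<noteq> 0" "norm t < r" for t
  proof -
    have "norm (h t / t ^ Suc n - ?c) * norm t ^ Suc n = norm ((h t / t ^ Suc n - ?c) * t ^ Suc n)"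
      by (simp only: norm_mult norm_power)
    also have "(h t / t ^ Suc n - ?c) * t ^ Suc n = h t - ?c * t ^ Suc n"
      using t(1) by (simp add: left_diff_distrib del: of_nat_Suc power_Suc)
    also have "norm \<dots> \<le> e / 2 * norm t ^ Suc n" using bound[OF t(2)] .
    finally have "norm (h t / t ^ Suc n - ?c) \<le> e / 2"
      by (rule mult_right_le_imp_le) (use t in auto)
    then show ?thesis using \<open>e > 0\<close> by (simp add: dist_norm)
  qed
  then show "\<forall>\<^sub>F t in at 0. dist (h t / t ^ Suc n) ?c < e"
    unfolding eventually_at using r(1) by (intro exI[of _ r]) auto
qed

text \<open>The limit is the leading Taylor coefficient: each passage from \<open>deriv h\<close>
  back to \<open>h\<close> divides it by \<open>Suc n\<close>, which is invertible, so it stays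
  nonzero.\<close>

lemma has_order_imp_tendsto:
  fixes h :: "'k::real_normed_field \<Rightarrow> 'k"
  assumes "smooth_germ h" "has_order h n"
  shows "\<exists>c. c \<noteq> 0 \<and> ((\<lambda>t. h t / t ^ n) \<longlongrightarrow> c) (at 0)"
  using assms
proof (induction n arbitrary: h)
  case 0
  then show ?case using smooth_germ_isCont[of h] by (auto simp: has_order_0 isCont_def)
next
  case (Suc n)
  then obtain c where c: "c \<noteq> 0" "((\<lambda>t. deriv h t / t ^ n) \<longlongrightarrow> c) (at 0)"
    by (auto simp: has_order_Suc dest: smooth_germ_deriv)
  have "((\<lambda>t. h t / t ^ Suc n) \<longlongrightarrow> c / of_nat (Suc n)) (at 0)"
    using Suc.prems c
    by (intro tendsto_div_power_of_deriv smooth_germ_differentiable smooth_germ_isCont smooth_germ_deriv)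
       (auto simp: has_order_Suc)
  then show ?case using c(1) by (intro exI[of _ "c / of_nat (Suc n)"]) (simp del: of_nat_Suc)
qed

lemma tendsto_imp_order_less_zero:
  fixes h :: "'k::real_normed_field \<Rightarrow> 'k"
  assumes "((\<lambda>t. h t / t ^ n) \<longlongrightarrow> c) (at 0)" "m < n"
  shows "((\<lambda>t. h t / t ^ m) \<longlongrightarrow> 0) (at 0)"
proof -
  have "((\<lambda>t. h t / t ^ n * t ^ (n - m)) \<longlongrightarrow> c * 0 ^ (n - m)) (at 0)"
    by (intro tendsto_intros assms)
  moreover have "h t / t ^ n * t ^ (n - m) = h t / t ^ m" if "t \<noteq> 0" for t
    using that assms(2) power_add[of t m "n - m"] by simp
  then have "\<forall>\<^sub>F t in at 0. h t / t ^ n * t ^ (n - m) = h t / t ^ m"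
    unfolding eventually_at_filter by (intro always_eventually allI impI)
  ultimately have "((\<lambda>t. h t / t ^ m) \<longlongrightarrow> c * 0 ^ (n - m)) (at 0)" by (rule Lim_transform_eventually)
  then show ?thesis using assms(2) by (simp add: power_0_left)
qed

text \<open>If all derivatives up to the \<open>n\<close>th vanished at 0, the quotient would tend
  to 0 (\<open>flat\<close>), so an order exists and is at most \<open>n\<close>. A smaller order
  \<open>m\<close> would make \<open>h t / t ^ m\<close> tend both to a nonzero value and to 0
  (\<open>low\<close>). This is how the existence of an order is obtained.\<close>

lemma has_order_if_tendsto:
  fixes h :: "'k::real_normed_field \<Rightarrow> 'k"
  assumes "smooth_germ h" "((\<lambda>t. h t / t ^ n) \<longlongrightarrow> c) (at 0)" "c \<noteq> 0"
  shows "has_order h n"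
  using assms
proof -
  have low: False if less: "has_order h m" "m < n" for m
  proof -
    obtain d where d: "d \<noteq> 0" "((\<lambda>t. h t / t ^ m) \<longlongrightarrow> d) (at 0)"
      using has_order_imp_tendsto[OF assms(1) less(1)] by blast
    from LIM_unique[OF d(2) tendsto_imp_order_less_zero[OF assms(2) less(2)]] show False using d by simp
  qed
  have flat: "((\<lambda>t. g t / t ^ j) \<longlongrightarrow> 0) (at 0)"
    if "smooth_germ g" "\<forall>i\<le>j. (deriv ^^ i) g 0 = 0" for g :: "'k \<Rightarrow> 'k" and j
    using that
  proof (induction j arbitrary: g)
    case 0
    then show ?case using smooth_germ_isCont[of g] by (auto simp: isCont_def)
  next
    case (Suc j)
    have "(deriv ^^ i) (deriv g) 0 = 0" if "i \<le> j" for i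
      using Suc.prems(2)[rule_format, of "Suc i"] that by (simp add: funpow_Suc_right del: funpow.simps)
    then have "((\<lambda>t. deriv g t / t ^ j) \<longlongrightarrow> 0) (at 0)"
      by (intro Suc.IH smooth_germ_deriv[OF Suc.prems(1)]) simp
    moreover have "g 0 = 0" using Suc.prems(2)[rule_format, of 0] by simp
    ultimately show ?case
      using tendsto_div_power_of_deriv[of g j 0] smooth_germ_differentiable[OF Suc.prems(1)]
        smooth_germ_isCont[OF smooth_germ_deriv[OF Suc.prems(1)]] by (simp del: power_Suc)
  qed
  have "\<exists>i\<le>n. (deriv ^^ i) h 0 \<noteq> 0"
  proof (rule ccontr)
    assume "\<not> ?thesis"
    then have "((\<lambda>t. h t / t ^ n) \<longlongrightarrow> 0) (at 0)" using flat[OF assms(1), of n] by simp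
    from LIM_unique[OF this assms(2)] show False using assms(3) by simp
  qed
  then obtain j where j: "j \<le> n" "(deriv ^^ j) h 0 \<noteq> 0" by blast
  obtain i where i: "(deriv ^^ i) h 0 \<noteq> 0" "\<forall>m<i. \<not> (deriv ^^ m) h 0 \<noteq> 0"
    using exists_least_iff[of "\<lambda>i. (deriv ^^ i) h 0 \<noteq> 0"] j(2) by blast
  have "i \<le> j" using i(2) j(2) by (meson not_less)
  then have "i \<le> n" "has_order h i" using i j(1) by (auto simp: has_order_def)
  then show ?thesis using low[of i] by (cases "i = n") auto
qed

text \<open>Leading coefficients multiply. The factorization is asked for only off 0, because that
  is where a slope times a velocity is known to be another velocity.\<close>

lemma has_order_mult:
  fixes f g h :: "'k::real_normed_field \<Rightarrow> 'k"
  assumes "smooth_germ f" "smooth_germ g" "smooth_germ h" "has_order f n" "has_order g m"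
    "\<forall>\<^sub>F t in at 0. h t = f t * g t"
  shows "has_order h (n + m)"
proof -
  obtain c where c: "c \<noteq> 0" "((\<lambda>t. f t / t ^ n) \<longlongrightarrow> c) (at 0)"
    using has_order_imp_tendsto[OF assms(1,4)] by blast
  obtain d where d: "d \<noteq> 0" "((\<lambda>t. g t / t ^ m) \<longlongrightarrow> d) (at 0)"
    using has_order_imp_tendsto[OF assms(2,5)] by blast
  have "((\<lambda>t. (f t / t ^ n) * (g t / t ^ m)) \<longlongrightarrow> c * d) (at 0)" by (intro tendsto_mult c d)
  moreover have "\<forall>\<^sub>F t in at 0. (f t / t ^ n) * (g t / t ^ m) = h t / t ^ (n + m)"
    using assms(6) by eventually_elim (simp add: power_add)
  ultimately have "((\<lambda>t. h t / t ^ (n + m)) \<longlongrightarrow> c * d) (at 0)" by (rule Lim_transform_eventually)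
  from has_order_if_tendsto[OF assms(3) this] show ?thesis using c d by simp
qed

text \<open>Only continuity is asked of the cofactor \<open>g\<close>; it will be a sum of partial
  derivatives times frame coefficients. An order \<open>m < n\<close> of \<open>h\<close> would
  contradict that \<open>h t / t ^ m\<close> tends to 0.\<close>

lemma has_order_mult_ge:
  fixes f g h :: "'k::real_normed_field \<Rightarrow> 'k"
  assumes "smooth_germ f" "isCont g 0" "smooth_germ h" "has_order f n" "has_order h m"
    "\<forall>\<^sub>F t in at 0. h t = f t * g t"
  shows "n \<le> m"
proof (rule ccontr)
  assume "\<not> n \<le> m"
  then have "m < n" by simp
  obtain c where c: "((\<lambda>t. f t / t ^ n) \<longlongrightarrow> c) (at 0)"
    using has_order_imp_tendsto[OF assms(1,4)] by blast
  obtain d where d: "d \<noteq> 0" "((\<lambda>t. h t / t ^ m) \<longlongrightarrow> d) (at 0)"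
    using has_order_imp_tendsto[OF assms(3,5)] by blast
  have "((\<lambda>t. (f t / t ^ m) * g t) \<longlongrightarrow> 0 * g 0) (at 0)"
    using tendsto_imp_order_less_zero[OF c \<open>m < n\<close>] assms(2) by (intro tendsto_mult) (auto simp: isCont_def)
  moreover have "\<forall>\<^sub>F t in at 0. (f t / t ^ m) * g t = h t / t ^ m"
    using assms(6) by eventually_elim simp
  ultimately have "((\<lambda>t. h t / t ^ m) \<longlongrightarrow> 0 * g 0) (at 0)" by (rule Lim_transform_eventually)
  from LIM_unique[OF this d(2)] show False using d(1) by simp
qed

section \<open>Smooth functions of several variables\<close>

definition open_in :: "nat \<Rightarrow> (nat \<Rightarrow> 'k::real_normed_field) set \<Rightarrow> bool" where
  "open_in n W \<longleftrightarrow> openin (top_of_set (coord_space n)) W"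

lemma open_in_subset: "open_in n W \<Longrightarrow> W \<subseteq> coord_space n"
  unfolding open_in_def using openin_imp_subset by blast

lemma open_in_Int: "open_in n W \<Longrightarrow> open_in n W' \<Longrightarrow> open_in n (W \<inter> W')"
  unfolding open_in_def by (rule openin_Int)

lemma open_in_coord_space: "open_in n (coord_space n)"
  unfolding open_in_def by simp

text \<open>The topology is the product topology. Coordinates from \<open>n\<close> on are fixed to
  0 in \<open>coord_space n\<close>, so the least of the \<open>n\<close> remaining radii gives a
  box.\<close>

lemma open_in_box:
  fixes x :: "nat \<Rightarrow> 'k::real_normed_field"
  assumes "open_in n W" "x \<in> W"
  shows "\<exists>e>0. \<forall>y\<in>coord_space n. (\<forall>i<n. norm (y i - x i) < e) \<longrightarrow> y \<in> W"
proof -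
  obtain U where U: "open U" "W = coord_space n \<inter> U"
    using assms(1) unfolding open_in_def openin_open by blast
  then have "openin (product_topology (\<lambda>i. euclidean) UNIV) U"
    unfolding euclidean_product_topology by simp
  from product_topology_open_contains_basis[OF this, of x] U assms(2)
  obtain X where X: "x \<in> (\<Pi>\<^sub>E i\<in>UNIV. X i)" "\<And>i. open (X i)" "(\<Pi>\<^sub>E i\<in>UNIV. X i) \<subseteq> U"
    by auto
  have "\<exists>e. e > 0 \<and> ball (x i) e \<subseteq> X i" for i
    using X(1,2) open_contains_ball[of "X i"] by (auto simp: PiE_iff)
  then obtain e where e: "\<And>i. e i > 0" "\<And>i. ball (x i) (e i) \<subseteq> X i" by metis
  \<comment> \<open>The extra element 1 keeps the minimum meaningful for
    \<open>n = 0\<close>.\<close>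
  define d where "d = Min (insert 1 (e ` {..<n}))"
  have d: "d > 0" "\<And>i. i < n \<Longrightarrow> d \<le> e i" using e(1) by (auto simp: d_def)
  have "y \<in> W" if "y \<in> coord_space n" "\<forall>i<n. norm (y i - x i) < d" for y
  proof -
    have "y i \<in> X i" for i
    proof (cases "i < n")
      case True
      then have "y i \<in> ball (x i) (e i)"
        using that(2) d(2)[OF True] by (force simp: dist_norm norm_minus_commute)
      then show ?thesis using e(2) by blast
    next
      case False
      have "x \<in> coord_space n" using assms(2) U(2) by blast
      then have "y i = x i" using that(1) False by (simp add: coord_space_def)
      then show ?thesis using X(1) by (simp add: PiE_iff)
    qed
    then show ?thesis using X(3) U(2) that(1) by (auto simp: PiE_iff)
  qed
  then show ?thesis using d(1) by blast
qed

lemma continuous_on_box: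
  fixes f :: "(nat \<Rightarrow> 'k::real_normed_field) \<Rightarrow> 'k"
  assumes "open_in n W" "x \<in> W" "continuous_on W f" "e > 0"
  shows "\<exists>d>0. \<forall>y\<in>coord_space n. (\<forall>i<n. norm (y i - x i) < d) \<longrightarrow> y \<in> W \<and> norm (f y - f x) < e"
proof -
  have "openin (top_of_set W) (W \<inter> f -` ball (f x) e)"
    using assms(3) by (intro continuous_openin_preimage_gen) auto
  then have "open_in n (W \<inter> f -` ball (f x) e)"
    using openin_trans assms(1) unfolding open_in_def by blast
  from open_in_box[OF this, of x] show ?thesis
    using assms(2,4) by (auto simp: dist_norm norm_minus_commute)
qed

lemma open_in_preimage_neq:
  fixes f :: "(nat \<Rightarrow> 'k::real_normed_field) \<Rightarrow> 'k"
  assumes "open_in n W" "continuous_on W f"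
  shows "open_in n {x \<in> W. f x \<noteq> 0}"
proof -
  have "openin (top_of_set W) (W \<inter> f -` (- {0}))"
    using assms(2) by (intro continuous_openin_preimage_gen) auto
  moreover have "W \<inter> f -` (- {0}) = {x \<in> W. f x \<noteq> 0}" by auto
  ultimately show ?thesis using openin_trans[of W "{x \<in> W. f x \<noteq> 0}"] assms(1) unfolding open_in_def by simp
qed

lemma upd_coord_space: "x \<in> coord_space n \<Longrightarrow> i < n \<Longrightarrow> x(i := h) \<in> coord_space n"
  by (auto simp: coord_space_def)

lemma eventually_upd:
  assumes "open_in n W" "x \<in> W" "i < n"
  shows "\<forall>\<^sub>F h in nhds (x i). x(i := h) \<in> W"
proof -
  obtain e where e: "e > 0" "\<And>y. y \<in> coord_space n \<Longrightarrow> \<forall>i<n. norm (y i - x i) < e \<Longrightarrow> y \<in> W"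
    using open_in_box[OF assms(1,2)] by blast
  have "x(i := h) \<in> W" if "dist h (x i) < e" for h
  proof (rule e(2))
    show "x(i := h) \<in> coord_space n"
      using assms open_in_subset upd_coord_space by blast
    show "\<forall>j<n. norm ((x(i := h)) j - x j) < e" using that e(1) by (simp add: dist_norm)
  qed
  then show ?thesis unfolding eventually_nhds_metric using e(1) by blast
qed

section \<open>Closure properties of differentiable functions, first order approximation, chain
  rule\<close>

lemma C_on_SucD: "C_on n (Suc m) W f \<Longrightarrow> C_on n m W f"
  by (induction m arbitrary: f) auto

lemma C_on_continuous: "C_on n m W f \<Longrightarrow> continuous_on W f"
  by (cases m) auto

lemma C_on_subset: "C_on n m W f \<Longrightarrow> W' \<subseteq> W \<Longrightarrow> C_on n m W' f"
  by (induction m arbitrary: f) (auto intro: continuous_on_subset)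

lemma partial_cong:
  assumes "open_in n W" "\<And>x. x \<in> W \<Longrightarrow> f x = g x" "x \<in> W" "i < n"
  shows "partial i f x = partial i g x"
  unfolding partial_def
  by (rule deriv_cong_ev[OF eventually_mono[OF eventually_upd[OF assms(1,3,4)]]]) (use assms(2) in auto)

lemma C_on_cong:
  assumes "open_in n W" "\<And>x. x \<in> W \<Longrightarrow> f x = g x" "C_on n m W f"
  shows "C_on n m W g"
  using assms(2,3)
proof (induction m arbitrary: f g)
  case 0
  then show ?case using continuous_on_cong[of W W f g] by simp
next
  case (Suc m)
  have "(\<lambda>h. g (x(i := h))) field_differentiable at (x i)" if "i < n" "x \<in> W" for i x
  proof (rule field_differentiable_cong_ev)
    show "\<forall>\<^sub>F h in nhds (x i). f (x(i := h)) = g (x(i := h))"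
      by (rule eventually_mono[OF eventually_upd[OF assms(1) that(2,1)]]) (rule Suc.prems(1))
    show "(\<lambda>h. f (x(i := h))) field_differentiable at (x i)" using Suc.prems(2) that by simp
  qed
  moreover have "C_on n m W (partial i g)" if "i < n" for i
    by (rule Suc.IH[of "partial i f"])
       (use partial_cong[OF assms(1) Suc.prems(1) _ that] Suc.prems(2) that in auto)
  moreover have "continuous_on W g"
    using continuous_on_cong[of W W f g] Suc.prems by simp
  ultimately show ?case by simp
qed

lemma C_on_const: "C_on n m W (\<lambda>x. c)"
proof (induction m arbitrary: c)
  case (Suc m)
  have "partial i (\<lambda>x. c) = (\<lambda>x. 0)" for i by (simp add: partial_def fun_eq_iff)
  then show ?case using Suc by simp
qed simp

lemma C_on_coord:
  fixes W :: "(nat \<Rightarrow> 'k::real_normed_field) set"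
  shows "C_on n m W (\<lambda>x. x j)"
proof (cases m)
  case 0
  then show ?thesis by (auto intro: continuous_on_product_then_coordinatewise continuous_on_id)
next
  case (Suc l)
  have *: "(\<lambda>h. (x(i := h)) j) = (if i = j then (\<lambda>h. h) else (\<lambda>h. x j))" for i and x :: "nat \<Rightarrow> 'k"
    by (auto simp: fun_eq_iff)
  have "partial i (\<lambda>x::nat \<Rightarrow> 'k. x j) = (\<lambda>x. if i = j then 1 else 0)" for i
    unfolding partial_def * by (auto simp: fun_eq_iff)
  then have "C_on n l W (partial i (\<lambda>x. x j))" for i by (simp add: C_on_const)
  moreover have "continuous_on W (\<lambda>x. x j)"
    by (auto intro: continuous_on_product_then_coordinatewise continuous_on_id)
  moreover have "(\<lambda>h. (x(i := h)) j) field_differentiable at (x i)" for i and x :: "nat \<Rightarrow> 'k"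
    unfolding * by auto
  ultimately show ?thesis unfolding Suc C_on.simps by blast
qed

text \<open>Lets a derivative obtained from a calculus rule stand in for \<open>partial i f\<close>,
  with which it is compared on \<open>W\<close> only.\<close>

lemma C_on_SucI:
  assumes "open_in n W" "continuous_on W f"
    and "\<And>i x. i < n \<Longrightarrow> x \<in> W \<Longrightarrow> ((\<lambda>h. f (x(i := h))) has_field_derivative D i x) (at (x i))"
    and "\<And>i. i < n \<Longrightarrow> C_on n m W (D i)"
  shows "C_on n (Suc m) W f"
proof -
  have "partial i f x = D i x" if "i < n" "x \<in> W" for i x
    unfolding partial_def by (rule DERIV_imp_deriv) (rule assms(3)[OF that])
  then have "C_on n m W (partial i f)" if "i < n" for i
    by (intro C_on_cong[OF assms(1) _ assms(4)[OF that]]) (use that in auto)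
  then show ?thesis using assms(2,3) by (auto simp: field_differentiable_def)
qed

lemma C_on_partialD:
  assumes "C_on n (Suc m) W f" "i < n" "x \<in> W"
  shows "((\<lambda>h. f (x(i := h))) has_field_derivative partial i f x) (at (x i))"
  using assms unfolding partial_def by (simp add: DERIV_deriv_iff_field_differentiable)

lemma C_on_add:
  assumes "open_in n W" "C_on n m W f" "C_on n m W g"
  shows "C_on n m W (\<lambda>x. f x + g x)"
  using assms(2,3)
proof (induction m arbitrary: f g)
  case (Suc m)
  show ?case
    by (rule C_on_SucI[OF assms(1) _ DERIV_add[OF C_on_partialD C_on_partialD]
          Suc.IH[of "partial i f" "partial i g" for i]])
       (use Suc.prems in \<open>auto intro: continuous_on_add\<close>)
qed (auto intro: continuous_on_add)

lemma C_on_mult: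
  assumes "open_in n W" "C_on n m W f" "C_on n m W g"
  shows "C_on n m W (\<lambda>x. f x * g x)"
  using assms(2,3)
proof (induction m arbitrary: f g)
  case (Suc m)
  have *: "C_on n m W f" "C_on n m W g" using Suc.prems C_on_SucD by blast+
  show ?case
  proof (rule C_on_SucI[OF assms(1), where D = "\<lambda>i x. partial i f x * g x + partial i g x * f x"])
    show "continuous_on W (\<lambda>x. f x * g x)" using Suc.prems by (auto intro: continuous_on_mult)
    fix i x assume ix: "i < n" "x \<in> W"
    show "((\<lambda>h. f (x(i := h)) * g (x(i := h))) has_field_derivative
        partial i f x * g x + partial i g x * f x) (at (x i))"
      by (rule DERIV_cong[OF DERIV_mult[OF C_on_partialD[OF Suc.prems(1) ix] C_on_partialD[OF Suc.prems(2) ix]]])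
         simp
  next
    fix i assume "i < n"
    then show "C_on n m W (\<lambda>x. partial i f x * g x + partial i g x * f x)"
      by (intro C_on_add[OF assms(1)] Suc.IH *) (use Suc.prems in auto)
  qed
qed (auto intro: continuous_on_mult)

lemma C_on_inverse:
  assumes "open_in n W" "C_on n m W f" "\<And>x. x \<in> W \<Longrightarrow> f x \<noteq> 0"
  shows "C_on n m W (\<lambda>x. inverse (f x))"
  using assms(2)
proof (induction m)
  case 0
  then show ?case using assms(3) by (auto intro!: continuous_on_inverse)
next
  case (Suc m)
  show ?case
  proof (rule C_on_SucI[OF assms(1), where D = "\<lambda>i x. (-1) * (inverse (f x) * (partial i f x * inverse (f x)))"])
    show "continuous_on W (\<lambda>x. inverse (f x))"
      using Suc.prems assms(3) by (auto intro!: continuous_on_inverse)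
    fix i x assume ix: "i < n" "x \<in> W"
    have nz: "f (x(i := x i)) \<noteq> 0" using assms(3)[OF ix(2)] by simp
    show "((\<lambda>h. inverse (f (x(i := h)))) has_field_derivative
        (-1) * (inverse (f x) * (partial i f x * inverse (f x)))) (at (x i))"
      by (rule DERIV_cong[OF DERIV_inverse'[OF C_on_partialD[OF Suc.prems ix] nz]]) simp
  next
    fix i assume "i < n"
    then show "C_on n m W (\<lambda>x. (-1) * (inverse (f x) * (partial i f x * inverse (f x))))"
      by (intro C_on_mult[OF assms(1)] C_on_const Suc.IH) (use Suc.prems C_on_SucD in auto)
  qed
qed

lemma C_on_sum:
  assumes "open_in n W" "\<And>j. j \<in> I \<Longrightarrow> C_on n m W (f j)"
  shows "C_on n m W (\<lambda>x. \<Sum>j\<in>I. f j x)"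
  using assms(2)
  by (induction I rule: infinite_finite_induct)
     (simp_all add: C_on_const C_on_add[OF assms(1)])

text \<open>Passing from \<open>x\<close> to \<open>y\<close> one coordinate at a time reduces the
  estimate to the mean value inequality in one variable; continuity keeps each partial derivative
  within \<open>e\<close> of its value at \<open>x\<close>.\<close>

lemma C1_approx:
  assumes "open_in n W" "C_on n (Suc m) W f" "x \<in> W" "e > 0"
  shows "\<exists>d>0. \<forall>y\<in>coord_space n. (\<forall>i<n. norm (y i - x i) < d) \<longrightarrow>
           norm (f y - f x - (\<Sum>i<n. partial i f x * (y i - x i))) \<le> e * (\<Sum>i<n. norm (y i - x i))"
proof -
  have "\<exists>d>0. \<forall>y\<in>coord_space n. (\<forall>j<n. norm (y j - x j) < d) \<longrightarrow>
        y \<in> W \<and> norm (partial i f y - partial i f x) < e" if "i < n" for i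
    using assms that by (intro continuous_on_box C_on_continuous[of n m]) auto
  then obtain d' where d': "\<And>i. i < n \<Longrightarrow> d' i > 0"
    "\<And>i y. i < n \<Longrightarrow> y \<in> coord_space n \<Longrightarrow> \<forall>j<n. norm (y j - x j) < d' i \<Longrightarrow>
        y \<in> W \<and> norm (partial i f y - partial i f x) < e"
    by metis
  define d where "d = Min (insert 1 (d' ` {..<n}))"
  have d: "d > 0" "\<And>i. i < n \<Longrightarrow> d \<le> d' i" using d'(1) by (auto simp: d_def)
  have near: "y \<in> W \<and> norm (partial i f y - partial i f x) < e"
    if "i < n" "y \<in> coord_space n" "\<forall>j<n. norm (y j - x j) < d" for i y
    using d'(2)[OF that(1,2)] d(2)[OF that(1)] that(3) by (meson less_le_trans)
  have x: "x \<in> coord_space n" using assms(1,3) open_in_subset by blast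
  have "norm (f y - f x - (\<Sum>i<n. partial i f x * (y i - x i))) \<le> e * (\<Sum>i<n. norm (y i - x i))"
    if y: "y \<in> coord_space n" "\<forall>j<n. norm (y j - x j) < d" for y
  proof -
    \<comment> \<open>The corners of the path from \<open>x\<close> to \<open>y\<close>; consecutive
      ones differ in a single coordinate.\<close>
    define z where "z i = (\<lambda>j. if j < i then y j else x j)" for i :: nat
    have zc: "z i \<in> coord_space n" if "i \<le> n" for i
      using x y that by (auto simp: z_def coord_space_def)
    have step: "norm (f (z (Suc i)) - f (z i) - partial i f x * (y i - x i)) \<le> e * norm (y i - x i)"
      if i: "i < n" for i
    proof -
      have zu: "(z i)(i := h) \<in> coord_space n" for h using zc[of i] i upd_coord_space by auto
      have zn: "(z i)(i := h) \<in> W \<and> norm (partial i f ((z i)(i := h)) - partial i f x) < e"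
        if "h \<in> ball (x i) d" for h
        by (rule near[OF i zu])
           (use that y(2) d(1) in \<open>auto simp: z_def dist_norm norm_minus_commute\<close>)
      define \<phi> where "\<phi> h = f ((z i)(i := h)) - partial i f x * h" for h
      have "norm (\<phi> (y i) - \<phi> (x i)) \<le> e * norm (y i - x i)"
      proof (rule field_differentiable_bound[where S = "ball (x i) d"
            and f' = "\<lambda>h. partial i f ((z i)(i := h)) - partial i f x"])
        fix h assume h: "h \<in> ball (x i) d"
        have "((\<lambda>h'. f (((z i)(i := h))(i := h'))) has_field_derivative partial i f ((z i)(i := h)))
            (at (((z i)(i := h)) i))"
          using zn[OF h] i by (intro C_on_partialD[OF assms(2)]) auto
        then have "((\<lambda>h'. f ((z i)(i := h'))) has_field_derivative partial i f ((z i)(i := h))) (at h)"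
          by simp
        from DERIV_diff[OF this DERIV_cmult_Id[of "partial i f x"]]
        show "(\<phi> has_field_derivative partial i f ((z i)(i := h)) - partial i f x)
            (at h within ball (x i) d)"
          unfolding \<phi>_def by (rule has_field_derivative_at_within)
        show "norm (partial i f ((z i)(i := h)) - partial i f x) \<le> e" using zn[OF h] by simp
      qed (use y(2) i d(1) in \<open>auto simp: dist_norm norm_minus_commute\<close>)
      moreover have "(z i)(i := y i) = z (Suc i)" "(z i)(i := x i) = z i"
        by (auto simp: z_def fun_eq_iff less_Suc_eq)
      ultimately show ?thesis by (simp add: \<phi>_def algebra_simps)
    qed
    have "z 0 = x" "z n = y" using x y by (auto simp: z_def fun_eq_iff coord_space_def)
    then have "f y - f x = (\<Sum>i<n. f (z (Suc i)) - f (z i))"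
      using sum_lessThan_telescope[of "\<lambda>i. f (z i)" n] by simp
    then have "f y - f x - (\<Sum>i<n. partial i f x * (y i - x i)) =
        (\<Sum>i<n. f (z (Suc i)) - f (z i) - partial i f x * (y i - x i))"
      by (simp add: sum_subtractf)
    also have "norm \<dots> \<le> (\<Sum>i<n. e * norm (y i - x i))"
      by (rule sum_norm_le) (use step in auto)
    finally show ?thesis by (simp add: sum_distrib_left)
  qed
  then show ?thesis using d(1) by blast
qed

lemma eventually_close:
  fixes u :: "'b::t2_space \<Rightarrow> nat \<Rightarrow> 'k::real_normed_field"
  assumes "\<And>i. i < n \<Longrightarrow> isCont (\<lambda>s. u s i) t" "d > 0"
  shows "\<forall>\<^sub>F s in nhds t. \<forall>i<n. norm (u s i - u t i) < d"
proof -
  have "\<forall>\<^sub>F s in nhds t. norm (u s i - u t i) < d" if "i < n" for i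
  proof -
    have "((\<lambda>s. u s i) \<longlongrightarrow> u t i) (nhds t)"
      using assms(1)[OF that] tendsto_at_iff_tendsto_nhds[of "\<lambda>s. u s i" t]
      by (simp add: isCont_def)
    from tendstoD[OF this assms(2)] show ?thesis by (simp add: dist_norm)
  qed
  then have "\<forall>\<^sub>F s in nhds t. \<forall>i\<in>{..<n}. norm (u s i - u t i) < d"
    by (intro eventually_ball_finite) auto
  then show ?thesis by (rule eventually_mono) simp
qed

lemma eventually_mem_open_in:
  fixes u :: "'b::t2_space \<Rightarrow> nat \<Rightarrow> 'k::real_normed_field"
  assumes "open_in n W" "u t \<in> W" "\<And>i. i < n \<Longrightarrow> isCont (\<lambda>s. u s i) t"
    "\<forall>\<^sub>F s in nhds t. u s \<in> coord_space n"
  shows "\<forall>\<^sub>F s in nhds t. u s \<in> W"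
proof -
  obtain e where e: "e > 0" "\<And>y. y \<in> coord_space n \<Longrightarrow> \<forall>i<n. norm (y i - u t i) < e \<Longrightarrow> y \<in> W"
    using open_in_box[OF assms(1,2)] by blast
  show ?thesis using eventually_conj[OF eventually_close[where u = u and n = n, OF assms(3) e(1)] assms(4)]
    by (rule eventually_mono) (use e(2) in auto)
qed

text \<open>Divided by \<open>s - t\<close>, the error bound of \<open>C1_approx\<close> becomes a
  small multiple of the sum of the norms of the difference quotients \<open>q\<close>, and this sum
  is bounded near \<open>t\<close> because they converge.\<close>

lemma chain_rule:
  fixes u :: "'k \<Rightarrow> nat \<Rightarrow> 'k::real_normed_field"
  assumes "open_in n W" "C_on n (Suc m) W f" "u t \<in> W"
    and ev: "\<forall>\<^sub>F s in nhds t. u s \<in> coord_space n"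
    and d: "\<And>i. i < n \<Longrightarrow> ((\<lambda>s. u s i) has_field_derivative u' i) (at t)"
  shows "((\<lambda>s. f (u s)) has_field_derivative (\<Sum>i<n. partial i f (u t) * u' i)) (at t)"
proof -
  define q where "q i s = (u s i - u t i) / (s - t)" for i s
  have q: "(q i \<longlongrightarrow> u' i) (at t)" if "i < n" for i
    using d[OF that] unfolding q_def has_field_derivative_iff by simp
  define rest where "rest s = (f (u s) - f (u t)) / (s - t) - (\<Sum>i<n. partial i f (u t) * q i s)" for s
  have "(rest \<longlongrightarrow> 0) (at t)"
  proof (rule tendstoI)
    fix e :: real assume "e > 0"
    define L where "L = (\<Sum>i<n. norm (u' i)) + 1"
    have "L > 0" unfolding L_def by (simp add: add_nonneg_pos sum_nonneg)
    have lim: "((\<lambda>s. \<Sum>i<n. norm (q i s)) \<longlongrightarrow> (\<Sum>i<n. norm (u' i))) (at t)"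
      by (intro tendsto_sum tendsto_norm q) auto
    have "\<forall>\<^sub>F s in at t. (\<Sum>i<n. norm (q i s)) < L"
      by (rule order_tendstoD(2)[OF lim]) (simp add: L_def)
    moreover
    obtain d where d': "d > 0" "\<And>y. y \<in> coord_space n \<Longrightarrow> \<forall>i<n. norm (y i - u t i) < d \<Longrightarrow>
        norm (f y - f (u t) - (\<Sum>i<n. partial i f (u t) * (y i - u t i)))
          \<le> (e / L) * (\<Sum>i<n. norm (y i - u t i))"
      using C1_approx[OF assms(1-3), of "e / L"] \<open>e > 0\<close> \<open>L > 0\<close> by auto
    have "\<forall>\<^sub>F s in nhds t. \<forall>i<n. norm (u s i - u t i) < d"
      by (rule eventually_close[OF _ d'(1)]) (use d DERIV_isCont in blast)
    then have "\<forall>\<^sub>F s in at t. \<forall>i<n. norm (u s i - u t i) < d"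
      by (simp add: eventually_nhds_conv_at)
    moreover have "\<forall>\<^sub>F s in at t. u s \<in> coord_space n"
      using ev by (simp add: eventually_nhds_conv_at)
    moreover have "\<forall>\<^sub>F s in at t. s \<noteq> t" by (rule eventually_neq_at_within)
    ultimately show "\<forall>\<^sub>F s in at t. dist (rest s) 0 < e"
    proof eventually_elim
      case (elim s)
      have "(\<Sum>i<n. partial i f (u t) * q i s) = (\<Sum>i<n. partial i f (u t) * (u s i - u t i)) / (s - t)"
        by (simp add: q_def sum_divide_distrib)
      then have "rest s = (f (u s) - f (u t) - (\<Sum>i<n. partial i f (u t) * (u s i - u t i))) / (s - t)"
        by (simp add: rest_def diff_divide_distrib)
      then have "norm (rest s) = norm (f (u s) - f (u t) - (\<Sum>i<n. partial i f (u t) * (u s i - u t i)))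
          / norm (s - t)"
        by (simp add: norm_divide)
      also have "\<dots> \<le> ((e / L) * (\<Sum>i<n. norm (u s i - u t i))) / norm (s - t)"
        by (intro divide_right_mono d'(2)) (use elim in auto)
      also have "\<dots> = (e / L) * (\<Sum>i<n. norm (q i s))"
        by (simp add: q_def norm_divide sum_divide_distrib[symmetric])
      also have "\<dots> < (e / L) * L"
        using elim \<open>e > 0\<close> \<open>L > 0\<close> by (intro mult_strict_left_mono) auto
      finally show ?case using \<open>L > 0\<close> by (simp add: dist_norm)
    qed
  qed
  then have "((\<lambda>s. rest s + (\<Sum>i<n. partial i f (u t) * q i s)) \<longlongrightarrow>
      0 + (\<Sum>i<n. partial i f (u t) * u' i)) (at t)"
    by (intro tendsto_add tendsto_sum tendsto_mult tendsto_const q) auto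
  then show ?thesis unfolding has_field_derivative_iff rest_def by simp
qed

lemma C_on_compose:
  fixes g :: "(nat \<Rightarrow> 'k::real_normed_field) \<Rightarrow> nat \<Rightarrow> 'k"
  assumes "open_in n W" "open_in l W'" "\<And>z. z \<in> W' \<Longrightarrow> g z \<in> W"
    and "\<And>j. j < n \<Longrightarrow> C_on l m W' (\<lambda>z. g z j)" "C_on n m W f"
  shows "C_on l m W' (\<lambda>z. f (g z))"
  using assms(4,5)
proof (induction m arbitrary: f)
  case 0
  \<comment> \<open>Continuity into the product topology concerns every coordinate, also those from
    \<open>n\<close> on, which vanish on the image.\<close>
  have "continuous_on W' (\<lambda>z. g z j)" for j
  proof (cases "j < n")
    case False
    then have "g z j = 0" if "z \<in> W'" for z
      using assms(3)[OF that] open_in_subset[OF assms(1)] by (auto simp: coord_space_def)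
    then show ?thesis using continuous_on_cong[of W' W' "\<lambda>z. g z j" "\<lambda>z. 0"] by simp
  qed (use 0 in auto)
  then have "continuous_on W' g" by (rule continuous_on_coordinatewise_then_product)
  moreover have "continuous_on W f" "g ` W' \<subseteq> W" using 0 assms(3) by auto
  ultimately have "continuous_on W' (\<lambda>z. f (g z))" using continuous_on_compose2 by blast
  then show ?case by simp
next
  case (Suc m)
  note gc = C_on_SucD[OF Suc.prems(1)]
  have cont: "C_on l m W' (\<lambda>z. f (g z))" by (rule Suc.IH) (fact gc, rule C_on_SucD[OF Suc.prems(2)])
  show ?case
  proof (rule C_on_SucI[OF assms(2), where D = "\<lambda>i z. \<Sum>j<n. partial j f (g z) * partial i (\<lambda>z. g z j) z"])
    show "continuous_on W' (\<lambda>z. f (g z))" using C_on_continuous[OF cont] .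
    fix i z assume iz: "i < l" "z \<in> W'"
    have "((\<lambda>h. f (g (z(i := h)))) has_field_derivative
        (\<Sum>j<n. partial j f (g (z(i := z i))) * partial i (\<lambda>z. g z j) z)) (at (z i))"
    proof (rule chain_rule[OF assms(1) Suc.prems(2)])
      show "g (z(i := z i)) \<in> W" using assms(3) iz by simp
      show "\<forall>\<^sub>F h in nhds (z i). g (z(i := h)) \<in> coord_space n"
        using eventually_upd[OF assms(2) iz(2,1)]
        by (rule eventually_mono) (use assms(3) open_in_subset[OF assms(1)] in auto)
      show "((\<lambda>h. g (z(i := h)) j) has_field_derivative partial i (\<lambda>z. g z j) z) (at (z i))"
        if "j < n" for j
        using C_on_partialD[OF Suc.prems(1)[OF that] iz] .
    qed
    then show "((\<lambda>h. f (g (z(i := h)))) has_field_derivative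
        (\<Sum>j<n. partial j f (g z) * partial i (\<lambda>z. g z j) z)) (at (z i))" by simp
  next
    fix i assume "i < l"
    show "C_on l m W' (\<lambda>z. \<Sum>j<n. partial j f (g z) * partial i (\<lambda>z. g z j) z)"
    proof (intro C_on_sum[OF assms(2)] C_on_mult[OF assms(2)])
      fix j assume "j \<in> {..<n}"
      then show "C_on l m W' (\<lambda>z. partial j f (g z))"
        using Suc.prems(2) by (intro Suc.IH[of "partial j f"] gc) auto
      show "C_on l m W' (partial i (\<lambda>z. g z j))"
        using Suc.prems(1) \<open>j \<in> {..<n}\<close> \<open>i < l\<close> by simp
    qed
  qed
qed

lemma times_diff_compose:
  assumes "open G" "open_in n W" "\<And>t. t \<in> G \<Longrightarrow> u t \<in> W"
    and "\<And>j. j < n \<Longrightarrow> times_diff m G (\<lambda>t. u t j)" "C_on n m W f"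
  shows "times_diff m G (\<lambda>t. f (u t))"
  using assms(4,5)
proof (induction m arbitrary: f)
  case (Suc m)
  note uc = times_diff_SucD[OF Suc.prems(1)]
  have d: "((\<lambda>s. f (u s)) has_field_derivative (\<Sum>j<n. partial j f (u t) * deriv (\<lambda>t. u t j) t)) (at t)"
    if "t \<in> G" for t
  proof (rule chain_rule[where u = u and t = t, OF assms(2) Suc.prems(2) assms(3)[OF that]])
    show "\<forall>\<^sub>F s in nhds t. u s \<in> coord_space n"
      using assms(1,3) that open_in_subset[OF assms(2)] unfolding eventually_nhds by blast
    show "((\<lambda>s. u s i) has_field_derivative deriv (\<lambda>t. u t i) t) (at t)" if "i < n" for i
      using Suc.prems(1)[OF that] \<open>t \<in> G\<close> by (simp add: DERIV_deriv_iff_field_differentiable)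
  qed
  have "times_diff m G (\<lambda>t. \<Sum>j<n. partial j f (u t) * deriv (\<lambda>t. u t j) t)"
  proof (intro times_diff_sum[OF assms(1)] times_diff_mult[OF assms(1)])
    fix j assume "j \<in> {..<n}"
    then show "times_diff m G (\<lambda>t. partial j f (u t))" "times_diff m G (deriv (\<lambda>t. u t j))"
      using Suc.prems by (auto intro!: Suc.IH[OF uc])
  qed
  then have "times_diff m G (deriv (\<lambda>t. f (u t)))"
    by (rule times_diff_cong[OF assms(1), rotated]) (use DERIV_imp_deriv[OF d] in simp)
  then show ?case using d by (auto simp: field_differentiable_def)
qed simp

lemma smooth_germ_common:
  fixes u :: "'k::real_normed_field \<Rightarrow> nat \<Rightarrow> 'k"
  assumes "\<And>j. j < n \<Longrightarrow> smooth_germ (\<lambda>t. u t j)"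
  shows "\<exists>G. open G \<and> 0 \<in> G \<and> (\<forall>j<n. \<forall>m. times_diff m G (\<lambda>t. u t j))"
proof -
  have "\<forall>\<^sub>F t in nhds 0. \<forall>j\<in>{..<n}. smooth_at_pt (\<lambda>t. u t j) t"
    using assms by (intro eventually_ball_finite) (auto simp: smooth_germ_def smooth_at_pt_def)
  then obtain G where G: "open G" "0 \<in> G" "\<forall>t\<in>G. \<forall>j<n. smooth_at_pt (\<lambda>t. u t j) t"
    unfolding eventually_nhds by auto
  have "times_diff m G (\<lambda>t. u t j)" if "j < n" for j m
    using G(3) that smooth_at_pt_iff[of G "\<lambda>t. u t j"] by simp
  then show ?thesis using G(1,2) by (intro exI[of _ G]) simp
qed

lemma smooth_germ_compose:
  fixes u :: "'k::real_normed_field \<Rightarrow> nat \<Rightarrow> 'k"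
  assumes "open_in n W" "smooth_on n W f" "\<And>j. j < n \<Longrightarrow> smooth_germ (\<lambda>t. u t j)"
    "\<forall>\<^sub>F t in nhds 0. u t \<in> W"
  shows "smooth_germ (\<lambda>t. f (u t))"
proof -
  obtain G where G: "open G" "0 \<in> G" "\<And>j m. j < n \<Longrightarrow> times_diff m G (\<lambda>t. u t j)"
    using smooth_germ_common[of n u] assms(3) by blast
  obtain G' where G': "open G'" "0 \<in> G'" "\<And>t. t \<in> G' \<Longrightarrow> u t \<in> W"
    using assms(4) unfolding eventually_nhds by blast
  have "times_diff m (G \<inter> G') (\<lambda>t. f (u t))" for m
    by (rule times_diff_compose[OF _ assms(1)])
       (use G G' assms(2) in \<open>auto simp: times_diff_iff smooth_on_def\<close>)
  then show ?thesis unfolding smooth_germ_iff using G G' by (intro exI[of _ "G \<inter> G'"]) auto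
qed

lemma smooth_on_continuous: "smooth_on n W f \<Longrightarrow> continuous_on W f"
  unfolding smooth_on_def by (blast intro: C_on_continuous)

lemma smooth_on_subset: "smooth_on n W f \<Longrightarrow> W' \<subseteq> W \<Longrightarrow> smooth_on n W' f"
  unfolding smooth_on_def by (blast intro: C_on_subset)

lemma smooth_on_cong:
  "open_in n W \<Longrightarrow> (\<And>x. x \<in> W \<Longrightarrow> f x = g x) \<Longrightarrow> smooth_on n W f \<Longrightarrow> smooth_on n W g"
  unfolding smooth_on_def using C_on_cong by blast

lemma smooth_on_const: "smooth_on n W (\<lambda>x. c)"
  by (simp add: smooth_on_def C_on_const)

lemma smooth_on_coord: "smooth_on n W (\<lambda>x. x j)"
  by (simp add: smooth_on_def C_on_coord)

lemma smooth_on_add: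
  "open_in n W \<Longrightarrow> smooth_on n W f \<Longrightarrow> smooth_on n W g \<Longrightarrow> smooth_on n W (\<lambda>x. f x + g x)"
  by (simp add: smooth_on_def C_on_add)

lemma smooth_on_mult:
  "open_in n W \<Longrightarrow> smooth_on n W f \<Longrightarrow> smooth_on n W g \<Longrightarrow> smooth_on n W (\<lambda>x. f x * g x)"
  by (simp add: smooth_on_def C_on_mult)

lemma smooth_on_diff:
  assumes "open_in n W" "smooth_on n W f" "smooth_on n W g"
  shows "smooth_on n W (\<lambda>x. f x - g x)"
  using smooth_on_add[OF assms(1,2) smooth_on_mult[OF assms(1) smooth_on_const[of n W "-1"] assms(3)]]
  by simp

lemma smooth_on_divide:
  assumes "open_in n W" "smooth_on n W f" "smooth_on n W g" "\<And>x. x \<in> W \<Longrightarrow> g x \<noteq> 0"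
  shows "smooth_on n W (\<lambda>x. f x / g x)"
proof -
  have "smooth_on n W (\<lambda>x. inverse (g x))"
    using assms by (auto simp: smooth_on_def intro: C_on_inverse)
  from smooth_on_mult[OF assms(1,2) this] show ?thesis by (simp add: field_simps)
qed

lemma smooth_on_sum:
  "open_in n W \<Longrightarrow> (\<And>j. j \<in> I \<Longrightarrow> smooth_on n W (f j)) \<Longrightarrow> smooth_on n W (\<lambda>x. \<Sum>j\<in>I. f j x)"
  by (simp add: smooth_on_def C_on_sum)

lemma smooth_on_partial: "smooth_on n W f \<Longrightarrow> i < n \<Longrightarrow> smooth_on n W (partial i f)"
  unfolding smooth_on_def using C_on.simps(2) by blast

lemma smooth_on_compose:
  "open_in n W \<Longrightarrow> open_in l W' \<Longrightarrow> (\<And>z. z \<in> W' \<Longrightarrow> g z \<in> W) \<Longrightarrow>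
   (\<And>j. j < n \<Longrightarrow> smooth_on l W' (\<lambda>z. g z j)) \<Longrightarrow> smooth_on n W f \<Longrightarrow> smooth_on l W' (\<lambda>z. f (g z))"
  unfolding smooth_on_def using C_on_compose by blast

lemma smooth_on_chain_rule:
  fixes u :: "'k \<Rightarrow> nat \<Rightarrow> 'k::real_normed_field"
  assumes "open_in n W" "smooth_on n W f" "u t \<in> W" "\<forall>\<^sub>F s in nhds t. u s \<in> coord_space n"
    "\<And>i. i < n \<Longrightarrow> ((\<lambda>s. u s i) has_field_derivative u' i) (at t)"
  shows "((\<lambda>s. f (u s)) has_field_derivative (\<Sum>i<n. partial i f (u t) * u' i)) (at t)"
  by (rule chain_rule[where u = u and t = t and m = 0, OF assms(1) _ assms(3-5)])
     (use assms(2) smooth_on_def in blast)+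

section \<open>Charts and velocities\<close>

lemma open_in_preimage:
  assumes "open_in n W" "open_in l W'" "\<And>j. continuous_on W (\<lambda>z. g z j)" "\<And>z. z \<in> W \<Longrightarrow> g z \<in> coord_space l"
  shows "open_in n {z \<in> W. g z \<in> W'}"
proof -
  have "continuous_on W g" by (rule continuous_on_coordinatewise_then_product) (rule assms(3))
  then have "openin (top_of_set W) (W \<inter> g -` W')"
    using assms(2,4) unfolding open_in_def by (intro continuous_openin_preimage) auto
  moreover have "W \<inter> g -` W' = {z \<in> W. g z \<in> W'}" by auto
  ultimately show ?thesis
    using openin_trans[of W "{z \<in> W. g z \<in> W'}"] assms(1) unfolding open_in_def by simp
qed

text \<open>\<open>velocity\<close> is a value of \<open>deriv\<close> and says nothing where the
  curve leaves the chart or is not differentiable. The relational form includes both conditions, so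
  it determines \<open>w\<close> and transforms under changes of charts.\<close>

definition has_velocity :: "('p, 'k::real_normed_field) chart \<Rightarrow> ('k \<Rightarrow> 'p) \<Rightarrow> 'k \<Rightarrow> (nat \<Rightarrow> 'k) \<Rightarrow> bool" where
  "has_velocity c \<gamma> t w \<longleftrightarrow>
     (\<forall>\<^sub>F s in nhds t. \<gamma> s \<in> fst c) \<and> (\<forall>i. ((\<lambda>s. snd c (\<gamma> s) i) has_field_derivative w i) (at t))"

definition smooth_in :: "('p, 'k::real_normed_field) chart \<Rightarrow> ('k \<Rightarrow> 'p) \<Rightarrow> bool" where
  "smooth_in c \<gamma> \<longleftrightarrow> (\<forall>\<^sub>F t in nhds 0. \<gamma> t \<in> fst c) \<and> (\<forall>i. smooth_germ (\<lambda>t. snd c (\<gamma> t) i))"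

definition transition :: "('p, 'k) chart \<Rightarrow> ('p, 'k) chart \<Rightarrow> (nat \<Rightarrow> 'k) \<Rightarrow> nat \<Rightarrow> 'k" where
  "transition c c' z = snd c' (inv_into (fst c) (snd c) z)"

definition jacobian :: "nat \<Rightarrow> ('p, 'k::real_normed_field) chart \<Rightarrow> ('p, 'k) chart \<Rightarrow> 'p \<Rightarrow> (nat \<Rightarrow> 'k) \<Rightarrow> nat \<Rightarrow> 'k" where
  "jacobian n c c' p w =
     (\<lambda>i. if i < n then \<Sum>j<n. partial j (\<lambda>z. transition c c' z i) (snd c p) * w j else 0)"

definition line :: "('p, 'k::real_normed_field) chart \<Rightarrow> 'p \<Rightarrow> (nat \<Rightarrow> 'k) \<Rightarrow> 'k \<Rightarrow> 'p" where
  "line c p w s = inv_into (fst c) (snd c) (\<lambda>i. snd c p i + s * w i)"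

lemma curve_along_eq_line: "curve_along \<A> p v = line (chart_at \<A> p) p v"
  by (simp add: curve_along_def line_def case_prod_unfold Let_def fun_eq_iff)

lemma has_velocity_imp_velocity: "has_velocity c \<gamma> t w \<Longrightarrow> velocity c \<gamma> t = w"
  unfolding has_velocity_def velocity_def by (auto intro: DERIV_imp_deriv)

lemma has_velocity_unique: "has_velocity c \<gamma> t w \<Longrightarrow> has_velocity c \<gamma> t w' \<Longrightarrow> w = w'"
  using has_velocity_imp_velocity by metis

lemma has_velocity_mem: "has_velocity c \<gamma> t w \<Longrightarrow> \<gamma> t \<in> fst c"
  unfolding has_velocity_def using eventually_nhds_x_imp_x by fast

lemma smooth_in_mem: "smooth_in c \<gamma> \<Longrightarrow> \<gamma> 0 \<in> fst c"
  unfolding smooth_in_def using eventually_nhds_x_imp_x by fast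

lemma smooth_curve_iff: "smooth_curve \<A> \<gamma> \<longleftrightarrow> (\<exists>c\<in>\<A>. smooth_in c \<gamma>)"
  by (simp add: smooth_curve_def smooth_in_def)

lemma line_through_eq: "a \<noteq> 0 \<Longrightarrow> line_through (\<lambda>i. a * v i) = line_through v"
  unfolding line_through_def
proof (intro subset_antisym subsetI)
  fix x assume "a \<noteq> 0" "x \<in> {\<lambda>i. b * v i |b. True}"
  then obtain b where "x = (\<lambda>i. b * v i)" by auto
  then have "x = (\<lambda>i. (b / a) * (a * v i))" using \<open>a \<noteq> 0\<close> by auto
  then show "x \<in> {\<lambda>i. b * (a * v i) |b. True}" by blast
qed (auto simp: mult.assoc[symmetric])

lemma line_through_self: "v \<in> line_through v"
  unfolding line_through_def by (auto intro: exI[of _ 1])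

text \<open>The type of points carries no topology. What is needed of one is expressed by openness
  of the chart images and of the images of overlaps; separation of limits is treated apart.\<close>

locale manifold =
  fixes n :: nat and M :: "'p set" and \<A> :: "('p, 'k::real_normed_field) chart set"
  assumes M_eq: "M = (\<Union>c\<in>\<A>. fst c)"
    and chart_inj: "c \<in> \<A> \<Longrightarrow> inj_on (snd c) (fst c)"
    and chart_open: "c \<in> \<A> \<Longrightarrow> open_in n (snd c ` fst c)"
    and overlap_open: "c \<in> \<A> \<Longrightarrow> c' \<in> \<A> \<Longrightarrow> open_in n (snd c ` (fst c \<inter> fst c'))"
    and transition_smooth: "c \<in> \<A> \<Longrightarrow> c' \<in> \<A> \<Longrightarrow> i < n \<Longrightarrow>
          smooth_on n (snd c ` (fst c \<inter> fst c')) (\<lambda>z. transition c c' z i)"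
begin

lemma coord_mem: "c \<in> \<A> \<Longrightarrow> p \<in> fst c \<Longrightarrow> snd c p \<in> coord_space n"
  using open_in_subset[OF chart_open] by blast

lemma chart_at: "p \<in> M \<Longrightarrow> chart_at \<A> p \<in> \<A>" "p \<in> M \<Longrightarrow> p \<in> fst (chart_at \<A> p)"
proof -
  assume "p \<in> M"
  then have "\<exists>c. c \<in> \<A> \<and> p \<in> fst c" by (auto simp: M_eq)
  from someI_ex[OF this] show "chart_at \<A> p \<in> \<A>" "p \<in> fst (chart_at \<A> p)"
    by (auto simp: chart_at_def)
qed

lemma inM: "c \<in> \<A> \<Longrightarrow> p \<in> fst c \<Longrightarrow> p \<in> M"
  by (auto simp: M_eq)

lemma transition_eq: "c \<in> \<A> \<Longrightarrow> p \<in> fst c \<Longrightarrow> transition c c' (snd c p) = snd c' p"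
  by (simp add: transition_def inv_into_f_f[OF chart_inj])

lemma transition_coord_space:
  assumes "c \<in> \<A>" "c' \<in> \<A>" "z \<in> snd c ` (fst c \<inter> fst c')"
  shows "transition c c' z \<in> coord_space n"
  using assms(3) transition_eq[OF assms(1), of _ c'] coord_mem[OF assms(2)] by auto

lemma transition_continuous:
  assumes "c \<in> \<A>" "c' \<in> \<A>"
  shows "continuous_on (snd c ` (fst c \<inter> fst c')) (\<lambda>z. transition c c' z j)"
proof (cases "j < n")
  case False
  then have "transition c c' z j = 0" if "z \<in> snd c ` (fst c \<inter> fst c')" for z
    using transition_coord_space[OF assms that] by (simp add: coord_space_def)
  then show ?thesis
    using continuous_on_cong[OF refl, of _ "\<lambda>z. transition c c' z j" "\<lambda>z. 0"] by simp
qed (rule smooth_on_continuous[OF transition_smooth[OF assms]])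

text \<open>Takes the place of openness of the domain of \<open>c'\<close>: the coordinates in
  \<open>c\<close> converge inside the open image of the overlap, and injectivity of
  \<open>c\<close> brings this back to the points.\<close>

lemma eventually_in_overlap:
  assumes "c \<in> \<A>" "c' \<in> \<A>" "\<gamma> t \<in> fst c'"
    "\<forall>\<^sub>F s in nhds t. \<gamma> s \<in> fst c" "\<And>i. isCont (\<lambda>s. snd c (\<gamma> s) i) t"
  shows "\<forall>\<^sub>F s in nhds t. \<gamma> s \<in> fst c \<inter> fst c'"
proof -
  have t: "\<gamma> t \<in> fst c" using assms(4) eventually_nhds_x_imp_x by fast
  have "\<forall>\<^sub>F s in nhds t. snd c (\<gamma> s) \<in> coord_space n"
    by (rule eventually_mono[OF assms(4)]) (rule coord_mem[OF assms(1)])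
  then have "\<forall>\<^sub>F s in nhds t. snd c (\<gamma> s) \<in> snd c ` (fst c \<inter> fst c')"
    by (intro eventually_mem_open_in[OF overlap_open[OF assms(1,2)]] assms(5))
       (use t assms(3) in auto)
  with assms(4) show ?thesis
    by eventually_elim (use chart_inj[OF assms(1)] in \<open>auto dest: inj_onD\<close>)
qed

lemma has_velocity_coord_space:
  assumes "c \<in> \<A>" "has_velocity c \<gamma> t w"
  shows "w \<in> coord_space n"
  unfolding coord_space_def
proof (safe)
  fix i assume "n \<le> i"
  have "\<forall>\<^sub>F s in nhds t. snd c (\<gamma> s) i = 0"
    using assms(2) unfolding has_velocity_def
    by (auto elim!: eventually_mono dest: coord_mem[OF assms(1)] simp: coord_space_def \<open>n \<le> i\<close>)
  then have "((\<lambda>s. snd c (\<gamma> s) i) has_field_derivative 0) (at t)"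
    using DERIV_cong_ev[of t t "\<lambda>s. snd c (\<gamma> s) i" "\<lambda>s. 0" 0 0] by simp
  moreover have "((\<lambda>s. snd c (\<gamma> s) i) has_field_derivative w i) (at t)"
    using assms(2) by (simp add: has_velocity_def)
  ultimately show "w i = 0" by (rule DERIV_unique[symmetric])
qed

lemma has_velocity_change:
  assumes "c \<in> \<A>" "c' \<in> \<A>" "has_velocity c \<gamma> t w" "\<gamma> t \<in> fst c'"
  shows "has_velocity c' \<gamma> t (jacobian n c c' (\<gamma> t) w)"
proof -
  have d: "((\<lambda>s. snd c (\<gamma> s) i) has_field_derivative w i) (at t)" for i
    using assms(3) by (simp add: has_velocity_def)
  have ev: "\<forall>\<^sub>F s in nhds t. \<gamma> s \<in> fst c \<inter> fst c'"
    using assms(3) unfolding has_velocity_def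
    by (intro eventually_in_overlap assms(1,2,4)) (auto intro: DERIV_isCont)
  have "((\<lambda>s. snd c' (\<gamma> s) i) has_field_derivative jacobian n c c' (\<gamma> t) w i) (at t)" for i
  proof (cases "i < n")
    case True
    have "((\<lambda>s. transition c c' (snd c (\<gamma> s)) i) has_field_derivative
        (\<Sum>j<n. partial j (\<lambda>z. transition c c' z i) (snd c (\<gamma> t)) * w j)) (at t)"
    proof (rule smooth_on_chain_rule[where u = "\<lambda>s. snd c (\<gamma> s)", OF overlap_open[OF assms(1,2)]
          transition_smooth[OF assms(1,2) True]])
      show "snd c (\<gamma> t) \<in> snd c ` (fst c \<inter> fst c')"
        using has_velocity_mem[OF assms(3)] assms(4) by blast
      show "\<forall>\<^sub>F s in nhds t. snd c (\<gamma> s) \<in> coord_space n"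
        by (rule eventually_mono[OF ev]) (use coord_mem[OF assms(1)] in blast)
    qed (rule d)
    moreover have "\<forall>\<^sub>F s in nhds t. transition c c' (snd c (\<gamma> s)) i = snd c' (\<gamma> s) i"
      by (rule eventually_mono[OF ev]) (use transition_eq[OF assms(1)] in auto)
    ultimately show ?thesis
      using DERIV_cong_ev[OF refl, of "\<lambda>s. transition c c' (snd c (\<gamma> s)) i" "\<lambda>s. snd c' (\<gamma> s) i" t]
        True by (simp add: jacobian_def)
  next
    case False
    have "\<forall>\<^sub>F s in nhds t. snd c' (\<gamma> s) i = 0"
      by (rule eventually_mono[OF ev])
         (use coord_mem[OF assms(2)] False in \<open>auto simp: coord_space_def\<close>)
    then show ?thesis
      using DERIV_cong_ev[OF refl, of "\<lambda>s. snd c' (\<gamma> s) i" "\<lambda>s. 0" t] False by (simp add: jacobian_def)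
  qed
  moreover have "\<forall>\<^sub>F s in nhds t. \<gamma> s \<in> fst c'" by (rule eventually_mono[OF ev]) simp
  ultimately show ?thesis by (simp add: has_velocity_def)
qed

lemma smooth_in_change:
  assumes "c \<in> \<A>" "c' \<in> \<A>" "smooth_in c \<gamma>" "\<gamma> 0 \<in> fst c'"
  shows "smooth_in c' \<gamma>"
proof -
  have s: "smooth_germ (\<lambda>s. snd c (\<gamma> s) i)" for i
    using assms(3) by (simp add: smooth_in_def)
  have ev: "\<forall>\<^sub>F s in nhds 0. \<gamma> s \<in> fst c \<inter> fst c'"
    using assms(3) unfolding smooth_in_def
    by (intro eventually_in_overlap assms(1,2,4)) (auto intro: smooth_germ_isCont)
  have "smooth_germ (\<lambda>s. snd c' (\<gamma> s) i)" for i
  proof (cases "i < n")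
    case True
    have "smooth_germ (\<lambda>s. transition c c' (snd c (\<gamma> s)) i)"
    proof (rule smooth_germ_compose[where u = "\<lambda>s. snd c (\<gamma> s)", OF overlap_open[OF assms(1,2)]
          transition_smooth[OF assms(1,2) True]])
      show "\<forall>\<^sub>F s in nhds 0. snd c (\<gamma> s) \<in> snd c ` (fst c \<inter> fst c')"
        by (rule eventually_mono[OF ev]) blast
    qed (rule s)
    moreover have "\<forall>\<^sub>F s in nhds 0. transition c c' (snd c (\<gamma> s)) i = snd c' (\<gamma> s) i"
      by (rule eventually_mono[OF ev]) (use transition_eq[OF assms(1)] in auto)
    ultimately show ?thesis by (rule smooth_germ_cong[rotated])
  next
    case False
    have "\<forall>\<^sub>F s in nhds 0. 0 = snd c' (\<gamma> s) i"
      by (rule eventually_mono[OF ev])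
         (use coord_mem[OF assms(2)] False in \<open>auto simp: coord_space_def\<close>)
    then show ?thesis by (rule smooth_germ_cong) (rule smooth_germ_const)
  qed
  moreover have "\<forall>\<^sub>F s in nhds 0. \<gamma> s \<in> fst c'" by (rule eventually_mono[OF ev]) simp
  ultimately show ?thesis by (simp add: smooth_in_def)
qed

lemma smooth_in_has_velocity:
  assumes "c \<in> \<A>" "smooth_in c \<gamma>"
  shows "\<forall>\<^sub>F t in nhds 0. has_velocity c \<gamma> t (velocity c \<gamma> t)"
proof -
  have in_c: "\<forall>\<^sub>F t in nhds 0. \<forall>\<^sub>F s in nhds t. \<gamma> s \<in> fst c"
    using assms(2) by (simp add: smooth_in_def eventually_eventually)
  have "\<forall>\<^sub>F t in nhds 0. \<forall>i\<in>{..<n}. (\<lambda>s. snd c (\<gamma> s) i) field_differentiable at t"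
    using assms(2) by (intro eventually_ball_finite) (auto simp: smooth_in_def intro: smooth_germ_differentiable)
  with in_c show ?thesis
  proof eventually_elim
    case (elim t)
    have "((\<lambda>s. snd c (\<gamma> s) i) has_field_derivative velocity c \<gamma> t i) (at t)" for i
    proof (cases "i < n")
      case True
      then show ?thesis using elim by (simp add: velocity_def DERIV_deriv_iff_field_differentiable)
    next
      case False
      have *: "\<forall>\<^sub>F s in nhds t. snd c (\<gamma> s) i = 0"
        by (rule eventually_mono[OF elim(1)])
           (use coord_mem[OF assms(1)] False in \<open>auto simp: coord_space_def\<close>)
      then have "((\<lambda>s. snd c (\<gamma> s) i) has_field_derivative 0) (at t)"
        using DERIV_cong_ev[OF refl *, of 0 0] by simp
      then show ?thesis by (simp add: velocity_def DERIV_imp_deriv)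
    qed
    then show ?case using elim(1) by (simp add: has_velocity_def)
  qed
qed

lemma smooth_in_has_velocity_0: "c \<in> \<A> \<Longrightarrow> smooth_in c \<gamma> \<Longrightarrow> has_velocity c \<gamma> 0 (velocity c \<gamma> 0)"
  using eventually_nhds_x_imp_x[OF smooth_in_has_velocity] .

lemma line_coords:
  assumes "c \<in> \<A>" "p \<in> fst c" "w \<in> coord_space n"
  shows "line c p w 0 = p"
    "\<forall>\<^sub>F s in nhds 0. line c p w s \<in> fst c \<and> snd c (line c p w s) = (\<lambda>i. snd c p i + s * w i)"
proof -
  show "line c p w 0 = p" using inv_into_f_f[OF chart_inj[OF assms(1)] assms(2)] by (simp add: line_def)
  have "\<forall>\<^sub>F s in nhds 0. (\<lambda>i. snd c p i + s * w i) \<in> snd c ` fst c"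
  proof (rule eventually_mem_open_in[OF chart_open[OF assms(1)]])
    show "(\<lambda>i. snd c p i + 0 * w i) \<in> snd c ` fst c" using assms(2) by simp
    show "\<forall>\<^sub>F s in nhds 0. (\<lambda>i. snd c p i + s * w i) \<in> coord_space n"
      using coord_mem[OF assms(1,2)] assms(3) by (simp add: coord_space_def)
  qed (auto intro!: continuous_intros)
  then show "\<forall>\<^sub>F s in nhds 0. line c p w s \<in> fst c \<and> snd c (line c p w s) = (\<lambda>i. snd c p i + s * w i)"
    by (rule eventually_mono) (simp add: line_def inv_into_into f_inv_into_f)
qed

lemma line_smooth:
  assumes "c \<in> \<A>" "p \<in> fst c" "w \<in> coord_space n"
  shows "smooth_in c (line c p w)" "has_velocity c (line c p w) 0 w"
proof -
  note ev = line_coords(2)[OF assms]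
  have "smooth_germ (\<lambda>s. snd c (line c p w s) i)" for i
  proof (rule smooth_germ_cong[OF _ smooth_germ_affine[of "snd c p i" "w i"]])
    show "\<forall>\<^sub>F t in nhds 0. snd c p i + w i * t = snd c (line c p w t) i"
      by (rule eventually_mono[OF ev]) (simp add: mult.commute)
  qed
  then show s: "smooth_in c (line c p w)"
    unfolding smooth_in_def using eventually_mono[OF ev] by auto
  have "((\<lambda>s. snd c (line c p w s) i) has_field_derivative w i) (at 0)" for i
  proof -
    have *: "\<forall>\<^sub>F s in nhds 0. snd c (line c p w s) i = snd c p i + s * w i"
      by (rule eventually_mono[OF ev]) simp
    have "((\<lambda>s. snd c p i + s * w i) has_field_derivative 0 + 1 * w i) (at 0)"
      by (intro DERIV_add DERIV_const DERIV_cmult_right DERIV_ident)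
    then show ?thesis using DERIV_cong_ev[OF refl *, of "w i" "w i"] by simp
  qed
  then show "has_velocity c (line c p w) 0 w"
    using s by (simp add: has_velocity_def smooth_in_def)
qed

lemma tangent_has_velocity:
  assumes "c \<in> \<A>" "has_velocity c \<gamma> t w"
  shows "has_velocity (chart_at \<A> (\<gamma> t)) \<gamma> t (tangent \<A> \<gamma> t)"
    "tangent \<A> \<gamma> t = jacobian n c (chart_at \<A> (\<gamma> t)) (\<gamma> t) w"
    "tangent \<A> \<gamma> t \<in> coord_space n"
proof -
  have M: "\<gamma> t \<in> M" using has_velocity_mem[OF assms(2)] inM assms(1) by blast
  have h: "has_velocity (chart_at \<A> (\<gamma> t)) \<gamma> t (jacobian n c (chart_at \<A> (\<gamma> t)) (\<gamma> t) w)"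
    by (rule has_velocity_change[OF assms(1) chart_at(1)[OF M] assms(2) chart_at(2)[OF M]])
  then show eq: "tangent \<A> \<gamma> t = jacobian n c (chart_at \<A> (\<gamma> t)) (\<gamma> t) w"
    unfolding tangent_def by (rule has_velocity_imp_velocity)
  show *: "has_velocity (chart_at \<A> (\<gamma> t)) \<gamma> t (tangent \<A> \<gamma> t)" using h eq by simp
  show "tangent \<A> \<gamma> t \<in> coord_space n" by (rule has_velocity_coord_space[OF chart_at(1)[OF M] *])
qed

lemma curve_along:
  assumes "p \<in> M" "v \<in> coord_space n"
  shows "curve_along \<A> p v 0 = p" "smooth_in (chart_at \<A> p) (curve_along \<A> p v)"
    "has_velocity (chart_at \<A> p) (curve_along \<A> p v) 0 v"
  unfolding curve_along_eq_line using line_coords(1) line_smooth chart_at[OF assms(1)] assms(2) by auto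

lemma d_coord_jacobian:
  assumes "c \<in> \<A>" "p \<in> fst c" "v \<in> coord_space n"
  shows "has_velocity c (curve_along \<A> p v) 0 (d_coord \<A> c p v)"
    "d_coord \<A> c p v = jacobian n (chart_at \<A> p) c p v"
proof -
  have M: "p \<in> M" using assms inM by blast
  have "has_velocity c (curve_along \<A> p v) 0 (jacobian n (chart_at \<A> p) c (curve_along \<A> p v 0) v)"
    by (rule has_velocity_change[OF chart_at(1)[OF M] assms(1) curve_along(3)[OF M assms(3)]])
       (use curve_along(1)[OF M assms(3)] assms(2) in simp)
  then have *: "has_velocity c (curve_along \<A> p v) 0 (jacobian n (chart_at \<A> p) c p v)"
    using curve_along(1)[OF M assms(3)] by simp
  then show "d_coord \<A> c p v = jacobian n (chart_at \<A> p) c p v"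
    unfolding d_coord_def by (rule has_velocity_imp_velocity)
  with * show "has_velocity c (curve_along \<A> p v) 0 (d_coord \<A> c p v)" by simp
qed

text \<open>No inverse Jacobian is computed: \<open>\<gamma>\<close> has velocity \<open>w\<close>
  in \<open>c\<close>, hence some velocity in the preferred chart, and carrying the latter back to
  \<open>c\<close> must give \<open>w\<close> because velocities are unique.\<close>

lemma d_coord_tangent:
  assumes "c \<in> \<A>" "has_velocity c \<gamma> t w"
  shows "d_coord \<A> c (\<gamma> t) (tangent \<A> \<gamma> t) = w"
proof -
  have p: "\<gamma> t \<in> fst c" "\<gamma> t \<in> M" using has_velocity_mem[OF assms(2)] inM assms(1) by blast+
  note tv = tangent_has_velocity[OF assms]
  have "has_velocity c \<gamma> t (jacobian n (chart_at \<A> (\<gamma> t)) c (\<gamma> t) (tangent \<A> \<gamma> t))"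
    by (rule has_velocity_change[OF chart_at(1)[OF p(2)] assms(1) tv(1) p(1)])
  then show ?thesis
    using has_velocity_unique[OF assms(2)] d_coord_jacobian(2)[OF assms(1) p(1) tv(3)] by simp
qed

lemma d_coord_coord_space:
  assumes "c \<in> \<A>" "p \<in> fst c" "v \<in> coord_space n"
  shows "d_coord \<A> c p v \<in> coord_space n"
  using has_velocity_coord_space[OF assms(1) d_coord_jacobian(1)[OF assms]] .

lemma d_coord_scale:
  assumes "c \<in> \<A>" "p \<in> fst c" "v \<in> coord_space n"
  shows "d_coord \<A> c p (\<lambda>i. a * v i) = (\<lambda>i. a * d_coord \<A> c p v i)"
proof -
  have "(\<lambda>i. a * v i) \<in> coord_space n" using assms(3) by (simp add: coord_space_def)
  then show ?thesis
    by (simp add: d_coord_jacobian(2)[OF assms(1,2)] assms(3) jacobian_def fun_eq_iff sum_distrib_left mult.left_commute)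
qed

lemma d_coord_change:
  assumes "c \<in> \<A>" "c' \<in> \<A>" "p \<in> fst c" "p \<in> fst c'" "v \<in> coord_space n"
  shows "d_coord \<A> c' p v = jacobian n c c' p (d_coord \<A> c p v)"
proof -
  have M: "p \<in> M" using assms inM by blast
  have 0: "curve_along \<A> p v 0 = p" by (rule curve_along(1)[OF M assms(5)])
  have "has_velocity c' (curve_along \<A> p v) 0 (jacobian n c c' (curve_along \<A> p v 0) (d_coord \<A> c p v))"
    by (rule has_velocity_change[OF assms(1,2) d_coord_jacobian(1)[OF assms(1,3,5)]]) (use 0 assms(4) in simp)
  then show ?thesis
    using has_velocity_unique[OF d_coord_jacobian(1)[OF assms(2,4,5)]] 0 by simp
qed

text \<open>The curve \<open>curve_along \<A> p v\<close> has velocity \<open>v\<close> in the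
  preferred chart, so \<open>v\<close> is recovered from \<open>d_coord \<A> c p v\<close> by the
  change of charts starting at \<open>c\<close>.\<close>

lemma d_coord_inj:
  assumes "c \<in> \<A>" "p \<in> fst c" "v \<in> coord_space n" "v' \<in> coord_space n"
    "d_coord \<A> c p v = d_coord \<A> c p v'"
  shows "v = v'"
proof -
  have M: "p \<in> M" using assms inM by blast
  have "v = jacobian n c (chart_at \<A> p) p (d_coord \<A> c p v)" if "v \<in> coord_space n" for v
  proof -
    have 0: "curve_along \<A> p v 0 = p" by (rule curve_along(1)[OF M that])
    have "has_velocity (chart_at \<A> p) (curve_along \<A> p v) 0
        (jacobian n c (chart_at \<A> p) (curve_along \<A> p v 0) (d_coord \<A> c p v))"
      by (rule has_velocity_change[OF assms(1) chart_at(1)[OF M] d_coord_jacobian(1)[OF assms(1,2) that]])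
         (use 0 chart_at(2)[OF M] in simp)
    then show ?thesis using has_velocity_unique[OF curve_along(3)[OF M that]] 0 by simp
  qed
  then show ?thesis using assms(3-5) by metis
qed

lemma d_coord_zero:
  assumes "c \<in> \<A>" "p \<in> fst c"
  shows "d_coord \<A> c p (\<lambda>_. 0) = (\<lambda>_. 0)"
  using d_coord_scale[OF assms, of "\<lambda>_. 0" 0] by (simp add: coord_space_def)

lemma d_coord_eq_zero:
  assumes "c \<in> \<A>" "p \<in> fst c" "v \<in> coord_space n" "d_coord \<A> c p v = (\<lambda>_. 0)"
  shows "v = (\<lambda>_. 0)"
  using d_coord_inj[OF assms(1-3), of "\<lambda>_. 0"] d_coord_zero[OF assms(1,2)] assms(4)
  by (simp add: coord_space_def)

text \<open>The inverse of \<open>d_coord \<A> c p\<close>, realized by a straight line in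
  \<open>c\<close> instead of a matrix.\<close>

definition of_coord :: "('p, 'k) chart \<Rightarrow> 'p \<Rightarrow> (nat \<Rightarrow> 'k) \<Rightarrow> nat \<Rightarrow> 'k" where
  "of_coord c p w = tangent \<A> (line c p w) 0"

lemma of_coord:
  assumes "c \<in> \<A>" "p \<in> fst c" "w \<in> coord_space n"
  shows "of_coord c p w \<in> coord_space n" "d_coord \<A> c p (of_coord c p w) = w"
proof -
  note h = line_smooth(2)[OF assms]
  show "of_coord c p w \<in> coord_space n"
    unfolding of_coord_def by (rule tangent_has_velocity(3)[OF assms(1) h])
  show "d_coord \<A> c p (of_coord c p w) = w"
    using d_coord_tangent[OF assms(1) h] line_coords(1)[OF assms] by (simp add: of_coord_def)
qed

lemma of_coord_d_coord:
  assumes "c \<in> \<A>" "p \<in> fst c" "v \<in> coord_space n"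
  shows "of_coord c p (d_coord \<A> c p v) = v"
  by (rule d_coord_inj[OF assms(1,2) _ assms(3)])
     (use of_coord[OF assms(1,2)] d_coord_coord_space[OF assms] in auto)

text \<open>Membership may be tested on the straight line of any chart, since
  \<open>tangent_space\<close> admits all smooth curves and not only lines of the preferred
  chart.\<close>

lemma tangent_spaceI:
  assumes "c \<in> \<A>" "p \<in> fst c" "v \<in> coord_space n" "\<forall>\<^sub>F s in nhds 0. line c p (d_coord \<A> c p v) s \<in> N"
  shows "v \<in> tangent_space \<A> N p"
proof -
  let ?w = "d_coord \<A> c p v"
  have w: "?w \<in> coord_space n" by (rule d_coord_coord_space[OF assms(1-3)])
  have "v = tangent \<A> (line c p ?w) 0"
    using of_coord_d_coord[OF assms(1-3)] by (simp add: of_coord_def)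
  moreover have "smooth_curve \<A> (line c p ?w)"
    unfolding smooth_curve_iff using line_smooth(1)[OF assms(1,2) w] assms(1) by blast
  ultimately show ?thesis
    unfolding tangent_space_def using line_coords(1)[OF assms(1,2) w] assms(4) by blast
qed

lemma tangent_spaceD:
  assumes "c \<in> \<A>" "p \<in> fst c" "v \<in> tangent_space \<A> N p"
  obtains \<gamma> where "smooth_in c \<gamma>" "\<gamma> 0 = p" "\<forall>\<^sub>F s in nhds 0. \<gamma> s \<in> N" "v \<in> coord_space n"
    "has_velocity c \<gamma> 0 (d_coord \<A> c p v)" "v = tangent \<A> \<gamma> 0"
proof -
  obtain \<gamma> d where g: "v = tangent \<A> \<gamma> 0" "d \<in> \<A>" "smooth_in d \<gamma>" "\<gamma> 0 = p" "\<forall>\<^sub>F s in nhds 0. \<gamma> s \<in> N"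
    using assms(3) unfolding tangent_space_def smooth_curve_iff by blast
  have s: "smooth_in c \<gamma>" by (rule smooth_in_change[OF g(2) assms(1) g(3)]) (use g(4) assms(2) in simp)
  note h = smooth_in_has_velocity_0[OF assms(1) s]
  have "d_coord \<A> c p v = velocity c \<gamma> 0" using d_coord_tangent[OF assms(1) h] g(1,4) by simp
  then show thesis
    using that[OF s g(4,5) _ _ g(1)] h tangent_has_velocity(3)[OF assms(1) h] g(1) by simp
qed

lemma tangent_space_M:
  assumes "p \<in> M"
  shows "tangent_space \<A> M p = coord_space n"
proof (intro subset_antisym subsetI)
  fix v assume v: "v \<in> tangent_space \<A> M p"
  show "v \<in> coord_space n" by (rule tangent_spaceD[OF chart_at[OF assms] v])
next
  fix v :: "nat \<Rightarrow> 'k" assume v: "v \<in> coord_space n"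
  note w = d_coord_coord_space[OF chart_at[OF assms] v]
  show "v \<in> tangent_space \<A> M p"
    by (rule tangent_spaceI[OF chart_at[OF assms] v])
       (rule eventually_mono[OF line_coords(2)[OF chart_at[OF assms] w]], use inM chart_at[OF assms] in blast)
qed

end

section \<open>Prolongation of a rank 2 distribution\<close>

text \<open>In the chart, \<open>D\<close> is a graph over the plane of the coordinates
  \<open>a\<close> and \<open>b\<close>, with smooth coefficients \<open>\<alpha>\<close> and
  \<open>\<beta>\<close>: a smooth rank 2 distribution on which these two differentials are a basis
  of the dual.\<close>

definition framed :: "nat \<Rightarrow> ('p, 'k::real_normed_field) chart set \<Rightarrow> ('p \<Rightarrow> (nat \<Rightarrow> 'k) set) \<Rightarrow> ('p, 'k) chart \<Rightarrow>
    nat \<Rightarrow> nat \<Rightarrow> (nat \<Rightarrow> (nat \<Rightarrow> 'k) \<Rightarrow> 'k) \<Rightarrow> (nat \<Rightarrow> (nat \<Rightarrow> 'k) \<Rightarrow> 'k) \<Rightarrow> bool" where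
  "framed n \<A> D c a b \<alpha> \<beta> \<longleftrightarrow> a < n \<and> b < n \<and> a \<noteq> b \<and>
     (\<forall>i<n. smooth_on n (snd c ` fst c) (\<alpha> i) \<and> smooth_on n (snd c ` fst c) (\<beta> i)) \<and>
     (\<forall>z\<in>snd c ` fst c. \<alpha> a z = 1 \<and> \<beta> a z = 0 \<and> \<alpha> b z = 0 \<and> \<beta> b z = 1) \<and>
     (\<forall>q\<in>fst c. d_coord \<A> c q ` D q =
        {w \<in> coord_space n. \<forall>i<n. w i = \<alpha> i (snd c q) * w a + \<beta> i (snd c q) * w b})"

lemma coord_space_SucD: "z \<in> coord_space (Suc n) \<Longrightarrow> z(n := 0) \<in> coord_space n"
  by (auto simp: coord_space_def)

lemma coord_space_SucI: "z \<in> coord_space n \<Longrightarrow> z(n := m) \<in> coord_space (Suc n)"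
  by (auto simp: coord_space_def)

lemma open_in_Suc:
  assumes "open_in n W"
  shows "open_in (Suc n) {z \<in> coord_space (Suc n). z(n := 0) \<in> W}"
proof (rule open_in_preimage[OF open_in_coord_space assms])
  fix j
  have "continuous_on (coord_space (Suc n)) (\<lambda>z::nat \<Rightarrow> 'a. z j)"
    using C_on_continuous[OF C_on_coord[of 0 0]] by blast
  then show "continuous_on (coord_space (Suc n)) (\<lambda>z::nat \<Rightarrow> 'a. (z(n := 0)) j)"
    by (cases "j = n") auto
qed (rule coord_space_SucD)

text \<open>Setting coordinate \<open>n\<close> to 0 is the bundle projection in coordinates; this
  pulls functions on the base back to the projectivization.\<close>

lemma smooth_on_Suc:
  assumes "open_in n W" "smooth_on n W f"
  shows "smooth_on (Suc n) {z \<in> coord_space (Suc n). z(n := 0) \<in> W} (\<lambda>z. f (z(n := 0)))"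
proof (rule smooth_on_compose[OF assms(1) open_in_Suc[OF assms(1)] _ _ assms(2)])
  fix j assume "j < n"
  then have "(\<lambda>z. (z(n := 0)) j) = (\<lambda>z::nat \<Rightarrow> 'a. z j)" by auto
  then show "smooth_on (Suc n) {z \<in> coord_space (Suc n). z(n := 0) \<in> W} (\<lambda>z. (z(n := 0)) j)"
    using smooth_on_coord by simp
qed simp

locale distribution = manifold n M \<A>
  for n :: nat and M :: "('a, 'k::real_normed_field) pt set" and \<A> :: "(('a, 'k) pt, 'k) chart set" +
  fixes D :: "('a, 'k) distr"
  assumes D_sub: "p \<in> M \<Longrightarrow> D p \<subseteq> coord_space n"
    and framed: "c \<in> \<A> \<Longrightarrow> \<exists>a b \<alpha> \<beta>. framed n \<A> D c a b \<alpha> \<beta>"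
begin

abbreviation "d \<equiv> d_coord \<A>"

text \<open>The condition in \<open>prolong_chart\<close> under which \<open>a\<close> and
  \<open>b\<close> yield a fiber coordinate, isolated here because it cuts out an open part of the
  chart.\<close>

definition indep :: "(('a, 'k) pt, 'k) chart \<Rightarrow> nat \<Rightarrow> nat \<Rightarrow> ('a, 'k) pt \<Rightarrow> bool" where
  "indep c a b p \<longleftrightarrow> (\<forall>w\<in>D p. d c p w a = 0 \<and> d c p w b = 0 \<longrightarrow> w = (\<lambda>_. 0))"

abbreviation "M' \<equiv> projectivization M D"
abbreviation "\<A>' \<equiv> prolong_atlas n \<A> M D"
abbreviation "D' \<equiv> prolong_distr \<A> \<A>' M D"
abbreviation "pc \<equiv> prolong_chart n \<A> M D"

lemma D_coord: "c \<in> \<A> \<Longrightarrow> p \<in> fst c \<Longrightarrow> v \<in> D p \<Longrightarrow> v \<in> coord_space n"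
  using D_sub inM by blast

text \<open>\<open>D p\<close> is only known as a set of vectors. Its closure under scaling is
  inherited from the linear equations of a frame, through injectivity of the coordinates.\<close>

lemma D_scale:
  assumes "p \<in> M" "v \<in> D p"
  shows "(\<lambda>i. x * v i) \<in> D p"
proof -
  note c = chart_at[OF assms(1)]
  let ?c = "chart_at \<A> p"
  obtain a b \<alpha> \<beta> where f: "framed n \<A> D ?c a b \<alpha> \<beta>" using framed[OF c(1)] by blast
  then have im: "d ?c p ` D p = {w \<in> coord_space n. \<forall>i<n. w i = \<alpha> i (snd ?c p) * w a + \<beta> i (snd ?c p) * w b}"
    using c(2) by (simp add: framed_def)
  have v: "v \<in> coord_space n" using D_sub assms by blast
  then have xv: "(\<lambda>i. x * v i) \<in> coord_space n" by (simp add: coord_space_def)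
  have "d ?c p v \<in> d ?c p ` D p" using assms(2) by blast
  then have "d ?c p (\<lambda>i. x * v i) \<in> d ?c p ` D p"
    unfolding im d_coord_scale[OF c v] by (simp add: coord_space_def algebra_simps)
  then obtain v' where "v' \<in> D p" "d ?c p (\<lambda>i. x * v i) = d ?c p v'" by blast
  moreover have "v' \<in> coord_space n" using D_sub assms(1) \<open>v' \<in> D p\<close> by blast
  ultimately show ?thesis using d_coord_inj[OF c xv] by blast
qed

lemma frame_mem:
  assumes "framed n \<A> D c a b \<alpha> \<beta>" "c \<in> \<A>" "p \<in> fst c"
  shows "\<exists>v\<in>D p. \<forall>i<n. d c p v i = \<alpha> i (snd c p) * x + \<beta> i (snd c p) * y"
    "\<And>v i. v \<in> D p \<Longrightarrow> i < n \<Longrightarrow> d c p v i = \<alpha> i (snd c p) * d c p v a + \<beta> i (snd c p) * d c p v b"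
proof -
  have im: "d c p ` D p = {w \<in> coord_space n. \<forall>i<n. w i = \<alpha> i (snd c p) * w a + \<beta> i (snd c p) * w b}"
    using assms by (simp add: framed_def)
  then show "d c p v i = \<alpha> i (snd c p) * d c p v a + \<beta> i (snd c p) * d c p v b"
    if "v \<in> D p" "i < n" for v i
    using that by blast
  define w where "w = (\<lambda>i. if i < n then \<alpha> i (snd c p) * x + \<beta> i (snd c p) * y else 0)"
  have "w a = x" "w b = y" using assms by (auto simp: w_def framed_def)
  then have "w \<in> d c p ` D p" unfolding im by (simp add: coord_space_def w_def)
  then obtain v where v: "v \<in> D p" "w = d c p v" by blast
  then show "\<exists>v\<in>D p. \<forall>i<n. d c p v i = \<alpha> i (snd c p) * x + \<beta> i (snd c p) * y"
    by (intro bexI[OF _ v(1)]) (simp add: v(2)[symmetric] w_def)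
qed

lemma frame_indep:
  assumes "framed n \<A> D c a b \<alpha> \<beta>" "c \<in> \<A>" "p \<in> fst c"
  shows "indep c a b p"
  unfolding indep_def
proof (intro ballI impI)
  fix v assume v: "v \<in> D p" "d c p v a = 0 \<and> d c p v b = 0"
  have vc: "v \<in> coord_space n" using D_coord assms v by blast
  have "d c p v i = 0" for i
    using frame_mem(2)[OF assms v(1), of i] v(2) d_coord_coord_space[OF assms(2,3) vc]
    by (cases "i < n") (auto simp: coord_space_def)
  then show "v = (\<lambda>_. 0)" by (intro d_coord_eq_zero[OF assms(2,3) vc]) auto
qed

text \<open>By Cramer's rule, the vector of \<open>D\<close> with coordinates \<open>dx\<^sub>a = 1\<close> and \<open>dx\<^sub>b = m\<close> depends smoothly
  on the base point and on \<open>m\<close>; \<open>E i\<close> is its \<open>i\<close>th coordinate.\<close>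

definition frame_solution :: "(('a, 'k) pt, 'k) chart \<Rightarrow> nat \<Rightarrow> nat \<Rightarrow> (nat \<Rightarrow> 'k) set \<Rightarrow>
    (nat \<Rightarrow> (nat \<Rightarrow> 'k) \<Rightarrow> 'k) \<Rightarrow> bool" where
  "frame_solution c a b W E \<longleftrightarrow> open_in n W \<and> W \<subseteq> snd c ` fst c \<and>
     (\<forall>p\<in>fst c. indep c a b p \<longleftrightarrow> snd c p \<in> W) \<and>
     (\<forall>i<n. smooth_on (Suc n) {z \<in> coord_space (Suc n). z(n := 0) \<in> W} (E i)) \<and>
     (\<forall>p\<in>fst c. snd c p \<in> W \<longrightarrow>
        (\<forall>v\<in>D p. \<forall>m. d c p v b = m * d c p v a \<longrightarrow> (\<forall>i<n. d c p v i = d c p v a * E i ((snd c p)(n := m)))) \<and>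
        (\<forall>m. \<exists>v\<in>D p. d c p v a = 1 \<and> d c p v b = m))"

lemma frame_solutionD:
  assumes "frame_solution c a b W E"
  shows "open_in n W" "W \<subseteq> snd c ` fst c"
    "p \<in> fst c \<Longrightarrow> indep c a b p \<longleftrightarrow> snd c p \<in> W"
    "i < n \<Longrightarrow> smooth_on (Suc n) {z \<in> coord_space (Suc n). z(n := 0) \<in> W} (E i)"
    "p \<in> fst c \<Longrightarrow> snd c p \<in> W \<Longrightarrow> v \<in> D p \<Longrightarrow> d c p v b = m * d c p v a \<Longrightarrow> i < n \<Longrightarrow>
        d c p v i = d c p v a * E i ((snd c p)(n := m))"
    "p \<in> fst c \<Longrightarrow> snd c p \<in> W \<Longrightarrow> \<exists>v\<in>D p. d c p v a = 1 \<and> d c p v b = m"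
  using assms unfolding frame_solution_def by blast+

lemma frame_solution_exists:
  assumes "c \<in> \<A>" "a < n" "b < n"
  obtains W E where "frame_solution c a b W E"
proof -
  obtain a' b' \<alpha> \<beta> where f: "framed n \<A> D c a' b' \<alpha> \<beta>" using framed[OF assms(1)] by blast
  \<comment> \<open>The determinant of the differentials of \<open>a\<close> and \<open>b\<close> on
    the frame; they are independent exactly where it does not vanish.\<close>
  define det where "det z = \<alpha> a z * \<beta> b z - \<alpha> b z * \<beta> a z" for z
  define W where "W = {z \<in> snd c ` fst c. det z \<noteq> 0}"
  define E where "E i z = (\<alpha> i (z(n := 0)) * (\<beta> b (z(n := 0)) - z n * \<beta> a (z(n := 0))) +
      \<beta> i (z(n := 0)) * (z n * \<alpha> a (z(n := 0)) - \<alpha> b (z(n := 0)))) / det (z(n := 0))" for i z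
  note oc = chart_open[OF assms(1)]
  have sm: "smooth_on n (snd c ` fst c) (\<alpha> i)" "smooth_on n (snd c ` fst c) (\<beta> i)" if "i < n" for i
    using f that by (auto simp: framed_def)
  have sdet: "smooth_on n (snd c ` fst c) det"
    unfolding det_def by (intro smooth_on_diff smooth_on_mult oc sm assms)
  have oW: "open_in n W"
    unfolding W_def by (rule open_in_preimage_neq[OF oc smooth_on_continuous[OF sdet]])
  have Wsub: "W \<subseteq> snd c ` fst c" by (auto simp: W_def)
  let ?W' = "{z \<in> coord_space (Suc n). z(n := 0) \<in> W}"
  have oW': "open_in (Suc n) ?W'" by (rule open_in_Suc[OF oW])
  have sm': "smooth_on (Suc n) ?W' (\<lambda>z. g (z(n := 0)))" if "smooth_on n (snd c ` fst c) g" for g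
    by (rule smooth_on_Suc[OF oW smooth_on_subset[OF that Wsub]])
  have sE: "smooth_on (Suc n) ?W' (E i)" if "i < n" for i
    unfolding E_def
    by (intro smooth_on_divide smooth_on_add smooth_on_diff smooth_on_mult oW' sm' sm sdet smooth_on_coord that assms)
       (auto simp: W_def)
  have ind: "indep c a b p \<longleftrightarrow> snd c p \<in> W" if p: "p \<in> fst c" for p
  proof -
    let ?z = "snd c p"
    note fm = frame_mem[OF f assms(1) p]
    have "indep c a b p \<longleftrightarrow> det ?z \<noteq> 0"
    proof
      assume i: "indep c a b p"
      show "det ?z \<noteq> 0"
      proof
        assume 0: "det ?z = 0"
        \<comment> \<open>A singular two by two matrix has a nonzero kernel vector, read off from a
          nonzero row if there is one.\<close>
        have "\<exists>x y. (x \<noteq> 0 \<or> y \<noteq> 0) \<and> \<alpha> a ?z * x + \<beta> a ?z * y = 0 \<and> \<alpha> b ?z * x + \<beta> b ?z * y = 0"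
        proof (cases "\<alpha> a ?z = 0 \<and> \<beta> a ?z = 0")
          case True
          show ?thesis
          proof (cases "\<alpha> b ?z = 0 \<and> \<beta> b ?z = 0")
            case True
            with \<open>\<alpha> a ?z = 0 \<and> \<beta> a ?z = 0\<close> show ?thesis by (intro exI[of _ 1]) auto
          next
            case False
            with True show ?thesis by (intro exI[of _ "\<beta> b ?z"] exI[of _ "- \<alpha> b ?z"]) auto
          qed
        next
          case False
          with 0 show ?thesis
            by (intro exI[of _ "\<beta> a ?z"] exI[of _ "- \<alpha> a ?z"]) (auto simp: det_def algebra_simps)
        qed
        then obtain x y where xy: "x \<noteq> 0 \<or> y \<noteq> 0" "\<alpha> a ?z * x + \<beta> a ?z * y = 0" "\<alpha> b ?z * x + \<beta> b ?z * y = 0"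
          by blast
        obtain v where v: "v \<in> D p" "\<forall>i<n. d c p v i = \<alpha> i ?z * x + \<beta> i ?z * y" using fm(1) by blast
        have "v = (\<lambda>_. 0)" using i v xy(2,3) assms(2,3) by (simp add: indep_def)
        then have "d c p v = (\<lambda>_. 0)" using d_coord_zero[OF assms(1) p] by simp
        moreover have "d c p v a' = x" "d c p v b' = y"
          using v(2) f p by (auto simp: framed_def)
        ultimately show False using xy(1) by simp
      qed
    next
      assume nz: "det ?z \<noteq> 0"
      show "indep c a b p"
        unfolding indep_def
      proof (intro ballI impI)
        fix v assume v: "v \<in> D p" "d c p v a = 0 \<and> d c p v b = 0"
        let ?x = "d c p v a'" and ?y = "d c p v b'"
        have "?x * det ?z = (\<alpha> a ?z * ?x + \<beta> a ?z * ?y) * \<beta> b ?z - (\<alpha> b ?z * ?x + \<beta> b ?z * ?y) * \<beta> a ?z"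
          "?y * det ?z = (\<alpha> b ?z * ?x + \<beta> b ?z * ?y) * \<alpha> a ?z - (\<alpha> a ?z * ?x + \<beta> a ?z * ?y) * \<alpha> b ?z"
          by (simp_all add: det_def algebra_simps)
        then have "?x = 0" "?y = 0"
          using fm(2)[OF v(1) assms(2)] fm(2)[OF v(1) assms(3)] v(2) nz by auto
        then show "v = (\<lambda>_. 0)" using frame_indep[OF f assms(1) p] v(1) by (simp add: indep_def)
      qed
    qed
    then show ?thesis using p by (auto simp: W_def)
  qed
  have solve: "d c p v i = d c p v a * E i ((snd c p)(n := m))"
    if p: "p \<in> fst c" "snd c p \<in> W" "v \<in> D p" and m: "d c p v b = m * d c p v a" and i: "i < n" for p v m i
  proof -
    let ?z = "snd c p" and ?x = "d c p v a'" and ?y = "d c p v b'" and ?s = "d c p v a"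
    have z: "(?z(n := m))(n := 0) = ?z"
      using coord_mem[OF assms(1) p(1)] by (auto simp: coord_space_def fun_eq_iff)
    note fm = frame_mem(2)[OF f assms(1) p(1,3)]
    have nz: "det ?z \<noteq> 0" using p(2) by (simp add: W_def)
    have st: "\<alpha> a ?z * ?x + \<beta> a ?z * ?y = ?s" "\<alpha> b ?z * ?x + \<beta> b ?z * ?y = m * ?s"
      using fm[OF assms(2)] fm[OF assms(3)] m by simp_all
    have "?x * det ?z = (\<alpha> a ?z * ?x + \<beta> a ?z * ?y) * \<beta> b ?z - (\<alpha> b ?z * ?x + \<beta> b ?z * ?y) * \<beta> a ?z"
      "?y * det ?z = (\<alpha> b ?z * ?x + \<beta> b ?z * ?y) * \<alpha> a ?z - (\<alpha> a ?z * ?x + \<beta> a ?z * ?y) * \<alpha> b ?z"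
      by (simp_all add: det_def algebra_simps)
    then have "?x * det ?z = ?s * (\<beta> b ?z - m * \<beta> a ?z)" "?y * det ?z = ?s * (m * \<alpha> a ?z - \<alpha> b ?z)"
      unfolding st by (simp_all add: algebra_simps)
    then have x: "?x = ?s * (\<beta> b ?z - m * \<beta> a ?z) / det ?z" and y: "?y = ?s * (m * \<alpha> a ?z - \<alpha> b ?z) / det ?z"
      using nz by (simp_all add: nonzero_eq_divide_eq)
    have "d c p v i = \<alpha> i ?z * ?x + \<beta> i ?z * ?y" by (rule fm[OF i])
    also have "\<dots> = ?s * E i (?z(n := m))"
      unfolding x y E_def z by (simp add: add_divide_distrib diff_divide_distrib algebra_simps)
    finally show ?thesis .
  qed
  have ex: "\<exists>v\<in>D p. d c p v a = 1 \<and> d c p v b = m" if p: "p \<in> fst c" "snd c p \<in> W" for p m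
  proof -
    let ?z = "snd c p"
    have nz: "det ?z \<noteq> 0" using p(2) by (simp add: W_def)
    obtain v where v: "v \<in> D p" "\<forall>i<n. d c p v i = \<alpha> i ?z * ((\<beta> b ?z - m * \<beta> a ?z) / det ?z)
        + \<beta> i ?z * ((m * \<alpha> a ?z - \<alpha> b ?z) / det ?z)"
      using frame_mem(1)[OF f assms(1) p(1)] by blast
    have "d c p v a = (\<alpha> a ?z * (\<beta> b ?z - m * \<beta> a ?z) + \<beta> a ?z * (m * \<alpha> a ?z - \<alpha> b ?z)) / det ?z"
      "d c p v b = (\<alpha> b ?z * (\<beta> b ?z - m * \<beta> a ?z) + \<beta> b ?z * (m * \<alpha> a ?z - \<alpha> b ?z)) / det ?z"
      using v(2) assms(2,3) by (simp_all add: add_divide_distrib)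
    moreover have "\<alpha> a ?z * (\<beta> b ?z - m * \<beta> a ?z) + \<beta> a ?z * (m * \<alpha> a ?z - \<alpha> b ?z) = det ?z"
      "\<alpha> b ?z * (\<beta> b ?z - m * \<beta> a ?z) + \<beta> b ?z * (m * \<alpha> a ?z - \<alpha> b ?z) = m * det ?z"
      by (simp_all add: det_def algebra_simps)
    ultimately show ?thesis using v(1) nz by auto
  qed
  show thesis by (rule that[of W E]) (unfold frame_solution_def, use oW Wsub ind sE solve ex in blast)
qed

section \<open>Charts of the projectivization\<close>

lemma mem_pc:
  assumes "c \<in> \<A>" "p \<in> M" "v \<in> D p"
  shows "Dir p (line_through v) \<in> fst (pc c a b) \<longleftrightarrow> p \<in> fst c \<and> indep c a b p \<and> d c p v a \<noteq> 0"
proof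
  assume "Dir p (line_through v) \<in> fst (pc c a b)"
  \<comment> \<open>The domain of the chart is described by some spanning vector \<open>v'\<close>,
    which may differ from \<open>v\<close> by a factor.\<close>
  then obtain v' where v': "line_through v = line_through v'" "p \<in> fst c" "v' \<in> D p" "indep c a b p" "d c p v' a \<noteq> 0"
    unfolding prolong_chart_def indep_def by auto
  then obtain x where "v' = (\<lambda>i. x * v i)"
    using line_through_self[of v'] unfolding v'(1)[symmetric] by (auto simp: line_through_def)
  then have "d c p v' a = x * d c p v a"
    using d_coord_scale[OF assms(1) v'(2) D_coord[OF assms(1) v'(2) assms(3)]] by simp
  with v' show "p \<in> fst c \<and> indep c a b p \<and> d c p v a \<noteq> 0" by auto
next
  assume "p \<in> fst c \<and> indep c a b p \<and> d c p v a \<noteq> 0"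
  with assms show "Dir p (line_through v) \<in> fst (pc c a b)"
    unfolding prolong_chart_def indep_def by auto
qed

lemma pc_cases:
  assumes "Q \<in> fst (pc c a b)"
  obtains p v where "Q = Dir p (line_through v)" "p \<in> M" "p \<in> fst c" "v \<in> D p" "indep c a b p" "d c p v a \<noteq> 0"
  using assms unfolding prolong_chart_def indep_def by auto

lemma snd_pc:
  assumes "c \<in> \<A>" "p \<in> fst c" "v \<in> D p" "d c p v a \<noteq> 0"
  shows "snd (pc c a b) (Dir p (line_through v)) = (snd c p)(n := d c p v b / d c p v a)"
proof -
  have v: "v \<in> coord_space n" by (rule D_coord[OF assms(1-3)])
  have "(\<forall>w\<in>line_through v. d c p w b = m * d c p w a) \<longleftrightarrow> m = d c p v b / d c p v a" for m
  proof
    assume "\<forall>w\<in>line_through v. d c p w b = m * d c p w a"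
    then show "m = d c p v b / d c p v a"
      using line_through_self[of v] assms(4) by (simp add: nonzero_eq_divide_eq)
  next
    assume "m = d c p v b / d c p v a"
    then show "\<forall>w\<in>line_through v. d c p w b = m * d c p w a"
      using assms(4) by (auto simp: line_through_def d_coord_scale[OF assms(1,2) v])
  qed
  then show ?thesis by (simp add: prolong_chart_def)
qed

text \<open>Normalizing the \<open>a\<close>-differential of the spanning vector to 1 turns the
  fiber coordinate, a quotient, into its \<open>b\<close>-differential.\<close>

lemma pc_normal:
  assumes "c \<in> \<A>" "Q \<in> fst (pc c a b)"
  obtains p v where "Q = Dir p (line_through v)" "p \<in> M" "p \<in> fst c" "v \<in> D p" "indep c a b p"
    "d c p v a = 1" "snd (pc c a b) Q = (snd c p)(n := d c p v b)"
proof -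
  obtain p v where Q: "Q = Dir p (line_through v)" "p \<in> M" "p \<in> fst c" "v \<in> D p" "indep c a b p" "d c p v a \<noteq> 0"
    using pc_cases[OF assms(2)] .
  define u where "u = (\<lambda>i. (1 / d c p v a) * v i)"
  have u: "line_through u = line_through v" "u \<in> D p"
    unfolding u_def by (rule line_through_eq, use Q(6) in simp, rule D_scale[OF Q(2,4)])
  have "d c p u = (\<lambda>i. (1 / d c p v a) * d c p v i)"
    unfolding u_def by (rule d_coord_scale[OF assms(1) Q(3) D_coord[OF assms(1) Q(3,4)]])
  then have "d c p u a = 1" using Q(6) by simp
  moreover from this have "snd (pc c a b) Q = (snd c p)(n := d c p u b)"
    using snd_pc[OF assms(1) Q(3) u(2), of a b] unfolding Q(1) u(1) by simp
  ultimately show thesis using that[of p u] Q u by simp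
qed

lemma pc_restrict:
  assumes "c \<in> \<A>" "Q \<in> fst (pc c a b)"
  shows "proj Q \<in> fst c" "(snd (pc c a b) Q)(n := 0) = snd c (proj Q)" "snd (pc c a b) Q \<in> coord_space (Suc n)"
proof -
  obtain p v where Q: "Q = Dir p (line_through v)" "p \<in> M" "p \<in> fst c" "v \<in> D p" "indep c a b p"
    "d c p v a = 1" "snd (pc c a b) Q = (snd c p)(n := d c p v b)" using pc_normal[OF assms] .
  have c: "snd c p \<in> coord_space n" by (rule coord_mem[OF assms(1) Q(3)])
  then show "(snd (pc c a b) Q)(n := 0) = snd c (proj Q)"
    using Q(1,7) by (auto simp: coord_space_def fun_eq_iff)
  show "proj Q \<in> fst c" "snd (pc c a b) Q \<in> coord_space (Suc n)"
    using Q(1,3,7) coord_space_SucI[OF c] by auto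
qed

lemma pc_coord: "c \<in> \<A> \<Longrightarrow> Q \<in> fst (pc c a b) \<Longrightarrow> i < n \<Longrightarrow> snd (pc c a b) Q i = snd c (proj Q) i"
  using pc_restrict(2)[of c Q a b] by (auto simp: fun_eq_iff split: if_splits)

text \<open>The base coordinates determine the base point, and over it a normalized vector of
  \<open>D\<close> is determined by its \<open>b\<close>-differential, through the functions
  \<open>E\<close> of a frame solution.\<close>

lemma pc_inj:
  assumes "c \<in> \<A>" "a < n" "b < n"
  shows "inj_on (snd (pc c a b)) (fst (pc c a b))"
proof (rule inj_onI)
  fix Q1 Q2 assume Q: "Q1 \<in> fst (pc c a b)" "Q2 \<in> fst (pc c a b)" "snd (pc c a b) Q1 = snd (pc c a b) Q2"
  obtain p v where 1: "Q1 = Dir p (line_through v)" "p \<in> M" "p \<in> fst c" "v \<in> D p" "indep c a b p"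
    "d c p v a = 1" "snd (pc c a b) Q1 = (snd c p)(n := d c p v b)" using pc_normal[OF assms(1) Q(1)] .
  obtain p' v' where 2: "Q2 = Dir p' (line_through v')" "p' \<in> M" "p' \<in> fst c" "v' \<in> D p'" "indep c a b p'"
    "d c p' v' a = 1" "snd (pc c a b) Q2 = (snd c p')(n := d c p' v' b)" using pc_normal[OF assms(1) Q(2)] .
  have "snd c p = snd c p'"
    using pc_restrict(2)[OF assms(1) Q(1)] pc_restrict(2)[OF assms(1) Q(2)] Q(3) 1(1) 2(1) by simp
  then have p: "p' = p" using chart_inj[OF assms(1)] 1(3) 2(3) by (auto dest: inj_onD)
  have b: "d c p v b = d c p v' b"
    using fun_cong[OF Q(3), of n] unfolding 1(7) 2(7) p by simp
  obtain W E where "frame_solution c a b W E" by (rule frame_solution_exists[OF assms])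
  note WE = frame_solutionD[OF this]
  have W: "snd c p \<in> W" using WE(3) 1(3,5) by blast
  have co: "v \<in> coord_space n" "v' \<in> coord_space n" using D_coord[OF assms(1) 1(3)] 1(4) 2(4) p by auto
  have "d c p v i = d c p v' i" for i
  proof (cases "i < n")
    case True
    have "d c p v i = d c p v a * E i ((snd c p)(n := d c p v b))"
      by (rule WE(5)[OF 1(3) W 1(4) _ True]) (simp add: 1(6))
    moreover have "d c p v' i = d c p v' a * E i ((snd c p)(n := d c p v b))"
      by (rule WE(5)[OF 1(3) W _ _ True]) (use 2 p b in auto)
    ultimately show ?thesis using 1(6) 2(6) p by simp
  next
    case False
    then show ?thesis
      using d_coord_coord_space[OF assms(1) 1(3) co(1)] d_coord_coord_space[OF assms(1) 1(3) co(2)]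
      by (simp add: coord_space_def)
  qed
  then have "v = v'" using d_coord_inj[OF assms(1) 1(3) co] by blast
  then show "Q1 = Q2" using 1(1) 2(1) p by simp
qed

text \<open>On the base the transition is the old one, and the new slope is
  \<open>q b' / q a'\<close>, where \<open>q\<close> applies the old Jacobian to the normalized
  vector of slope \<open>z n\<close>. The overlap corresponds to the open set \<open>Z\<close> over
  which the old transition is defined, both pairs of differentials are independent and
  \<open>q a'\<close> does not vanish.\<close>

lemma overlap_pc:
  assumes c: "c \<in> \<A>" "a < n" "b < n" and c': "c' \<in> \<A>" "a' < n" "b' < n"
  shows "open_in (Suc n) (snd (pc c a b) ` (fst (pc c a b) \<inter> fst (pc c' a' b')))"
    "i < Suc n \<Longrightarrow> smooth_on (Suc n) (snd (pc c a b) ` (fst (pc c a b) \<inter> fst (pc c' a' b')))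
        (\<lambda>z. transition (pc c a b) (pc c' a' b') z i)"
proof -
  obtain W E where "frame_solution c a b W E" by (rule frame_solution_exists[OF c])
  note WE = frame_solutionD[OF this]
  obtain W' E' where "frame_solution c' a' b' W' E'" by (rule frame_solution_exists[OF c'])
  note W' = frame_solutionD(1,3)[OF this]
  let ?I = "snd c ` (fst c \<inter> fst c')"
  have oI: "open_in n ?I" by (rule overlap_open[OF c(1) c'(1)])
  have st: "smooth_on n ?I (\<lambda>z. transition c c' z i)" if "i < n" for i
    by (rule transition_smooth[OF c(1) c'(1) that])
  define X where "X = {z \<in> ?I. transition c c' z \<in> W'} \<inter> W"
  have oX: "open_in n X"
    unfolding X_def
    by (intro open_in_Int open_in_preimage[OF oI W'(1)] transition_continuous transition_coord_space c c' WE(1))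
  define Y where "Y = {z \<in> coord_space (Suc n). z(n := 0) \<in> X}"
  have oY: "open_in (Suc n) Y" unfolding Y_def by (rule open_in_Suc[OF oX])
  define q where "q i z = (\<Sum>j<n. partial j (\<lambda>z. transition c c' z i) (z(n := 0)) * E j z)" for i z
  have sq: "smooth_on (Suc n) Y (q i)" if "i < n" for i
    unfolding q_def
  proof (intro smooth_on_sum[OF oY] smooth_on_mult[OF oY])
    fix j assume "j \<in> {..<n}"
    then have "smooth_on n X (partial j (\<lambda>z. transition c c' z i))"
      by (intro smooth_on_subset[OF smooth_on_partial[OF st[OF that]]]) (auto simp: X_def)
    then show "smooth_on (Suc n) Y (\<lambda>z. partial j (\<lambda>z. transition c c' z i) (z(n := 0)))"
      unfolding Y_def by (rule smooth_on_Suc[OF oX])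
    show "smooth_on (Suc n) Y (E j)"
      by (rule smooth_on_subset[OF WE(4)]) (use \<open>j \<in> {..<n}\<close> in \<open>auto simp: X_def Y_def\<close>)
  qed
  define Z where "Z = {z \<in> Y. q a' z \<noteq> 0}"
  have oZ: "open_in (Suc n) Z"
    unfolding Z_def by (rule open_in_preimage_neq[OF oY smooth_on_continuous[OF sq[OF c'(2)]]])
  have dq: "d c' p v i = q i ((snd c p)(n := d c p v b))"
    if "p \<in> fst c" "p \<in> fst c'" "snd c p \<in> W" "v \<in> D p" "d c p v a = 1" "i < n" for p v i
  proof -
    have z: "(snd c p)(n := 0) = snd c p"
      using coord_mem[OF c(1) that(1)] by (auto simp: coord_space_def fun_eq_iff)
    have "d c p v j = E j ((snd c p)(n := d c p v b))" if "j < n" for j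
      using WE(5)[OF \<open>p \<in> fst c\<close> \<open>snd c p \<in> W\<close> \<open>v \<in> D p\<close> _ that, of "d c p v b"] \<open>d c p v a = 1\<close> by simp
    then show ?thesis
      unfolding d_coord_change[OF c(1) c'(1) that(1,2) D_coord[OF c(1) that(1,4)]]
      using that(6) by (simp add: jacobian_def q_def z)
  qed
  have fwd: "snd (pc c a b) Q \<in> Z" "snd (pc c' a' b') Q =
        (transition c c' ((snd (pc c a b) Q)(n := 0)))(n := q b' (snd (pc c a b) Q) / q a' (snd (pc c a b) Q))"
    if Q: "Q \<in> fst (pc c a b) \<inter> fst (pc c' a' b')" for Q
  proof -
    obtain p v where 1: "Q = Dir p (line_through v)" "p \<in> M" "p \<in> fst c" "v \<in> D p" "indep c a b p"
      "d c p v a = 1" "snd (pc c a b) Q = (snd c p)(n := d c p v b)" using pc_normal[OF c(1)] Q by blast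
    have 2: "p \<in> fst c'" "indep c' a' b' p" "d c' p v a' \<noteq> 0"
      using Q mem_pc[OF c'(1) 1(2,4)] unfolding 1(1) by auto
    have pW: "snd c p \<in> W" using WE(3) 1(3,5) by blast
    note dq' = dq[OF 1(3) 2(1) pW 1(4,6)]
    have z: "(snd (pc c a b) Q)(n := 0) = snd c p" using pc_restrict(2)[OF c(1), of Q] Q 1(1) by simp
    have "transition c c' (snd c p) = snd c' p" by (rule transition_eq[OF c(1) 1(3)])
    then show "snd (pc c' a' b') Q = (transition c c' ((snd (pc c a b) Q)(n := 0)))
        (n := q b' (snd (pc c a b) Q) / q a' (snd (pc c a b) Q))"
      unfolding z using snd_pc[OF c'(1) 2(1) 1(4) 2(3), of b'] dq'[OF c'(2)] dq'[OF c'(3)] unfolding 1(1,7)[symmetric]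
      by simp
    have "snd (pc c a b) Q \<in> Y"
      using pc_restrict(3)[OF c(1), of Q] Q pW W'(2)[OF 2(1)] 2(1,2) 1(3)
      by (simp add: Y_def X_def z transition_eq[OF c(1)])
    then show "snd (pc c a b) Q \<in> Z"
      unfolding Z_def using dq'[OF c'(2)] 2(3) 1(7) by simp
  qed
  have bwd: "z \<in> snd (pc c a b) ` (fst (pc c a b) \<inter> fst (pc c' a' b'))" if z: "z \<in> Z" for z
  proof -
    from z obtain p where p: "p \<in> fst c" "p \<in> fst c'" "z(n := 0) = snd c p" "snd c p \<in> W" "transition c c' (snd c p) \<in> W'"
      "q a' z \<noteq> 0"
      by (auto simp: Z_def Y_def X_def)
    have pM: "p \<in> M" using inM[OF c(1) p(1)] .
    obtain v where v: "v \<in> D p" "d c p v a = 1" "d c p v b = z n" using WE(6)[OF p(1,4)] by blast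
    have zz: "(snd c p)(n := d c p v b) = z" using p(3) v(3) by (metis fun_upd_triv fun_upd_upd)
    let ?Q = "Dir p (line_through v)"
    have "?Q \<in> fst (pc c a b)" using mem_pc[OF c(1) pM v(1)] p(1,4) WE(3)[OF p(1)] v(2) by simp
    moreover have "?Q \<in> fst (pc c' a' b')"
      using mem_pc[OF c'(1) pM v(1)] p(2,5,6) W'(2)[OF p(2)] dq[OF p(1,2,4) v(1,2) c'(2)] zz
      by (simp add: transition_eq[OF c(1) p(1)])
    moreover have "snd (pc c a b) ?Q = z" using snd_pc[OF c(1) p(1) v(1), of a b] v(2) zz by simp
    ultimately show ?thesis by force
  qed
  have main: "snd (pc c a b) ` (fst (pc c a b) \<inter> fst (pc c' a' b')) = Z"
    using fwd(1) bwd by blast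
  show "open_in (Suc n) (snd (pc c a b) ` (fst (pc c a b) \<inter> fst (pc c' a' b')))"
    using main oZ by simp
  have tr: "transition (pc c a b) (pc c' a' b') z i = ((transition c c' (z(n := 0)))(n := q b' z / q a' z)) i"
    if zZ: "z \<in> Z" for z i
  proof -
    obtain Q where Q: "z = snd (pc c a b) Q" "Q \<in> fst (pc c a b) \<inter> fst (pc c' a' b')" using bwd[OF zZ] by blast
    have "inv_into (fst (pc c a b)) (snd (pc c a b)) z = Q"
      unfolding Q(1) by (rule inv_into_f_f[OF pc_inj[OF c]]) (use Q in simp)
    then show ?thesis using fwd(2)[OF Q(2)] Q(1) unfolding transition_def[of "pc c a b"] by simp
  qed
  assume i: "i < Suc n"
  have "smooth_on (Suc n) Z (\<lambda>z. ((transition c c' (z(n := 0)))(n := q b' z / q a' z)) i)"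
  proof (cases "i = n")
    case True
    have "smooth_on (Suc n) Z (\<lambda>z. q b' z / q a' z)"
      by (intro smooth_on_divide[OF oZ] smooth_on_subset[OF sq] c') (auto simp: Z_def)
    then show ?thesis using True by simp
  next
    case False
    have "smooth_on n X (\<lambda>z. transition c c' z i)"
      by (rule smooth_on_subset[OF st]) (use i False in \<open>auto simp: X_def\<close>)
    have "Z \<subseteq> {z \<in> coord_space (Suc n). z(n := 0) \<in> X}" by (auto simp: Z_def Y_def)
    from smooth_on_subset[OF smooth_on_Suc[OF oX \<open>smooth_on n X _\<close>] this] show ?thesis
      using False by simp
  qed
  then show "smooth_on (Suc n) (snd (pc c a b) ` (fst (pc c a b) \<inter> fst (pc c' a' b')))
        (\<lambda>z. transition (pc c a b) (pc c' a' b') z i)"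
    using main by (simp add: smooth_on_cong[OF oZ, OF tr[symmetric]])
qed

lemma atlas'_cases:
  assumes "C \<in> \<A>'"
  obtains c a b where "C = pc c a b" "c \<in> \<A>" "a < n" "b < n"
  using assms unfolding prolong_atlas_def by blast

lemma pc_atlas': "c \<in> \<A> \<Longrightarrow> a < n \<Longrightarrow> b < n \<Longrightarrow> pc c a b \<in> \<A>'"
  unfolding prolong_atlas_def by blast

lemma pc_subset_M':
  assumes "c \<in> \<A>" "Q \<in> fst (pc c a b)"
  shows "Q \<in> M'"
proof -
  obtain p v where "Q = Dir p (line_through v)" "p \<in> M" "p \<in> fst c" "v \<in> D p" "indep c a b p" "d c p v a \<noteq> 0"
    using pc_cases[OF assms(2)] .
  moreover from this have "v \<noteq> (\<lambda>_. 0)" using d_coord_zero[OF assms(1)] by auto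
  ultimately show ?thesis unfolding projectivization_def by blast
qed

lemma M'_cover:
  assumes "Q \<in> M'"
  obtains p v where "Q = Dir p (line_through v)" "p \<in> M" "v \<in> D p" "v \<noteq> (\<lambda>_. 0)"
  using assms unfolding projectivization_def by blast

lemma manifold': "manifold (Suc n) M' \<A>'"
proof
  show "M' = (\<Union>c\<in>\<A>'. fst c)"
  proof (intro subset_antisym subsetI)
    fix Q assume "Q \<in> M'"
    then obtain p v where Q: "Q = Dir p (line_through v)" "p \<in> M" "v \<in> D p" "v \<noteq> (\<lambda>_. 0)" by (rule M'_cover)
    note c = chart_at[OF Q(2)]
    obtain a b \<alpha> \<beta> where f: "framed n \<A> D (chart_at \<A> p) a b \<alpha> \<beta>" using framed[OF c(1)] by blast
    have i: "indep (chart_at \<A> p) a b p" by (rule frame_indep[OF f c])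
    then have i': "indep (chart_at \<A> p) b a p" by (auto simp: indep_def)
    have ab: "a < n" "b < n" using f by (auto simp: framed_def)
    \<comment> \<open>The chart of the slope and that of the inverse slope cover the projective line
      over \<open>p\<close>.\<close>
    have "d (chart_at \<A> p) p v a \<noteq> 0 \<or> d (chart_at \<A> p) p v b \<noteq> 0"
      using i Q(3,4) by (auto simp: indep_def)
    then have "Q \<in> fst (pc (chart_at \<A> p) a b) \<or> Q \<in> fst (pc (chart_at \<A> p) b a)"
      unfolding Q(1) mem_pc[OF c(1) Q(2,3)] using i i' c(2) by blast
    then show "Q \<in> (\<Union>c\<in>\<A>'. fst c)" using pc_atlas'[OF c(1)] ab by blast
  qed (auto elim!: atlas'_cases dest: pc_subset_M')
next
  fix c assume "c \<in> \<A>'"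
  then show "inj_on (snd c) (fst c)" by (auto elim!: atlas'_cases intro: pc_inj)
  show "open_in (Suc n) (snd c ` fst c)"
    using \<open>c \<in> \<A>'\<close> by (elim atlas'_cases) (use overlap_pc(1) in force)
next
  fix c c' assume "c \<in> \<A>'" "c' \<in> \<A>'"
  then show "open_in (Suc n) (snd c ` (fst c \<inter> fst c'))"
    by (elim atlas'_cases) (simp add: overlap_pc)
  fix i assume "i < Suc n"
  then show "smooth_on (Suc n) (snd c ` (fst c \<inter> fst c')) (\<lambda>z. transition c c' z i)"
    using \<open>c \<in> \<A>'\<close> \<open>c' \<in> \<A>'\<close> by (elim atlas'_cases) (simp add: overlap_pc)
qed

text \<open>Coordinate \<open>n\<close> is the fiber coordinate above and constantly 0 below, hence
  the reset of \<open>w\<close> at \<open>n\<close>.\<close>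

lemma has_velocity_proj:
  assumes "c \<in> \<A>" "has_velocity (pc c a b) \<gamma> t w"
  shows "has_velocity c (proj \<circ> \<gamma>) t (w(n := 0))"
proof -
  have ev: "\<forall>\<^sub>F s in nhds t. \<gamma> s \<in> fst (pc c a b)" using assms(2) by (simp add: has_velocity_def)
  have dc: "((\<lambda>s. snd (pc c a b) (\<gamma> s) i) has_field_derivative w i) (at t)" for i
    using assms(2) by (simp add: has_velocity_def)
  have "((\<lambda>s. snd c ((proj \<circ> \<gamma>) s) i) has_field_derivative (w(n := 0)) i) (at t)" for i
  proof (cases "i = n")
    case True
    have *: "\<forall>\<^sub>F s in nhds t. snd c ((proj \<circ> \<gamma>) s) i = 0"
      using ev by eventually_elim (use True coord_mem[OF assms(1)] pc_restrict(1)[OF assms(1)] in \<open>auto simp: coord_space_def\<close>)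
    show ?thesis using DERIV_cong_ev[OF refl *, of 0 0] True by simp
  next
    case False
    have *: "\<forall>\<^sub>F s in nhds t. snd (pc c a b) (\<gamma> s) i = snd c ((proj \<circ> \<gamma>) s) i"
      using ev by eventually_elim (use False fun_cong[OF pc_restrict(2)[OF assms(1)], of _ a b i] in auto)
    show ?thesis using DERIV_cong_ev[OF refl *, of "w i" "w i"] dc[of i] False by simp
  qed
  moreover have "\<forall>\<^sub>F s in nhds t. (proj \<circ> \<gamma>) s \<in> fst c"
    using ev by eventually_elim (use pc_restrict(1)[OF assms(1)] in auto)
  ultimately show ?thesis by (simp add: has_velocity_def)
qed

lemma smooth_in_proj:
  assumes "c \<in> \<A>" "smooth_in (pc c a b) \<gamma>"
  shows "smooth_in c (proj \<circ> \<gamma>)"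
proof -
  have ev: "\<forall>\<^sub>F s in nhds 0. \<gamma> s \<in> fst (pc c a b)" using assms(2) by (simp add: smooth_in_def)
  have dc: "smooth_germ (\<lambda>s. snd (pc c a b) (\<gamma> s) i)" for i
    using assms(2) by (simp add: smooth_in_def)
  have "smooth_germ (\<lambda>s. snd c ((proj \<circ> \<gamma>) s) i)" for i
  proof (cases "i = n")
    case True
    have *: "\<forall>\<^sub>F s in nhds 0. 0 = snd c ((proj \<circ> \<gamma>) s) i"
      using ev by eventually_elim (use True coord_mem[OF assms(1)] pc_restrict(1)[OF assms(1)] in \<open>auto simp: coord_space_def\<close>)
    show ?thesis by (rule smooth_germ_cong[OF * smooth_germ_const])
  next
    case False
    have *: "\<forall>\<^sub>F s in nhds 0. snd (pc c a b) (\<gamma> s) i = snd c ((proj \<circ> \<gamma>) s) i"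
      using ev by eventually_elim (use False fun_cong[OF pc_restrict(2)[OF assms(1)], of _ a b i] in auto)
    show ?thesis by (rule smooth_germ_cong[OF * dc])
  qed
  moreover have "\<forall>\<^sub>F s in nhds 0. (proj \<circ> \<gamma>) s \<in> fst c"
    using ev by eventually_elim (use pc_restrict(1)[OF assms(1)] in auto)
  ultimately show ?thesis by (simp add: smooth_in_def)
qed

lemma d_proj:
  assumes "c \<in> \<A>" "a < n" "b < n" "Q \<in> fst (pc c a b)" "v \<in> coord_space (Suc n)"
  shows "d_proj \<A>' \<A> Q v \<in> coord_space n"
    "d c (proj Q) (d_proj \<A>' \<A> Q v) = (d_coord \<A>' (pc c a b) Q v)(n := 0)"
proof -
  interpret pr: manifold "Suc n" M' \<A>' by (rule manifold')
  note C = pc_atlas'[OF assms(1-3)]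
  have Q: "Q \<in> M'" using pr.inM[OF C assms(4)] .
  have h: "has_velocity c (proj \<circ> curve_along \<A>' Q v) 0 ((d_coord \<A>' (pc c a b) Q v)(n := 0))"
    by (rule has_velocity_proj[OF assms(1) pr.d_coord_jacobian(1)[OF C assms(4,5)]])
  show "d_proj \<A>' \<A> Q v \<in> coord_space n"
    unfolding d_proj_def by (rule tangent_has_velocity(3)[OF assms(1) h])
  show "d c (proj Q) (d_proj \<A>' \<A> Q v) = (d_coord \<A>' (pc c a b) Q v)(n := 0)"
    using d_coord_tangent[OF assms(1) h] pr.curve_along(1)[OF Q assms(5)] by (simp add: d_proj_def)
qed

text \<open>A vector of the prolonged distribution projects into the line represented by its base
  point, so its base part is fixed by the \<open>a\<close>-differential, while the fiber
  differential is free. Thus \<open>a\<close> and the new index \<open>n\<close> frame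
  \<open>D'\<close>. The second conclusion expresses spanning vectors of lines by the same
  \<open>E\<close>; it later yields divisibility of velocities.\<close>

lemma framed':
  assumes "c \<in> \<A>" "a < n" "b < n"
  obtains E where "framed (Suc n) \<A>' D' (pc c a b) a n E (\<lambda>i z. if i = n then 1 else 0)"
    "\<And>p v i. p \<in> fst c \<Longrightarrow> indep c a b p \<Longrightarrow> v \<in> D p \<Longrightarrow> d c p v a \<noteq> 0 \<Longrightarrow> i < n \<Longrightarrow>
        d c p v i = d c p v a * E i (snd (pc c a b) (Dir p (line_through v)))"
proof -
  interpret pr: manifold "Suc n" M' \<A>' by (rule manifold')
  let ?C = "pc c a b"
  note C = pc_atlas'[OF assms]
  obtain W E where "frame_solution c a b W E" by (rule frame_solution_exists[OF assms])
  note WE = frame_solutionD[OF this]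
  \<comment> \<open>A frame solution leaves its function at index \<open>n\<close> unspecified; the
    frame requires the coefficient 0 there.\<close>
  define E' where "E' i z = (if i = n then 0 else E i z)" for i z
  have sol: "d c p v i = d c p v a * E' i (snd ?C (Dir p (line_through v)))"
    if "p \<in> fst c" "indep c a b p" "v \<in> D p" "d c p v a \<noteq> 0" "i < n" for p v i
    unfolding snd_pc[OF assms(1) that(1,3,4)]
    using WE(5)[OF that(1) _ that(3) _ that(5), of "d c p v b / d c p v a"] WE(3)[OF that(1)] that(2,4,5)
    by (simp add: E'_def)
  have im: "snd ?C ` fst ?C \<subseteq> {z \<in> coord_space (Suc n). z(n := 0) \<in> W}"
  proof clarify
    fix Q assume Q: "Q \<in> fst ?C"
    obtain p v where "Q = Dir p (line_through v)" "p \<in> M" "p \<in> fst c" "v \<in> D p" "indep c a b p" "d c p v a \<noteq> 0"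
      using pc_cases[OF Q] .
    then show "snd ?C Q \<in> coord_space (Suc n) \<and> (snd ?C Q)(n := 0) \<in> W"
      using pc_restrict[OF assms(1) Q] WE(3) by simp
  qed
  have "smooth_on (Suc n) (snd ?C ` fst ?C) (E' i)" if "i < Suc n" for i
  proof (cases "i = n")
    case True
    then show ?thesis using smooth_on_const[of _ _ 0] by (simp add: E'_def[abs_def])
  next
    case False
    then have "E' i = E i" "i < n" using that by (auto simp: E'_def)
    then show ?thesis using smooth_on_subset[OF WE(4) im] by simp
  qed
  moreover have "smooth_on (Suc n) (snd ?C ` fst ?C) (\<lambda>z. if i = n then 1 else 0)" for i
    by (rule smooth_on_const)
  moreover have "E' a z = 1 \<and> E' n z = 0" if z: "z \<in> snd ?C ` fst ?C" for z
  proof -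
    obtain Q where Q: "Q \<in> fst ?C" "z = snd ?C Q" using z by blast
    obtain p v where pv: "Q = Dir p (line_through v)" "p \<in> M" "p \<in> fst c" "v \<in> D p" "indep c a b p" "d c p v a \<noteq> 0"
      using pc_cases[OF Q(1)] .
    have "d c p v a = d c p v a * E' a z" using sol[OF pv(3,5,4,6) assms(2)] pv(1) Q(2) by simp
    then show ?thesis using pv(6) by (simp add: E'_def)
  qed
  moreover have "d_coord \<A>' ?C Q ` D' Q =
      {w \<in> coord_space (Suc n). \<forall>i<Suc n. w i = E' i (snd ?C Q) * w a + (if i = n then 1 else 0) * w n}"
    if Q: "Q \<in> fst ?C" for Q
  proof -
    obtain p v where pv: "Q = Dir p (line_through v)" "p \<in> M" "p \<in> fst c" "v \<in> D p" "indep c a b p" "d c p v a \<noteq> 0"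
      using pc_cases[OF Q] .
    have vc: "v \<in> coord_space n" by (rule D_coord[OF assms(1) pv(3,4)])
    have D'Q: "D' Q = {u \<in> coord_space (Suc n). d_proj \<A>' \<A> Q u \<in> line_through v}"
      using pr.tangent_space_M[OF pr.inM[OF C Q]] pv(1) by (simp add: prolong_distr_def)
    have key: "d_proj \<A>' \<A> Q u \<in> line_through v \<longleftrightarrow>
        (\<forall>i<n. d_coord \<A>' ?C Q u i = E' i (snd ?C Q) * d_coord \<A>' ?C Q u a)"
      if u: "u \<in> coord_space (Suc n)" for u
    proof -
      let ?w = "d_coord \<A>' ?C Q u"
      note dp = d_proj[OF assms Q u, unfolded pv(1) proj.simps]
      have sv: "d c p v i = d c p v a * E' i (snd ?C Q)" if "i < n" for i
        using sol[OF pv(3,5,4,6) that] pv(1) by simp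
      show ?thesis
      proof
        assume "d_proj \<A>' \<A> Q u \<in> line_through v"
        then obtain x where "d_proj \<A>' \<A> Q u = (\<lambda>i. x * v i)" by (auto simp: line_through_def)
        then have w: "?w(n := 0) = (\<lambda>i. x * d c p v i)"
          using dp(2) d_coord_scale[OF assms(1) pv(3) vc] pv(1) by simp
        have wi: "?w i = x * d c p v i" if "i < n" for i using fun_cong[OF w, of i] that by simp
        show "\<forall>i<n. ?w i = E' i (snd ?C Q) * ?w a"
          using wi wi[OF assms(2)] sv by simp
      next
        assume w: "\<forall>i<n. ?w i = E' i (snd ?C Q) * ?w a"
        define x where "x = ?w a / d c p v a"
        have xv: "(\<lambda>i. x * v i) \<in> coord_space n" using vc by (simp add: coord_space_def)
        have wc: "?w \<in> coord_space (Suc n)" by (rule pr.d_coord_coord_space[OF C Q u])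
        have "(?w(n := 0)) i = x * d c p v i" for i
        proof (cases "i < n")
          case True
          then show ?thesis using w sv[OF True] pv(6) by (simp add: x_def)
        next
          case False
          then show ?thesis using wc d_coord_coord_space[OF assms(1) pv(3) vc] by (auto simp: coord_space_def)
        qed
        then have "d c p (d_proj \<A>' \<A> Q u) = d c p (\<lambda>i. x * v i)"
          using dp(2) d_coord_scale[OF assms(1) pv(3) vc] pv(1) by (simp add: fun_eq_iff)
        moreover have "d_proj \<A>' \<A> Q u \<in> coord_space n" using dp(1) pv(1) by simp
        ultimately have "d_proj \<A>' \<A> Q u = (\<lambda>i. x * v i)"
          using d_coord_inj[OF assms(1) pv(3) _ xv] by blast
        then show "d_proj \<A>' \<A> Q u \<in> line_through v" by (auto simp: line_through_def)
      qed
    qed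
    have eq: "(\<forall>i<Suc n. w i = E' i (snd ?C Q) * w a + (if i = n then 1 else 0) * w n) \<longleftrightarrow>
        (\<forall>i<n. w i = E' i (snd ?C Q) * w a)" for w :: "nat \<Rightarrow> 'k"
      by (auto simp: less_Suc_eq E'_def)
    show ?thesis
      unfolding eq
    proof (intro subset_antisym subsetI)
      fix w assume "w \<in> d_coord \<A>' ?C Q ` D' Q"
      then show "w \<in> {w \<in> coord_space (Suc n). \<forall>i<n. w i = E' i (snd ?C Q) * w a}"
        using key pr.d_coord_coord_space[OF C Q] unfolding D'Q by blast
    next
      fix w assume w: "w \<in> {w \<in> coord_space (Suc n). \<forall>i<n. w i = E' i (snd ?C Q) * w a}"
      then have wc: "w \<in> coord_space (Suc n)" by simp
      note oc = pr.of_coord[OF C Q wc]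
      have "pr.of_coord ?C Q w \<in> D' Q" unfolding D'Q using key[OF oc(1)] oc w by simp
      then show "w \<in> d_coord \<A>' ?C Q ` D' Q" using oc(2) by (metis image_eqI)
    qed
  qed
  ultimately have "framed (Suc n) \<A>' D' ?C a n E' (\<lambda>i z. if i = n then 1 else 0)"
    using assms(2) by (simp add: framed_def)
  with sol show thesis by (intro that)
qed

lemma distribution': "distribution (Suc n) M' \<A>' D'"
proof -
  interpret pr: manifold "Suc n" M' \<A>' by (rule manifold')
  show ?thesis
  proof
    fix Q assume Q: "Q \<in> M'"
    then show "D' Q \<subseteq> coord_space (Suc n)"
      using pr.tangent_space_M[OF Q] by (auto simp: prolong_distr_def split: pt.splits)
  next
    fix C assume "C \<in> \<A>'"
    then obtain c a b where "C = pc c a b" "c \<in> \<A>" "a < n" "b < n" by (rule atlas'_cases)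
    then show "\<exists>a b \<alpha> \<beta>. framed (Suc n) \<A>' D' C a b \<alpha> \<beta>" using framed' by metis
  qed
qed

end

section \<open>Ruled submanifolds, their prolongations, and uniqueness of limits\<close>

context distribution
begin

lemma frame_eq:
  assumes "framed n \<A> D c a b \<alpha> \<beta>" "c \<in> \<A>" "p \<in> fst c" "v \<in> D p" "v' \<in> D p"
    "d c p v a = d c p v' a" "d c p v b = d c p v' b"
  shows "v = v'"
proof -
  have co: "v \<in> coord_space n" "v' \<in> coord_space n" using D_coord[OF assms(2,3)] assms(4,5) by auto
  have "d c p v i = d c p v' i" for i
  proof (cases "i < n")
    case True
    then show ?thesis using frame_mem(2)[OF assms(1-3)] assms(4-7) by simp
  next
    case False
    then show ?thesis
      using d_coord_coord_space[OF assms(2,3) co(1)] d_coord_coord_space[OF assms(2,3) co(2)]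
      by (simp add: coord_space_def)
  qed
  then show ?thesis using d_coord_inj[OF assms(2,3) co] by blast
qed

text \<open>The form taken by all pairs \<open>(N\<^sub>i, E\<^sub>i)\<close> that arise from vertical directions.\<close>

definition ruled :: "('a, 'k) pt set \<Rightarrow> ('a, 'k) distr \<Rightarrow> (('a, 'k) pt, 'k) chart \<Rightarrow> nat \<Rightarrow> bool" where
  "ruled N E c a \<longleftrightarrow>
     (\<forall>q\<in>N \<inter> fst c. d c q ` E q = {w. \<exists>s. w = (\<lambda>i. if i = a then s else 0)} \<and> E q \<subseteq> D q) \<and>
     (\<forall>q\<in>N \<inter> fst c. \<forall>q'\<in>fst c. (\<exists>s. snd c q' = (snd c q)(a := s)) \<longrightarrow> q' \<in> N)"

lemma ruledD:
  assumes "ruled N E c a" "q \<in> N" "q \<in> fst c"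
  shows "\<exists>v\<in>E q. d c q v = (\<lambda>i. if i = a then s else 0)" "E q \<subseteq> D q"
    "v \<in> E q \<Longrightarrow> d c q v = (\<lambda>i. if i = a then d c q v a else 0)"
    "q' \<in> fst c \<Longrightarrow> snd c q' = (snd c q)(a := s) \<Longrightarrow> q' \<in> N"
proof -
  have im: "d c q ` E q = {w. \<exists>s. w = (\<lambda>i. if i = a then s else 0)}"
    using assms unfolding ruled_def by blast
  have "(\<lambda>i. if i = a then s else 0) \<in> d c q ` E q" unfolding im by blast
  then show "\<exists>v\<in>E q. d c q v = (\<lambda>i. if i = a then s else 0)" by (metis imageE)
  show "E q \<subseteq> D q" using assms unfolding ruled_def by blast
  show "d c q v = (\<lambda>i. if i = a then d c q v a else 0)" if "v \<in> E q"
  proof -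
    have "d c q v \<in> d c q ` E q" using that by blast
    then obtain s where "d c q v = (\<lambda>i. if i = a then s else 0)" unfolding im by blast
    then show ?thesis by (auto simp: fun_eq_iff)
  qed
  show "q' \<in> N" if "q' \<in> fst c" "snd c q' = (snd c q)(a := s)"
    using assms that unfolding ruled_def by blast
qed

text \<open>Inside the plane framed by \<open>a\<close> and \<open>b\<close>, the line
  \<open>E\<close> is the direction of coordinate \<open>a\<close>. The doubleton hypothesis lets
  \<open>a\<close> be either member of the frame, since the ruling is the newest coordinate at first
  and the retained one later.\<close>

lemma ruled_mem:
  assumes "framed n \<A> D c x y \<alpha> \<beta>" "{x, y} = {a, b}" "c \<in> \<A>" "ruled N E c a" "q \<in> N" "q \<in> fst c" "v \<in> D q"
  shows "v \<in> E q \<longleftrightarrow> d c q v b = 0"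
proof
  have ab: "a \<noteq> b" using assms(1,2) by (auto simp: framed_def doubleton_eq_iff)
  note r = ruledD[OF assms(4-6)]
  show "d c q v b = 0" if "v \<in> E q" using r(3)[OF that] ab by (metis)
  assume "d c q v b = 0"
  obtain u where u: "u \<in> E q" "d c q u = (\<lambda>i. if i = a then d c q v a else 0)" using r(1) by blast
  have "d c q v a = d c q u a" "d c q v b = d c q u b" using u(2) ab \<open>d c q v b = 0\<close> by auto
  then have "v = u"
    using frame_eq[OF assms(1,3,6,7), of u] r(2) u(1) assms(2) by (auto simp: doubleton_eq_iff)
  then show "v \<in> E q" using u(1) by simp
qed

lemma indep_commute: "indep c a b p \<longleftrightarrow> indep c b a p"
  by (auto simp: indep_def)

lemma mem_projectivization_ruled:
  assumes "framed n \<A> D c x y \<alpha> \<beta>" "{x, y} = {a, b}" "c \<in> \<A>" "ruled N E c a" "q \<in> N" "q \<in> fst c" "v \<in> D q" "v \<noteq> (\<lambda>_. 0)"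
  shows "Dir q (line_through v) \<in> projectivization N E \<longleftrightarrow> d c q v b = 0"
proof
  have vc: "v \<in> coord_space n" using D_coord[OF assms(3,6,7)] .
  assume "Dir q (line_through v) \<in> projectivization N E"
  then obtain v' where v': "line_through v = line_through v'" "v' \<in> E q" "v' \<noteq> (\<lambda>_. 0)"
    by (auto simp: projectivization_def)
  then obtain s where s: "v = (\<lambda>i. s * v' i)"
    using line_through_self[of v] by (auto simp: line_through_def)
  have v'D: "v' \<in> D q" using ruledD(2)[OF assms(4-6)] v'(2) by blast
  have "d c q v b = s * d c q v' b"
    unfolding s using d_coord_scale[OF assms(3,6) D_coord[OF assms(3,6) v'D]] by simp
  then show "d c q v b = 0" using ruled_mem[OF assms(1-6) v'D] v'(2) by simp
next
  assume "d c q v b = 0"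
  then have "v \<in> E q" using ruled_mem[OF assms(1-7)] by simp
  then show "Dir q (line_through v) \<in> projectivization N E"
    using assms(5,8) by (auto simp: projectivization_def)
qed

text \<open>On the ruling the \<open>b\<close>-differential is 0 and the
  \<open>a\<close>-differential is not, which decides between the two slope charts. This fixes the
  chart in which a divisor has to be studied.\<close>

lemma projectivization_ruled_pc:
  assumes "framed n \<A> D c x y \<alpha> \<beta>" "{x, y} = {a, b}" "c \<in> \<A>" "ruled N E c a" "q \<in> N" "q \<in> fst c"
    "Dir q L \<in> projectivization N E"
  shows "Dir q L \<in> fst (pc c a b)" "Dir q L \<notin> fst (pc c b a)"
proof -
  obtain v where v: "L = line_through v" "v \<in> E q" "v \<noteq> (\<lambda>_. 0)"
    using assms(7) by (auto simp: projectivization_def)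
  have vD: "v \<in> D q" using ruledD(2)[OF assms(4-6)] v(2) by blast
  have qM: "q \<in> M" using inM assms(3,6) by blast
  have b0: "d c q v b = 0" using ruled_mem[OF assms(1-6) vD] v(2) by simp
  have i: "indep c a b q" using frame_indep[OF assms(1,3,6)] assms(2) by (auto simp: doubleton_eq_iff indep_commute)
  then have "d c q v a \<noteq> 0" using v(3) vD b0 by (auto simp: indep_def)
  then show "Dir q L \<in> fst (pc c a b)" "Dir q L \<notin> fst (pc c b a)"
    unfolding v(1) mem_pc[OF assms(3) qM vD] using b0 i assms(6) by auto
qed

text \<open>The fiber coordinate is the slope of \<open>b\<close> against \<open>a\<close>, and over
  \<open>N\<close> it is an equation of the projectivized ruling.\<close>

lemma projectivization_ruled_iff:
  assumes "framed n \<A> D c x y \<alpha> \<beta>" "{x, y} = {a, b}" "c \<in> \<A>" "ruled N E c a" "Q \<in> fst (pc c a b)" "proj Q \<in> N"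
  shows "Q \<in> projectivization N E \<longleftrightarrow> snd (pc c a b) Q n = 0"
proof -
  obtain p v where Q: "Q = Dir p (line_through v)" "p \<in> M" "p \<in> fst c" "v \<in> D p" "indep c a b p"
    "d c p v a = 1" "snd (pc c a b) Q = (snd c p)(n := d c p v b)" using pc_normal[OF assms(3,5)] .
  have "v \<noteq> (\<lambda>_. 0)" using Q(6) d_coord_zero[OF assms(3) Q(3)] by auto
  then show ?thesis
    using mem_projectivization_ruled[OF assms(1-4) _ Q(3,4)] assms(6) Q(1,7) by simp
qed

text \<open>The new fiber coordinate vanishes on the projectivization, so vectors tangent to it have
  no fiber component, and over the ruling only an \<open>a\<close>-component remains. Conversely,
  moving coordinate \<open>a\<close> preserves both \<open>N\<close> and the vanishing of the fiber
  coordinate. So the ruling coordinate passes unchanged to the next level.\<close>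

lemma ruled_prolong:
  assumes f: "framed n \<A> D c x y \<alpha> \<beta>" "{x, y} = {a, b}" "c \<in> \<A>" and r: "ruled N E c a"
  shows "distribution.ruled \<A>' D' (projectivization N E) (prolong_distr \<A> \<A>' N E) (pc c a b) a"
proof -
  interpret pr: distribution "Suc n" M' \<A>' D' by (rule distribution')
  let ?C = "pc c a b" and ?N = "projectivization N E" and ?E = "prolong_distr \<A> \<A>' N E"
  have ab: "a < n" "b < n" using f(1,2) by (auto simp: framed_def doubleton_eq_iff)
  note C = pc_atlas'[OF f(3) ab]
  have N: "proj Q \<in> N" if "Q \<in> ?N" for Q using that by (auto simp: projectivization_def)
  have closed: "Q' \<in> ?N" if Q: "Q \<in> ?N" "Q \<in> fst ?C" "Q' \<in> fst ?C" "snd ?C Q' = (snd ?C Q)(a := s)" for Q Q' s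
  proof -
    note r1 = pc_restrict[OF f(3) Q(2)] and r2 = pc_restrict[OF f(3) Q(3)]
    have "snd c (proj Q') = (snd c (proj Q))(a := s)"
      unfolding r1(2)[symmetric] r2(2)[symmetric] Q(4) by (rule fun_upd_twist) (use ab(1) in simp)
    then have "proj Q' \<in> N" using ruledD(4)[OF r N[OF Q(1)] r1(1) r2(1)] by blast
    moreover have "snd ?C Q' n = 0"
      using projectivization_ruled_iff[OF f r Q(2) N[OF Q(1)]] Q(1,4) ab(1) by simp
    ultimately show ?thesis using projectivization_ruled_iff[OF f r Q(3)] by simp
  qed
  have span: "d_coord \<A>' ?C Q ` ?E Q = {w. \<exists>s. w = (\<lambda>i. if i = a then s else 0)}" "?E Q \<subseteq> D' Q"
    if Q: "Q \<in> ?N" "Q \<in> fst ?C" for Q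
  proof -
    obtain p v where pv: "Q = Dir p (line_through v)" "p \<in> N" "v \<in> E p" "v \<noteq> (\<lambda>_. 0)"
      using Q(1) by (auto simp: projectivization_def)
    have pc: "p \<in> fst c" using pc_restrict(1)[OF f(3) Q(2)] pv(1) by simp
    note rp = ruledD[OF r pv(2) pc]
    have vD: "v \<in> D p" using rp(2) pv(3) by blast
    have vc: "v \<in> coord_space n" using D_coord[OF f(3) pc vD] .
    have dv: "d c p v = (\<lambda>i. if i = a then d c p v a else 0)" by (rule rp(3)[OF pv(3)])
    have va: "d c p v a \<noteq> 0" using mem_pc[OF f(3) inM[OF f(3) pc] vD] Q(2) pv(1) by simp
    have EQ: "?E Q = {u \<in> tangent_space \<A>' ?N Q. d_proj \<A>' \<A> Q u \<in> line_through v}"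
      using pv(1) by (simp add: prolong_distr_def)
    have DQ: "D' Q = {u \<in> tangent_space \<A>' M' Q. d_proj \<A>' \<A> Q u \<in> line_through v}"
      using pv(1) by (simp add: prolong_distr_def)
    have tc: "u \<in> coord_space (Suc n)" if "u \<in> tangent_space \<A>' ?N Q" for u
      using that by (rule pr.tangent_spaceD[OF C Q(2)])
    show "?E Q \<subseteq> D' Q"
      unfolding EQ DQ pr.tangent_space_M[OF pr.inM[OF C Q(2)]] using tc by blast
    show "d_coord \<A>' ?C Q ` ?E Q = {w. \<exists>s. w = (\<lambda>i. if i = a then s else 0)}"
    proof (intro subset_antisym subsetI)
      fix w assume "w \<in> d_coord \<A>' ?C Q ` ?E Q"
      then obtain u where u: "w = d_coord \<A>' ?C Q u" "u \<in> tangent_space \<A>' ?N Q" "d_proj \<A>' \<A> Q u \<in> line_through v"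
        unfolding EQ by blast
      note uc = tc[OF u(2)]
      obtain \<gamma> where g: "smooth_in ?C \<gamma>" "\<gamma> 0 = Q" "\<forall>\<^sub>F s in nhds 0. \<gamma> s \<in> ?N" "u \<in> coord_space (Suc n)"
        "has_velocity ?C \<gamma> 0 w" "u = tangent \<A>' \<gamma> 0"
        using pr.tangent_spaceD[OF C Q(2) u(2)] unfolding u(1) .
      have "\<forall>\<^sub>F s in nhds 0. \<gamma> s \<in> fst ?C" using g(1) by (simp add: smooth_in_def)
      with g(3) have *: "\<forall>\<^sub>F s in nhds 0. snd ?C (\<gamma> s) n = 0"
        by eventually_elim (use projectivization_ruled_iff[OF f r] N in blast)
      have "((\<lambda>s. snd ?C (\<gamma> s) n) has_field_derivative w n) (at 0)" using g(5) by (simp add: has_velocity_def)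
      moreover have "((\<lambda>s. snd ?C (\<gamma> s) n) has_field_derivative 0) (at 0)"
        using DERIV_cong_ev[OF refl *, of 0 0] by simp
      ultimately have wn: "w n = 0" by (rule DERIV_unique)
      obtain s where s: "d_proj \<A>' \<A> Q u = (\<lambda>i. s * v i)" using u(3) by (auto simp: line_through_def)
      have "w(n := 0) = (\<lambda>i. s * d c p v i)"
        using d_proj(2)[OF f(3) ab Q(2) uc] d_coord_scale[OF f(3) pc vc] s pv(1) u(1) by simp
      then have "w = (\<lambda>i. s * d c p v i)" using wn by (metis fun_upd_triv)
      then have "w = (\<lambda>i. if i = a then s * d c p v a else 0)" by (subst (asm) dv) (auto simp: fun_eq_iff)
      then show "w \<in> {w. \<exists>s. w = (\<lambda>i. if i = a then s else 0)}" by blast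
    next
      fix w :: "nat \<Rightarrow> 'k" assume "w \<in> {w. \<exists>s. w = (\<lambda>i. if i = a then s else 0)}"
      then obtain s where s: "w = (\<lambda>i. if i = a then s else 0)" by blast
      then have wc: "w \<in> coord_space (Suc n)" using ab(1) by (auto simp: coord_space_def)
      define u where "u = pr.of_coord ?C Q w"
      have u: "u \<in> coord_space (Suc n)" "d_coord \<A>' ?C Q u = w"
        unfolding u_def by (rule pr.of_coord[OF C Q(2) wc])+
      have "u \<in> tangent_space \<A>' ?N Q"
      proof (rule pr.tangent_spaceI[OF C Q(2) u(1)])
        show "\<forall>\<^sub>F h in nhds 0. line ?C Q (d_coord \<A>' ?C Q u) h \<in> ?N"
          unfolding u(2) using pr.line_coords(2)[OF C Q(2) wc]
        proof eventually_elim
          case (elim h)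
          then have "snd ?C (line ?C Q w h) = (snd ?C Q)(a := snd ?C Q a + h * s)"
            by (auto simp: s fun_eq_iff)
          then show ?case using closed[OF Q] elim by blast
        qed
      qed
      moreover have "d_proj \<A>' \<A> Q u \<in> line_through v"
      proof -
        note dp = d_proj[OF f(3) ab Q(2) u(1)]
        let ?s = "s / d c p v a"
        have "w(n := 0) = (\<lambda>i. ?s * d c p v i)"
          by (subst dv) (use va ab(1) in \<open>auto simp: s fun_eq_iff\<close>)
        then have "d c p (d_proj \<A>' \<A> Q u) = d c p (\<lambda>i. ?s * v i)"
          using dp(2) d_coord_scale[OF f(3) pc vc, of ?s] pv(1) u(2) by simp
        moreover have "(\<lambda>i. ?s * v i) \<in> coord_space n" using vc by (simp add: coord_space_def)
        ultimately have "d_proj \<A>' \<A> Q u = (\<lambda>i. ?s * v i)"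
          using d_coord_inj[OF f(3) pc dp(1)] by blast
        then show ?thesis unfolding line_through_def by blast
      qed
      ultimately have "u \<in> ?E Q" unfolding EQ by blast
      then show "w \<in> d_coord \<A>' ?C Q ` ?E Q" using u(2) by blast
    qed
  qed
  show ?thesis unfolding pr.ruled_def using span closed by blast
qed

text \<open>The start of the chain: as the projection forgets the fiber coordinate, vertical vectors
  are those with a component along \<open>n\<close> only.\<close>

lemma ruled_vertical:
  assumes "c \<in> \<A>" "a < n" "b < n"
  shows "distribution.ruled \<A>' D' M' (\<lambda>p. {v \<in> D' p. d_proj \<A>' \<A> p v = (\<lambda>_. 0)}) (pc c a b) n"
proof -
  interpret pr: distribution "Suc n" M' \<A>' D' by (rule distribution')
  let ?C = "pc c a b"
  note C = pc_atlas'[OF assms]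
  obtain E where f: "framed (Suc n) \<A>' D' ?C a n E (\<lambda>i z. if i = n then 1 else 0)"
    "\<And>p v i. p \<in> fst c \<Longrightarrow> indep c a b p \<Longrightarrow> v \<in> D p \<Longrightarrow> d c p v a \<noteq> 0 \<Longrightarrow> i < n \<Longrightarrow>
        d c p v i = d c p v a * E i (snd ?C (Dir p (line_through v)))" by (rule framed'[OF assms]) blast
  have key: "d_proj \<A>' \<A> Q v = (\<lambda>_. 0) \<longleftrightarrow> d_coord \<A>' ?C Q v = (\<lambda>i. if i = n then d_coord \<A>' ?C Q v n else 0)"
    if Q: "Q \<in> fst ?C" and v: "v \<in> D' Q" for Q v
  proof -
    have vc: "v \<in> coord_space (Suc n)" using pr.D_coord[OF C Q v] .
    note dp = d_proj[OF assms Q vc] and pQ = pc_restrict(1)[OF assms(1) Q]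
    have "d_proj \<A>' \<A> Q v = (\<lambda>_. 0) \<longleftrightarrow> d c (proj Q) (d_proj \<A>' \<A> Q v) = (\<lambda>_. 0)"
      using d_coord_zero[OF assms(1) pQ] d_coord_eq_zero[OF assms(1) pQ dp(1)] by auto
    also have "\<dots> \<longleftrightarrow> (d_coord \<A>' ?C Q v)(n := 0) = (\<lambda>_. 0)" by (simp only: dp(2))
    also have "\<dots> \<longleftrightarrow> d_coord \<A>' ?C Q v = (\<lambda>i. if i = n then d_coord \<A>' ?C Q v n else 0)"
      by (auto simp: fun_eq_iff split: if_splits)
    finally show ?thesis .
  qed
  show ?thesis
    unfolding pr.ruled_def
  proof (intro conjI ballI impI)
    fix Q assume Q: "Q \<in> M' \<inter> fst ?C"
    show "d_coord \<A>' ?C Q ` {v \<in> D' Q. d_proj \<A>' \<A> Q v = (\<lambda>_. 0)} = {w. \<exists>s. w = (\<lambda>i. if i = n then s else 0)}"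
    proof (intro subset_antisym subsetI)
      fix w assume "w \<in> d_coord \<A>' ?C Q ` {v \<in> D' Q. d_proj \<A>' \<A> Q v = (\<lambda>_. 0)}"
      then obtain v where v: "w = d_coord \<A>' ?C Q v" "v \<in> D' Q" "d_proj \<A>' \<A> Q v = (\<lambda>_. 0)" by blast
      then have "w = (\<lambda>i. if i = n then w n else 0)" using key[THEN iffD1, of Q v] Q unfolding v(1) by blast
      then show "w \<in> {w. \<exists>s. w = (\<lambda>i. if i = n then s else 0)}" by blast
    next
      fix w :: "nat \<Rightarrow> 'k" assume "w \<in> {w. \<exists>s. w = (\<lambda>i. if i = n then s else 0)}"
      then obtain s where s: "w = (\<lambda>i. if i = n then s else 0)" by blast
      have QC: "Q \<in> fst ?C" using Q by blast
      obtain v where v: "v \<in> D' Q" "\<forall>i<Suc n. d_coord \<A>' ?C Q v i =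
          E i (snd ?C Q) * 0 + (if i = n then 1 else 0) * s"
        using pr.frame_mem(1)[OF f(1) C QC] by blast
      have "d_coord \<A>' ?C Q v i = w i" for i
      proof (cases "i < Suc n")
        case False
        then show ?thesis using pr.d_coord_coord_space[OF C QC pr.D_coord[OF C QC v(1)]]
          by (simp add: coord_space_def s)
      qed (use v(2) s in simp)
      then have w: "d_coord \<A>' ?C Q v = w" by blast
      then have "d_proj \<A>' \<A> Q v = (\<lambda>_. 0)" using key[OF QC v(1)] s by (auto simp: fun_eq_iff)
      then show "w \<in> d_coord \<A>' ?C Q ` {v \<in> D' Q. d_proj \<A>' \<A> Q v = (\<lambda>_. 0)}" using v(1) w by blast
    qed
  next
    fix Q Q' assume "Q' \<in> fst ?C" then show "Q' \<in> M'" using pr.inM[OF C] by blast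
  qed blast
qed

lemma pc_inverse_slopes:
  assumes "c \<in> \<A>" "Q \<in> fst (pc c a b)" "Q \<in> fst (pc c b a)"
  shows "snd (pc c a b) Q n * snd (pc c b a) Q n = 1"
proof -
  obtain p v where Q: "Q = Dir p (line_through v)" "p \<in> M" "p \<in> fst c" "v \<in> D p" "indep c a b p" "d c p v a \<noteq> 0"
    using pc_cases[OF assms(2)] .
  have "d c p v b \<noteq> 0" using assms(3) mem_pc[OF assms(1) Q(2,4)] Q(1) by simp
  then show ?thesis
    using snd_pc[OF assms(1) Q(3,4)] Q(1,6) by simp
qed

lemma mem_pc_swap:
  assumes "c \<in> \<A>" "Q \<in> fst (pc c a b)"
  shows "Q \<in> fst (pc c b a) \<longleftrightarrow> snd (pc c a b) Q n \<noteq> 0"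
proof -
  obtain p v where Q: "Q = Dir p (line_through v)" "p \<in> M" "p \<in> fst c" "v \<in> D p" "indep c a b p" "d c p v a \<noteq> 0"
    using pc_cases[OF assms(2)] .
  then show ?thesis
    using mem_pc[OF assms(1) Q(2,4), of b a] snd_pc[OF assms(1) Q(3,4,6), of b] by (simp add: indep_commute)
qed

text \<open>The projectivization carries no topology here; this is the form of the Hausdorff property that is needed.\<close>

lemma unique_limit_prolong:
  assumes lim: "\<And>\<gamma> \<gamma>'. smooth_curve \<A> \<gamma> \<Longrightarrow> smooth_curve \<A> \<gamma>' \<Longrightarrow> \<forall>\<^sub>F t in at 0. \<gamma> t = \<gamma>' t \<Longrightarrow> \<gamma> 0 = \<gamma>' 0"
    and s: "smooth_curve \<A>' \<gamma>" "smooth_curve \<A>' \<gamma>'" and eq: "\<forall>\<^sub>F t in at 0. \<gamma> t = \<gamma>' t"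
  shows "\<gamma> 0 = \<gamma>' 0"
proof -
  interpret pr: manifold "Suc n" M' \<A>' by (rule manifold')
  obtain C where C: "C \<in> \<A>'" "smooth_in C \<gamma>" using s(1) unfolding smooth_curve_iff by blast
  obtain C' where C': "C' \<in> \<A>'" "smooth_in C' \<gamma>'" using s(2) unfolding smooth_curve_iff by blast
  have down: "smooth_curve \<A> (proj \<circ> \<gamma>)" if "C \<in> \<A>'" "smooth_in C \<gamma>" for C \<gamma>
    using that smooth_in_proj unfolding smooth_curve_iff by (metis atlas'_cases)
  have "\<forall>\<^sub>F t in at 0. (proj \<circ> \<gamma>) t = (proj \<circ> \<gamma>') t" using eq by eventually_elim simp
  from lim[OF down[OF C] down[OF C'] this] have p0: "proj (\<gamma> 0) = proj (\<gamma>' 0)" by simp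
  have agree: "\<gamma> 0 = \<gamma>' 0" if K: "K \<in> \<A>'" and s: "smooth_in K \<gamma>" "smooth_in K \<gamma>'" for K
  proof -
    have "snd K (\<gamma> 0) i = snd K (\<gamma>' 0) i" for i
    proof (rule tendsto_unique_zero[of "\<lambda>t. snd K (\<gamma> t) i" "\<lambda>t. snd K (\<gamma>' t) i"])
      show "\<forall>\<^sub>F t in at 0. snd K (\<gamma> t) i = snd K (\<gamma>' t) i" using eq by eventually_elim simp
    qed (use s smooth_germ_isCont in \<open>auto simp: smooth_in_def\<close>)
    then show ?thesis using inj_onD[OF pr.chart_inj[OF K]] smooth_in_mem s by blast
  qed
  define p where "p = proj (\<gamma> 0)"
  have M: "\<gamma> 0 \<in> M'" "\<gamma>' 0 \<in> M'"
    using pr.inM[OF C(1) smooth_in_mem[OF C(2)]] pr.inM[OF C'(1) smooth_in_mem[OF C'(2)]] .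
  obtain v where g: "\<gamma> 0 = Dir p (line_through v)" "p \<in> M" "v \<in> D p" "v \<noteq> (\<lambda>_. 0)"
    using M'_cover[OF M(1)] by (metis p_def proj.simps(2))
  obtain v' where g': "\<gamma>' 0 = Dir p (line_through v')" "v' \<in> D p" "v' \<noteq> (\<lambda>_. 0)"
    using M'_cover[OF M(2)] p0 by (metis p_def proj.simps(2))
  note c = chart_at[OF g(2)]
  let ?c = "chart_at \<A> p"
  obtain a b \<alpha> \<beta> where f: "framed n \<A> D ?c a b \<alpha> \<beta>" using framed[OF c(1)] by blast
  have key: "\<gamma> 0 = \<gamma>' 0"
    if ab: "a < n" "b < n" "indep ?c a b p" and va: "d ?c p v a \<noteq> 0" for a b
  proof -
    let ?K = "pc ?c a b" and ?K' = "pc ?c b a"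
    have K: "?K \<in> \<A>'" "?K' \<in> \<A>'" using pc_atlas'[OF c(1)] ab by auto
    have gK: "\<gamma> 0 \<in> fst ?K" using mem_pc[OF c(1) g(2,3)] ab(3) va c(2) g(1) by simp
    note sK = pr.smooth_in_change[OF C(1) K(1) C(2) gK]
    show ?thesis
    proof (cases "d ?c p v' a = 0")
      case False
      then have "\<gamma>' 0 \<in> fst ?K" using mem_pc[OF c(1) g(2) g'(2)] ab(3) c(2) g'(1) by simp
      then show ?thesis using agree[OF K(1) sK] pr.smooth_in_change[OF C'(1) K(1) C'(2)] by blast
    next
      case True
      then have "d ?c p v' b \<noteq> 0" using ab(3) g'(2,3) by (auto simp: indep_def)
      then have g'K: "\<gamma>' 0 \<in> fst ?K'"
        using mem_pc[OF c(1) g(2) g'(2)] ab(3) c(2) g'(1) by (simp add: indep_commute)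
      note sK' = pr.smooth_in_change[OF C'(1) K(2) C'(2) g'K]
      have evK: "\<forall>\<^sub>F t in at 0. \<gamma> t \<in> fst ?K" "\<forall>\<^sub>F t in at 0. \<gamma>' t \<in> fst ?K'"
        using sK sK' by (simp_all add: smooth_in_def eventually_nhds_conv_at)
      \<comment> \<open>The two limits are seen in opposite slope charts. Slope times inverse slope
        is 1 off 0, hence also at 0, so the slope of \<open>\<gamma> 0\<close> is not zero and
        \<open>\<gamma> 0\<close> lies in the other chart as well.\<close>
      have "snd ?K (\<gamma> 0) n * snd ?K' (\<gamma>' 0) n = 1"
      proof (rule tendsto_unique_zero[of "\<lambda>t. snd ?K (\<gamma> t) n * snd ?K' (\<gamma>' t) n" "\<lambda>t. 1"])
        show "\<forall>\<^sub>F t in at 0. snd ?K (\<gamma> t) n * snd ?K' (\<gamma>' t) n = 1"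
          using eq evK by eventually_elim (use pc_inverse_slopes[OF c(1)] in simp)
        show "isCont (\<lambda>t. snd ?K (\<gamma> t) n * snd ?K' (\<gamma>' t) n) 0"
          using sK sK' by (intro isCont_mult smooth_germ_isCont) (auto simp: smooth_in_def)
      qed simp
      then have "\<gamma> 0 \<in> fst ?K'" using mem_pc_swap[OF c(1) gK] by auto
      then show ?thesis using agree[OF K(2) pr.smooth_in_change[OF C(1) K(2) C(2)] sK'] by blast
    qed
  qed
  have i: "indep ?c a b p" by (rule frame_indep[OF f c])
  have ab: "a < n" "b < n" using f by (auto simp: framed_def)
  have "d ?c p v a \<noteq> 0 \<or> d ?c p v b \<noteq> 0" using i g(3,4) by (auto simp: indep_def)
  then show ?thesis using key[OF ab i] key[OF ab(2,1)] i indep_commute by blast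
qed

end

context distribution
begin

text \<open>Since moving coordinate \<open>a\<close> does not leave \<open>N\<close>, the coordinate
  line through \<open>p\<close> stays in \<open>N\<close> and is an integral curve of
  \<open>E\<close>.\<close>

lemma ruled_curve:
  fixes a
  defines "e \<equiv> (\<lambda>i. if i = a then 1 else 0)"
  assumes f: "framed n \<A> D c x y \<alpha> \<beta>" "{x, y} = {a, b}" "c \<in> \<A>" and r: "ruled N E c a" and p: "p \<in> N" "p \<in> fst c"
  shows "smooth_in c (line c p e)" "line c p e 0 = p"
    "\<forall>\<^sub>F t in nhds 0. line c p e t \<in> fst c \<and> line c p e t \<in> N \<and>
        snd c (line c p e t) = (snd c p)(a := snd c p a + t) \<and>
        tangent \<A> (line c p e) t \<in> E (line c p e t) \<and>
        d c (line c p e t) (tangent \<A> (line c p e) t) = e"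
proof -
  have a: "a < n" using f(1,2) by (auto simp: framed_def doubleton_eq_iff)
  have ec: "e \<in> coord_space n" using a by (auto simp: e_def coord_space_def)
  show "smooth_in c (line c p e)" "line c p e 0 = p"
    using line_smooth(1)[OF f(3) p(2) ec] line_coords(1)[OF f(3) p(2) ec] .
  note ev = line_coords(2)[OF f(3) p(2) ec]
  show "\<forall>\<^sub>F t in nhds 0. line c p e t \<in> fst c \<and> line c p e t \<in> N \<and>
        snd c (line c p e t) = (snd c p)(a := snd c p a + t) \<and>
        tangent \<A> (line c p e) t \<in> E (line c p e t) \<and>
        d c (line c p e t) (tangent \<A> (line c p e) t) = e"
    using ev eventually_nhds_nhds[OF ev]
  proof eventually_elim
    case (elim t)
    have co: "snd c (line c p e t) = (snd c p)(a := snd c p a + t)"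
      using elim(1) by (auto simp: e_def fun_eq_iff)
    have N: "line c p e t \<in> N" using ruledD(4)[OF r p] elim(1) co by blast
    have "((\<lambda>s. snd c (line c p e s) i) has_field_derivative e i) (at t)" for i
    proof -
      have *: "\<forall>\<^sub>F s in nhds t. snd c (line c p e s) i = snd c p i + s * e i"
        by (rule eventually_mono[OF elim(2)]) simp
      have "((\<lambda>s. snd c p i + s * e i) has_field_derivative 0 + 1 * e i) (at t)"
        by (intro DERIV_add DERIV_const DERIV_cmult_right DERIV_ident)
      then show ?thesis using DERIV_cong_ev[OF refl *, of "e i" "e i"] by simp
    qed
    moreover have "\<forall>\<^sub>F s in nhds t. line c p e s \<in> fst c" by (rule eventually_mono[OF elim(2)]) simp
    ultimately have h: "has_velocity c (line c p e) t e" by (simp add: has_velocity_def)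
    have q: "line c p e t \<in> fst c" using elim(1) by simp
    note dt = d_coord_tangent[OF f(3) h] and tc = tangent_has_velocity(3)[OF f(3) h]
    obtain u where u: "u \<in> E (line c p e t)" "d c (line c p e t) u = e"
      using ruledD(1)[OF r N q, of 1] unfolding e_def by blast
    have "u \<in> coord_space n" using D_coord[OF f(3) q] ruledD(2)[OF r N q] u(1) by blast
    then have "tangent \<A> (line c p e) t = u" using d_coord_inj[OF f(3) q tc] dt u(2) by simp
    then show ?case using u q N co by simp
  qed
qed

end

section \<open>The monster tower\<close>

declare tower.simps(2) [simp del] vertical_prolongation.simps [simp del]

lemma tower_Suc:
  "points (tower S (Suc k)) = projectivization (points (tower S k)) (focal (tower S k))"
  "atlas (tower S (Suc k)) = prolong_atlas (k + 2) (atlas (tower S k)) (points (tower S k)) (focal (tower S k))"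
  "focal (tower S (Suc k)) =
     prolong_distr (atlas (tower S k)) (atlas (tower S (Suc k))) (points (tower S k)) (focal (tower S k))"
  by (simp_all add: tower.simps(2) prolong_stage_def Let_def)

locale monster =
  fixes S :: "('a::{t2_space,second_countable_topology}, 'k::real_normed_field) chart set"
  assumes surface: "smooth_surface S"
begin

abbreviation "P k \<equiv> points (tower S k)"
abbreviation "At k \<equiv> atlas (tower S k)"
abbreviation "F k \<equiv> focal (tower S k)"
abbreviation "ch k \<equiv> prolong_chart (k + 2) (At k) (P k) (F k)"

text \<open>Here the topology of the surface is turned into openness of chart images, the form in
  which \<open>manifold\<close> asks for it.\<close>

lemma base_chart:
  assumes "(U, x) \<in> S"
  shows "open U" "open_in 2 (x ` U)" "inj_on x U"
    "open H \<Longrightarrow> open_in 2 (x ` (U \<inter> H))"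
proof -
  obtain y where h: "open U" "open_in 2 (x ` U)" "homeomorphism U (x ` U) x y"
    using surface assms unfolding smooth_surface_def open_in_def by fast
  show "open U" "open_in 2 (x ` U)" using h by auto
  show "inj_on x U" using h(3) unfolding homeomorphism_def by (metis inj_on_inverseI)
  assume "open H"
  then have "openin (top_of_set U) (U \<inter> H)" by (simp add: openin_open_Int)
  from homeomorphism_imp_open_map[OF h(3) this] h(2)
  show "open_in 2 (x ` (U \<inter> H))"
    using openin_trans[of "x ` U" "x ` (U \<inter> H)"] unfolding open_in_def by simp
qed

lemma base_image: "(x \<circ> base_point) ` (Base ` U) = x ` U"
  by force

lemma base_manifold: "manifold 2 (P 0) (At 0)"
proof
  show "P 0 = (\<Union>c\<in>At 0. fst c)"
    by (auto simp: base_stage_def base_points_def base_atlas_def)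
next
  fix c assume "c \<in> At 0"
  then obtain U x where c: "(U, x) \<in> S" "c = (Base ` U, x \<circ> base_point)"
    by (auto simp: base_stage_def base_atlas_def)
  show "inj_on (snd c) (fst c)" using base_chart(3)[OF c(1)] c(2) by (auto simp: inj_on_def)
  show "open_in 2 (snd c ` fst c)" using base_chart(2)[OF c(1)] c(2) by (simp only: fst_conv snd_conv base_image)
  fix c' assume "c' \<in> At 0"
  then obtain H y where c': "(H, y) \<in> S" "c' = (Base ` H, y \<circ> base_point)"
    by (auto simp: base_stage_def base_atlas_def)
  have I: "fst c \<inter> fst c' = Base ` (U \<inter> H)" using c c' by auto
  have im: "snd c ` (fst c \<inter> fst c') = x ` (U \<inter> H)" unfolding I using c(2) by (simp only: snd_conv base_image)
  show o: "open_in 2 (snd c ` (fst c \<inter> fst c'))"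
    unfolding im by (rule base_chart(4)[OF c(1) base_chart(1)[OF c'(1)]])
  fix i :: nat assume "i < 2"
  then have sm: "smooth_on 2 (x ` (U \<inter> H)) (\<lambda>z. y (inv_into U x z) i)"
    using surface c(1) c'(1) unfolding smooth_surface_def by fast
  have eq: "y (inv_into U x z) i = transition c c' z i" if "z \<in> x ` (U \<inter> H)" for z
  proof -
    obtain u where u: "u \<in> U" "z = x u" using \<open>z \<in> x ` (U \<inter> H)\<close> by blast
    have "inv_into (fst c) (snd c) (snd c (Base u)) = Base u"
      by (rule inv_into_f_f) (use \<open>inj_on (snd c) (fst c)\<close> c(2) u in auto)
    then have "transition c c' z = y u" using c(2) c'(2) u by (simp add: transition_def)
    moreover have "inv_into U x z = u" using inv_into_f_f[OF base_chart(3)[OF c(1)] u(1)] u(2) by simp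
    ultimately show ?thesis by simp
  qed
  show "smooth_on 2 (snd c ` (fst c \<inter> fst c')) (\<lambda>z. transition c c' z i)"
    unfolding im by (rule smooth_on_cong[OF o[unfolded im] eq sm])
qed

lemma base_framed:
  assumes "c \<in> At 0"
  shows "framed 2 (At 0) (F 0) c 0 1 (\<lambda>i z. if i = 0 then 1 else 0) (\<lambda>i z. if i = 1 then 1 else 0)"
proof -
  interpret manifold 2 "P 0" "At 0" by (rule base_manifold)
  have "d_coord (At 0) c q ` F 0 q = {w \<in> coord_space 2. \<forall>i<2. w i = (if i = 0 then 1 else 0) * w 0 + (if i = 1 then 1 else 0) * w 1}"
    if q: "q \<in> fst c" for q
  proof -
    have F: "F 0 q = coord_space 2"
      using tangent_space_M[OF inM[OF assms q]] by (simp add: base_stage_def)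
    have "d_coord (At 0) c q ` F 0 q = coord_space 2"
      unfolding F
    proof (intro subset_antisym subsetI)
      fix w :: "nat \<Rightarrow> 'k" assume "w \<in> coord_space 2"
      then show "w \<in> d_coord (At 0) c q ` coord_space 2" using of_coord[OF assms q] by (metis image_eqI)
    qed (use d_coord_coord_space[OF assms q] in blast)
    moreover have "i = 0 \<or> i = 1" if "i < 2" for i :: nat using that by auto
    ultimately show ?thesis by fastforce
  qed
  then show ?thesis by (simp add: framed_def smooth_on_const)
qed

lemma dist: "distribution (k + 2) (P k) (At k) (F k)"
proof (induction k)
  case 0
  interpret manifold 2 "P 0" "At 0" by (rule base_manifold)
  have "distribution 2 (P 0) (At 0) (F 0)"
  proof
    fix p assume p: "p \<in> P 0"
    show "F 0 p \<subseteq> coord_space 2" using tangent_space_M[OF p] by (simp add: base_stage_def)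
  next
    fix c assume "c \<in> At 0"
    then show "\<exists>a b \<alpha> \<beta>. framed 2 (At 0) (F 0) c a b \<alpha> \<beta>" using base_framed by blast
  qed
  then show ?case by (simp only: add_0)
next
  case (Suc k)
  from distribution.distribution'[OF this] show ?case by (simp only: tower_Suc add_Suc)
qed

lemmas mani = distribution.axioms(1)[OF dist]

lemmas pc_atlas = distribution.pc_atlas'[OF dist, folded tower_Suc]
lemmas mem_ch = distribution.mem_pc[OF dist]
lemmas ch_restrict = distribution.pc_restrict[OF dist]
lemmas ch_coord = distribution.pc_coord[OF dist]

lemma framed_ch:
  assumes "c \<in> At k" "a < k + 2" "b < k + 2"
  obtains E where "framed (Suc (k + 2)) (At (Suc k)) (F (Suc k)) (ch k c a b) a (k + 2) E (\<lambda>i z. if i = k + 2 then 1 else 0)"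
    "\<And>p v i. p \<in> fst c \<Longrightarrow> distribution.indep (At k) (F k) c a b p \<Longrightarrow> v \<in> F k p \<Longrightarrow>
        d_coord (At k) c p v a \<noteq> 0 \<Longrightarrow> i < k + 2 \<Longrightarrow>
        d_coord (At k) c p v i = d_coord (At k) c p v a * E i (snd (ch k c a b) (Dir p (line_through v)))"
  by (rule distribution.framed'[OF dist assms, folded tower_Suc]) blast

text \<open>\<open>b\<close> is the newest coordinate of the chart, \<open>a\<close> the one retained from the level below.\<close>

inductive adapted :: "nat \<Rightarrow> (('a, 'k) pt, 'k) chart \<Rightarrow> nat \<Rightarrow> nat \<Rightarrow> bool" where
  base: "c \<in> At 0 \<Longrightarrow> adapted 0 c 0 1"
| base': "c \<in> At 0 \<Longrightarrow> adapted 0 c 1 0"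
| step: "adapted k c a b \<Longrightarrow> adapted (Suc k) (ch k c a b) a (k + 2)"
| step': "adapted k c a b \<Longrightarrow> adapted (Suc k) (ch k c b a) b (k + 2)"

text \<open>Prolongation frames the focal bundle by the retained and the fiber coordinate, whichever
  of the two old coordinates is retained.\<close>

lemma adapted_framed:
  assumes "adapted k c a b"
  shows "c \<in> At k \<and> (\<exists>\<alpha> \<beta>. framed (k + 2) (At k) (F k) c a b \<alpha> \<beta>)"
  using assms
proof induction
  case (base c)
  then show ?case using base_framed by (metis add_0)
next
  case (base' c)
  interpret distribution 2 "P 0" "At 0" "F 0" using dist[of 0] by (simp only: add_0)
  note f = base_framed[OF base']
  have "framed 2 (At 0) (F 0) c 1 0 (\<lambda>i z. if i = 1 then 1 else 0) (\<lambda>i z. if i = 0 then 1 else 0)"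
    using f unfolding framed_def by (simp add: add.commute)
  then show ?case using base' by (metis add_0)
next
  case (step k c a b)
  then have c: "c \<in> At k" "a < k + 2" "b < k + 2" by (auto simp: framed_def)
  show ?case using framed_ch[OF c] pc_atlas[OF c] by (metis add_Suc)
next
  case (step' k c a b)
  then have c: "c \<in> At k" "b < k + 2" "a < k + 2" by (auto simp: framed_def)
  show ?case using framed_ch[OF c] pc_atlas[OF c] by (metis add_Suc)
qed

lemma adapted_atlas: "adapted k c a b \<Longrightarrow> c \<in> At k" "adapted k c a b \<Longrightarrow> a < k + 2" "adapted k c a b \<Longrightarrow> b < k + 2"
  "adapted k c a b \<Longrightarrow> a \<noteq> b"
  using adapted_framed by (auto simp: framed_def)

lemma adapted_Suc:
  assumes "adapted (Suc k) C x y"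
  obtains c a b y' where "adapted k c a b" "C = ch k c x y'" "x = a \<and> y' = b \<or> x = b \<and> y' = a" "y = k + 2"
  using assms by cases auto

lemma adapted_indep:
  assumes "adapted k c a b" "p \<in> fst c"
  shows "distribution.indep (At k) (F k) c a b p" "distribution.indep (At k) (F k) c b a p"
proof -
  interpret distribution "k + 2" "P k" "At k" "F k" by (rule dist)
  show "indep c a b p" using adapted_framed[OF assms(1)] frame_indep assms(2) by blast
  then show "indep c b a p" by (simp add: indep_commute)
qed

lemma adapted_indepD:
  assumes "adapted k c a b" "p \<in> fst c" "v \<in> F k p" "v \<noteq> (\<lambda>_. 0)"
  shows "d_coord (At k) c p v a \<noteq> 0 \<or> d_coord (At k) c p v b \<noteq> 0"
proof -
  interpret distribution "k + 2" "P k" "At k" "F k" by (rule dist)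
  show ?thesis using adapted_indep(1)[OF assms(1,2)] assms(3,4) by (auto simp: indep_def)
qed

lemma inP: "adapted k c a b \<Longrightarrow> p \<in> fst c \<Longrightarrow> p \<in> P k"
  using manifold.inM[OF mani] adapted_atlas(1) by blast

lemma mem_ch_adapted:
  assumes "adapted k c a b" "p \<in> fst c" "v \<in> F k p"
  shows "Dir p (line_through v) \<in> fst (ch k c a b) \<longleftrightarrow> d_coord (At k) c p v a \<noteq> 0"
    "Dir p (line_through v) \<in> fst (ch k c b a) \<longleftrightarrow> d_coord (At k) c p v b \<noteq> 0"
  using mem_ch[OF adapted_atlas(1)[OF assms(1)] inP[OF assms(1,2)] assms(3)] adapted_indep[OF assms(1,2)] assms(2)
  by simp_all

lemma adapted_step:
  assumes "adapted k c a b" "proj Q \<in> fst c" "Q \<in> P (Suc k)"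
  shows "Q \<in> fst (ch k c a b) \<or> Q \<in> fst (ch k c b a)"
proof -
  interpret distribution "k + 2" "P k" "At k" "F k" by (rule dist)
  obtain p v where Q: "Q = Dir p (line_through v)" "p \<in> P k" "v \<in> F k p" "v \<noteq> (\<lambda>_. 0)"
    using M'_cover[of Q] assms(3) by (metis tower_Suc(1))
  then show ?thesis
    using mem_ch_adapted[OF assms(1) _ Q(3)] adapted_indepD[OF assms(1) _ Q(3,4)] assms(2) by simp
qed

lemma proj_mem: "Q \<in> P (Suc k) \<Longrightarrow> proj Q \<in> P k"
  by (auto simp: tower_Suc(1) projectivization_def)

lemma adapted_cover: "p \<in> P k \<Longrightarrow> \<exists>c a b. adapted k c a b \<and> p \<in> fst c"
proof (induction k arbitrary: p)
  case 0
  then show ?case using adapted.base manifold.M_eq[OF mani, of 0] by blast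
next
  case (Suc k)
  obtain c a b where "adapted k c a b" "proj p \<in> fst c" using Suc.IH[OF proj_mem[OF Suc.prems]] by blast
  then show ?case using adapted_step[OF _ _ Suc.prems] adapted.step adapted.step' by blast
qed

text \<open>Prolongation only appends fiber coordinates, so coordinates 0 and 1 remain those of the
  surface. A curve that moves only coordinates from 2 on is therefore critical.\<close>

lemma adapted_base_point:
  assumes "adapted k c a b"
  shows "\<exists>U x. (U, x) \<in> S \<and> (\<forall>q\<in>fst c. base_point q \<in> U \<and> (\<forall>i<2. snd c q i = x (base_point q) i))"
  using assms
proof induction
  case (base c)
  then show ?case by (force simp: base_stage_def base_atlas_def)
next
  case (base' c)
  then show ?case by (force simp: base_stage_def base_atlas_def)
next
  case (step k c a b)
  have "base_point q = base_point (proj q)" for q :: "('a, 'k) pt" by (cases q) auto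
  then show ?case
    using step.IH ch_restrict(1)[OF adapted_atlas(1)[OF step.hyps]] ch_coord[OF adapted_atlas(1)[OF step.hyps]]
    by (metis trans_less_add2)
next
  case (step' k c a b)
  have "base_point q = base_point (proj q)" for q :: "('a, 'k) pt" by (cases q) auto
  then show ?case
    using step'.IH ch_restrict(1)[OF adapted_atlas(1)[OF step'.hyps]] ch_coord[OF adapted_atlas(1)[OF step'.hyps]]
    by (metis trans_less_add2)
qed

text \<open>At level 0 limits are separated by the Hausdorff topology of the surface, and
  prolongation preserves this. It is what extends the equations of lifts to the parameter 0.\<close>

lemma unique_limit:
  "smooth_curve (At k) \<gamma> \<Longrightarrow> smooth_curve (At k) \<gamma>' \<Longrightarrow> \<forall>\<^sub>F t in at 0. \<gamma> t = \<gamma>' t \<Longrightarrow> \<gamma> 0 = \<gamma>' 0"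
proof (induction k arbitrary: \<gamma> \<gamma>')
  case (Suc k)
  show ?case
    by (rule distribution.unique_limit_prolong[OF dist[of k], folded tower_Suc, of \<gamma> \<gamma>'])
       (erule (2) Suc.IH, (fact Suc.prems)+)
next
  case 0
  interpret manifold 2 "P 0" "At 0" by (rule base_manifold)
  have lim: "((\<lambda>t. base_point (\<gamma> t)) \<longlongrightarrow> base_point (\<gamma> 0)) (at 0) \<and> \<gamma> 0 = Base (base_point (\<gamma> 0))"
    if sc: "smooth_curve (At 0) \<gamma>" for \<gamma>
  proof -
    obtain c where c: "c \<in> At 0" "smooth_in c \<gamma>" using sc unfolding smooth_curve_iff by blast
    then obtain U x where Ux: "(U, x) \<in> S" "c = (Base ` U, x \<circ> base_point)"
      by (auto simp: base_stage_def base_atlas_def)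
    have g0: "\<gamma> 0 \<in> Base ` U" using smooth_in_mem[OF c(2)] Ux(2) by simp
    have ev: "\<forall>\<^sub>F t in nhds 0. \<gamma> t \<in> Base ` U" using c(2) Ux(2) by (simp add: smooth_in_def)
    have "((\<lambda>t. base_point (\<gamma> t)) \<longlongrightarrow> base_point (\<gamma> 0)) (at 0)"
    proof (rule topological_tendstoI)
      fix H assume H: "open H" "base_point (\<gamma> 0) \<in> H"
      have "\<forall>\<^sub>F t in nhds 0. x (base_point (\<gamma> t)) \<in> x ` (U \<inter> H)"
      proof (rule eventually_mem_open_in[OF base_chart(4)[OF Ux(1) H(1)]])
        show "x (base_point (\<gamma> 0)) \<in> x ` (U \<inter> H)" using g0 H(2) by auto
        show "isCont (\<lambda>t. x (base_point (\<gamma> t)) i) 0" for i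
          using c(2) Ux(2) smooth_germ_isCont[of "\<lambda>t. x (base_point (\<gamma> t)) i"] by (simp add: smooth_in_def)
        show "\<forall>\<^sub>F t in nhds 0. x (base_point (\<gamma> t)) \<in> coord_space 2"
          using ev by eventually_elim (use open_in_subset[OF base_chart(2)[OF Ux(1)]] in auto)
      qed
      with ev have "\<forall>\<^sub>F t in nhds 0. base_point (\<gamma> t) \<in> H"
      proof eventually_elim
        case (elim t)
        then obtain u w where "\<gamma> t = Base u" "u \<in> U" "w \<in> U \<inter> H" "x u = x w" by auto
        then show ?case using inj_onD[OF base_chart(3)[OF Ux(1)], of u w] by auto
      qed
      then show "\<forall>\<^sub>F t in at 0. base_point (\<gamma> t) \<in> H" by (simp add: eventually_nhds_conv_at)
    qed
    then show ?thesis using g0 by auto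
  qed
  note l = lim[OF 0(1)] and l' = lim[OF 0(2)]
  have "\<forall>\<^sub>F t in at 0. base_point (\<gamma> t) = base_point (\<gamma>' t)" using 0(3) by eventually_elim simp
  from Lim_transform_eventually[OF conjunct1[OF l] this]
  have "base_point (\<gamma> 0) = base_point (\<gamma>' 0)"
    by (rule LIM_unique) (rule conjunct1[OF l'])
  then show ?case using l l' by metis
qed

section \<open>Divisors at infinity\<close>

text \<open>The shift \<open>j = l + 2\<close> removes the truncated subtractions from
  \<open>vertical_prolongation\<close>; the submanifold with index \<open>i\<close> lies on the
  level \<open>Suc (l + i)\<close>.\<close>

definition vp :: "nat \<Rightarrow> nat \<Rightarrow> ('a, 'k) pt set \<times> ('a, 'k) distr" where
  "vp l i = vertical_prolongation S (l + 2) i"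

abbreviation "N l i \<equiv> fst (vp l i)"
abbreviation "E l i \<equiv> snd (vp l i)"

lemma N_Suc: "N l (Suc i) = projectivization (N l i) (E l i)"
  and E_Suc: "E l (Suc i) = prolong_distr (At (Suc (l + i))) (At (Suc (Suc (l + i)))) (N l i) (E l i)"
  by (simp_all add: vp_def vertical_prolongation.simps(2) case_prod_unfold Let_def)

lemma N_0: "N l 0 = P (Suc l)"
  and E_0: "E l 0 = (\<lambda>p. {v \<in> F (Suc l) p. d_proj (At (Suc l)) (At l) p v = (\<lambda>_. 0)})"
  by (simp_all add: vp_def vertical_prolongation.simps(1))

lemma divisor_eq: "divisor S (l + 2) m = N l (Suc m)"
  by (simp add: divisor_def vp_def)

text \<open>The ruling direction is the newest coordinate of the chart on \<open>N\<^sub>0\<close>, and from then on it is retained.\<close>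

lemma N_ruled:
  assumes "adapted (Suc (l + i)) c a b" "N l i \<inter> fst c \<noteq> {}"
  shows "2 \<le> (if i = 0 then b else a) \<and>
    distribution.ruled (At (Suc (l + i))) (F (Suc (l + i))) (N l i) (E l i) c (if i = 0 then b else a)"
  using assms
proof (induction i arbitrary: c a b)
  case 0
  then obtain c' a' b' y where c: "adapted l c' a' b'" "c = ch l c' a y" "a = a' \<and> y = b' \<or> a = b' \<and> y = a'" "b = l + 2"
    using adapted_Suc by (metis add_0_right)
  have ay: "a < l + 2" "y < l + 2" using c(3) adapted_atlas[OF c(1)] by auto
  show ?case
    using distribution.ruled_vertical[OF dist adapted_atlas(1)[OF c(1)] ay, folded tower_Suc] c(2,4)
    by (simp add: N_0 E_0)
next
  case (Suc i)
  let ?k = "Suc (l + i)"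
  have "adapted (Suc ?k) c a b" using Suc.prems(1) by simp
  then obtain c' a' b' y where c: "adapted ?k c' a' b'" "c = ch ?k c' a y" "a = a' \<and> y = b' \<or> a = b' \<and> y = a'" "b = ?k + 2"
    by (rule adapted_Suc)
  obtain Q where Q: "Q \<in> N l (Suc i)" "Q \<in> fst c" using Suc.prems(2) by blast
  then obtain q L where qL: "Q = Dir q L" "q \<in> N l i" by (auto simp: N_Suc projectivization_def)
  have q: "q \<in> fst c'" using ch_restrict(1)[OF adapted_atlas(1)[OF c(1)]] Q(2) c(2) qL(1) by fastforce
  let ?x = "if i = 0 then b' else a'" and ?y = "if i = 0 then a' else b'"
  have IH: "2 \<le> ?x" "distribution.ruled (At ?k) (F ?k) (N l i) (E l i) c' ?x"
    using Suc.IH[OF c(1)] q qL(2) by blast+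
  obtain \<alpha> \<beta> where f: "framed (?k + 2) (At ?k) (F ?k) c' a' b' \<alpha> \<beta>" using adapted_framed[OF c(1)] by blast
  have xy: "{a', b'} = {?x, ?y}" by auto
  \<comment> \<open>Points of the projectivized ruling are visible only in the chart that retains
    the ruling coordinate. Hence \<open>a\<close> must be \<open>?x\<close>.\<close>
  have "Q \<notin> fst (ch ?k c' ?y ?x)"
    using distribution.projectivization_ruled_pc(2)[OF dist f xy adapted_atlas(1)[OF c(1)] IH(2) qL(2) q] Q(1) qL(1)
    by (simp add: N_Suc)
  then have "a = ?x" "y = ?y" using c(2,3) Q(2) by (auto split: if_splits)
  then show ?case
    using distribution.ruled_prolong[OF dist f xy adapted_atlas(1)[OF c(1)] IH(2), folded tower_Suc] c(2) IH(1)
    by (simp add: N_Suc E_Suc)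
qed

text \<open>The differential that has to vanish is the one complementary to the ruling: for the
  divisor (\<open>i = 0\<close>) that of the retained coordinate, as the ruling is the newest one;
  for its prolongations that of the newest.\<close>

lemma N_mem:
  assumes "adapted (Suc (l + i)) c a b" "p \<in> N l i" "p \<in> fst c" "v \<in> F (Suc (l + i)) p" "v \<noteq> (\<lambda>_. 0)"
  shows "Dir p (line_through v) \<in> N l (Suc i) \<longleftrightarrow> d_coord (At (Suc (l + i))) c p v (if i = 0 then a else b) = 0"
proof -
  let ?k = "Suc (l + i)"
  let ?x = "if i = 0 then b else a" and ?y = "if i = 0 then a else b"
  obtain \<alpha> \<beta> where f: "framed (?k + 2) (At ?k) (F ?k) c a b \<alpha> \<beta>" using adapted_framed[OF assms(1)] by blast
  have xy: "{a, b} = {?x, ?y}" by auto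
  have r: "distribution.ruled (At ?k) (F ?k) (N l i) (E l i) c ?x" using N_ruled[OF assms(1)] assms(2,3) by blast
  show ?thesis
    unfolding N_Suc
    by (rule distribution.mem_projectivization_ruled[OF dist f xy adapted_atlas(1)[OF assms(1)] r assms(2-5)])
qed

text \<open>\<open>x\<close> is the ruling coordinate and \<open>y\<close> the other one of the
  frame. For \<open>i = 0\<close> the chart above retains the newest coordinate, for
  \<open>i > 0\<close> it goes on retaining the same one; this is the difference between
  \<open>V\<close> and \<open>T\<close>.\<close>

lemma N_chart:
  fixes a b i
  defines "x \<equiv> if i = 0 then b else a" and "y \<equiv> if i = 0 then a else b"
  assumes "adapted (Suc (l + i)) c a b" "proj Q \<in> N l i" "proj Q \<in> fst c"
  shows "Q \<in> N l (Suc i) \<Longrightarrow> Q \<in> fst (ch (Suc (l + i)) c x y) \<and> Q \<notin> fst (ch (Suc (l + i)) c y x)"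
    "Q \<in> fst (ch (Suc (l + i)) c x y) \<Longrightarrow> Q \<in> N l (Suc i) \<longleftrightarrow> snd (ch (Suc (l + i)) c x y) Q (Suc (l + i) + 2) = 0"
proof -
  let ?k = "Suc (l + i)"
  obtain \<alpha> \<beta> where f: "framed (?k + 2) (At ?k) (F ?k) c a b \<alpha> \<beta>" using adapted_framed[OF assms(3)] by blast
  have xy: "{a, b} = {x, y}" by (auto simp: x_def y_def)
  have r: "distribution.ruled (At ?k) (F ?k) (N l i) (E l i) c x"
    using N_ruled[OF assms(3)] assms(4,5) unfolding x_def by blast
  show "Q \<in> fst (ch ?k c x y) \<and> Q \<notin> fst (ch ?k c y x)" if Q: "Q \<in> N l (Suc i)"
  proof -
    obtain q L where qL: "Q = Dir q L" using Q by (auto simp: N_Suc projectivization_def)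
    show ?thesis
      using distribution.projectivization_ruled_pc[OF dist f xy adapted_atlas(1)[OF assms(3)] r, of q L] assms(4,5) Q
      by (simp add: N_Suc qL)
  qed
  show "Q \<in> N l (Suc i) \<longleftrightarrow> snd (ch ?k c x y) Q (?k + 2) = 0" if "Q \<in> fst (ch ?k c x y)"
    using distribution.projectivization_ruled_iff[OF dist f xy adapted_atlas(1)[OF assms(3)] r that assms(4)]
    by (simp only: N_Suc)
qed

lemma N_proj: "Q \<in> N l (Suc i) \<Longrightarrow> proj Q \<in> N l i"
  by (auto simp: N_Suc projectivization_def)

lemma ruling_focal_germ:
  fixes a
  defines "e \<equiv> (\<lambda>i. if i = a then 1 else 0)"
  assumes f: "framed (k + 2) (At k) (F k) c x y \<alpha> \<beta>" "{x, y} = {a, b}" "c \<in> At k"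
    and r: "distribution.ruled (At k) (F k) N' E' c a" and p: "p \<in> N'" "p \<in> fst c"
  shows "focal_germ S k (line c p e)"
proof -
  interpret distribution "k + 2" "P k" "At k" "F k" by (rule dist)
  note rc = ruled_curve[OF f r p, folded e_def]
  have "smooth_curve (At k) (line c p e)" unfolding smooth_curve_iff using rc(1) f(3) by blast
  moreover have "\<exists>\<epsilon>>0. inj_on (line c p e) (ball 0 \<epsilon>)"
  proof -
    obtain \<epsilon> where eps: "\<epsilon> > 0" "\<And>t. dist t 0 < \<epsilon> \<Longrightarrow> snd c (line c p e t) = (snd c p)(a := snd c p a + t)"
      using rc(3) unfolding eventually_nhds_metric by blast
    have "s = t" if st: "s \<in> ball 0 \<epsilon>" "t \<in> ball 0 \<epsilon>" "line c p e s = line c p e t" for s t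
    proof -
      have "(snd c p)(a := snd c p a + s) = (snd c p)(a := snd c p a + t)"
        using eps(2)[of s] eps(2)[of t] st by (simp add: dist_commute)
      from fun_cong[OF this, of a] show ?thesis by simp
    qed
    then show ?thesis using eps(1) by (intro exI[of _ \<epsilon>]) (auto simp: inj_on_def)
  qed
  moreover have "\<forall>\<^sub>F t in nhds 0. nonsingular_at S k (line c p e) t \<longrightarrow>
      tangent (At k) (line c p e) t \<in> F k (line c p e t)"
    using rc(3) by eventually_elim (use ruledD(2)[OF r] in blast)
  ultimately show ?thesis by (simp add: focal_germ_def)
qed

text \<open>The ruling through the point is a critical germ, and its lift is the ruling one level higher.\<close>

lemma critical_direction_N:
  assumes Q: "Q \<in> N l (Suc i)" "Q \<in> P (Suc (Suc (l + i)))"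
  shows "critical_direction S (Suc (l + i)) Q"
proof -
  let ?k = "Suc (l + i)"
  interpret distribution "?k + 2" "P ?k" "At ?k" "F ?k" by (rule dist)
  obtain c a b where c: "adapted ?k c a b" "proj Q \<in> fst c" using adapted_cover[OF proj_mem[OF Q(2)]] by blast
  define x where "x = (if i = 0 then b else a)"
  define y where "y = (if i = 0 then a else b)"
  have xy: "{a, b} = {x, y}" by (auto simp: x_def y_def)
  note qN = N_proj[OF Q(1)] and cA = adapted_atlas(1)[OF c(1)]
  obtain \<alpha> \<beta> where f: "framed (?k + 2) (At ?k) (F ?k) c a b \<alpha> \<beta>" using adapted_framed[OF c(1)] by blast
  have r: "2 \<le> x" "ruled (N l i) (E l i) c x" using N_ruled[OF c(1)] qN c(2) unfolding x_def by blast+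
  let ?C = "ch ?k c x y"
  have QC: "Q \<in> fst ?C" using N_chart(1)[OF c(1) qN c(2) Q(1)] unfolding x_def y_def by blast
  have x: "x < ?k + 2" "y < ?k + 2" using adapted_atlas[OF c(1)] by (auto simp: x_def y_def)
  obtain E' where f': "framed (Suc (?k + 2)) (At (Suc ?k)) (F (Suc ?k)) ?C x (?k + 2) E' (\<lambda>i z. if i = ?k + 2 then 1 else 0)"
    by (rule framed_ch[OF cA x]) blast
  have f'': "framed (Suc ?k + 2) (At (Suc ?k)) (F (Suc ?k)) ?C x (?k + 2) E' (\<lambda>i z. if i = ?k + 2 then 1 else 0)"
    using f' by simp
  have r': "distribution.ruled (At (Suc ?k)) (F (Suc ?k)) (N l (Suc i)) (E l (Suc i)) ?C x"
    using distribution.ruled_prolong[OF dist f xy cA r(2), folded tower_Suc] by (simp add: N_Suc E_Suc)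
  note CA = pc_atlas[OF cA x]
  define e where "e = (\<lambda>i. if i = x then 1 else 0 :: 'k)"
  define \<gamma> where "\<gamma> = line c (proj Q) e"
  define \<delta> where "\<delta> = line ?C Q e"
  note rc = ruled_curve[OF f xy cA r(2) qN c(2), folded e_def, folded \<gamma>_def]
  note rd = distribution.ruled_curve[OF dist f'' refl CA r' Q(1) QC, folded e_def, folded \<delta>_def]
  have fg: "focal_germ S ?k \<gamma>"
    unfolding \<gamma>_def e_def by (rule ruling_focal_germ[OF f xy cA r(2) qN c(2)])
  have fd: "focal_germ S (Suc ?k) \<delta>"
    unfolding \<delta>_def e_def by (rule ruling_focal_germ[OF f'' refl CA r' Q(1) QC])
  have "\<forall>\<^sub>F t in nhds 0. nonsingular_at S ?k \<gamma> t \<and> \<delta> t = tangent_direction S ?k \<gamma> t"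
    using rc(3) rd(3)
  proof eventually_elim
    case (elim t)
    have nz: "tangent (At ?k) \<gamma> t \<noteq> (\<lambda>_. 0)"
    proof
      assume "tangent (At ?k) \<gamma> t = (\<lambda>_. 0)"
      then have "e = (\<lambda>_. 0)" using elim(1) d_coord_zero[OF cA, of "\<gamma> t"] by simp
      from fun_cong[OF this, of x] show False by (simp add: e_def)
    qed
    note dC = ch_restrict[OF cA, of "\<delta> t" x y] and QC' = ch_restrict[OF cA QC]
    \<comment> \<open>Both lines move the same coordinate \<open>x\<close>, and the chart above
      extends the one below; so the ruling above projects to the ruling below.\<close>
    have "snd c (proj (\<delta> t)) = (snd c (proj Q))(x := snd c (proj Q) x + t)"
    proof -
      have "snd c (proj (\<delta> t)) = ((snd ?C Q)(x := snd ?C Q x + t))(?k + 2 := 0)"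
        using dC(2) elim(2) by simp
      also have "\<dots> = ((snd ?C Q)(?k + 2 := 0))(x := snd ?C Q x + t)"
        by (rule fun_upd_twist) (use x in simp)
      also have "\<dots> = (snd c (proj Q))(x := snd c (proj Q) x + t)"
        using QC'(2) ch_coord[OF cA QC x(1)] by simp
      finally show ?thesis .
    qed
    then have "proj (\<delta> t) = \<gamma> t"
      using inj_onD[OF chart_inj[OF cA]] dC(1) elim by auto
    moreover obtain q u where u: "\<delta> t = Dir q (line_through u)" "u \<in> E l i q" "u \<noteq> (\<lambda>_. 0)"
      using elim(2) by (auto simp: N_Suc projectivization_def)
    ultimately have u': "\<delta> t = Dir (\<gamma> t) (line_through u)" "u \<in> E l i (\<gamma> t)" by auto
    have gN: "\<gamma> t \<in> N l i" "\<gamma> t \<in> fst c" using elim(1) by auto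
    note rD = ruledD[OF r(2) gN]
    have uc: "u \<in> coord_space (?k + 2)" "tangent (At ?k) \<gamma> t \<in> coord_space (?k + 2)"
      using D_coord[OF cA gN(2)] rD(2) u'(2) elim(1) by auto
    let ?s = "d c (\<gamma> t) u x"
    have "d c (\<gamma> t) u = (\<lambda>i. ?s * e i)" by (rule trans[OF rD(3)[OF u'(2)]]) (auto simp: e_def)
    then have "d c (\<gamma> t) u = d c (\<gamma> t) (\<lambda>i. ?s * tangent (At ?k) \<gamma> t i)"
      using d_coord_scale[OF cA gN(2) uc(2), of ?s] elim(1) by simp
    moreover have "(\<lambda>i. ?s * tangent (At ?k) \<gamma> t i) \<in> coord_space (?k + 2)"
      using uc(2) by (simp add: coord_space_def)
    ultimately have ueq: "u = (\<lambda>i. ?s * tangent (At ?k) \<gamma> t i)" using d_coord_inj[OF cA gN(2) uc(1)] by blast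
    then have "?s \<noteq> 0" using u(3) by auto
    then have "line_through u = line_through (tangent (At ?k) \<gamma> t)"
      using line_through_eq[of ?s "tangent (At ?k) \<gamma> t"] ueq by simp
    then show ?case using nz u'(1) by (simp add: nonsingular_at_def tangent_direction_def)
  qed
  then have "is_lift S ?k \<gamma> \<delta>" using fd by (simp add: is_lift_def eventually_nhds_conv_at)
  moreover have "critical_germ S ?k \<gamma>"
  proof -
    \<comment> \<open>The moving coordinate has index at least 2, so the two coordinates of the
      surface stay constant along \<open>\<gamma>\<close>.\<close>
    obtain U z where Uz: "(U, z) \<in> S" "\<And>q. q \<in> fst c \<Longrightarrow> base_point q \<in> U"
      "\<And>q i. q \<in> fst c \<Longrightarrow> i < 2 \<Longrightarrow> snd c q i = z (base_point q) i"
      using adapted_base_point[OF c(1)] by blast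
    have "\<forall>\<^sub>F t in nhds 0. base_point (\<gamma> t) = base_point (proj Q)"
      using rc(3)
    proof eventually_elim
      case (elim t)
      have zc: "z s \<in> coord_space 2" if "s \<in> U" for s using open_in_subset[OF base_chart(2)[OF Uz(1)]] that by blast
      have "z (base_point (\<gamma> t)) i = z (base_point (proj Q)) i" for i
      proof (cases "i < 2")
        case True
        then have "snd c (\<gamma> t) i = snd c (proj Q) i" using elim r(1) by auto
        moreover have "\<gamma> t \<in> fst c" using elim by blast
        ultimately show ?thesis using Uz(3)[OF _ True] c(2) by metis
      next
        case False
        then show ?thesis
          using zc[OF Uz(2)[OF c(2)]] zc[OF Uz(2), of "\<gamma> t"] elim by (simp add: coord_space_def)
      qed
      then show ?case using inj_onD[OF base_chart(3)[OF Uz(1)]] Uz(2) elim c(2) by blast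
    qed
    then show ?thesis using fg by (auto simp: critical_germ_def)
  qed
  moreover have "\<delta> 0 = Q" using rd(2) .
  ultimately show ?thesis unfolding critical_direction_def by blast
qed

end

section \<open>Orders of functions along curves\<close>

lemma funpow_deriv_cong:
  assumes "\<forall>\<^sub>F t in nhds a. f t = g t"
  shows "\<forall>\<^sub>F t in nhds a. (deriv ^^ i) f t = (deriv ^^ i) g t"
proof (induction i)
  case (Suc i)
  from eventually_nhds_nhds[OF this] show ?case
    by (rule eventually_mono) (auto intro: deriv_cong_ev)
qed (use assms in simp)

lemma has_order_cong:
  assumes "\<forall>\<^sub>F t in nhds 0. f t = g t"
  shows "has_order f n \<longleftrightarrow> has_order g n"
  using eventually_nhds_x_imp_x[OF funpow_deriv_cong[OF assms]] by (simp add: has_order_def)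

text \<open>Stands for dividing \<open>f\<close> by the coordinate \<open>i\<close>. The mean value
  inequality is applied in that coordinate alone, starting on the hyperplane where \<open>f\<close>
  is 0; so the error is measured by \<open>norm (z i)\<close> and not by the distance to
  \<open>x\<close>, as control of orders requires.\<close>

lemma coordinate_factor_approx:
  fixes f :: "(nat \<Rightarrow> 'k::real_normed_field) \<Rightarrow> 'k"
  assumes "open_in n W" "C_on n (Suc m) W f" "x \<in> W" "i < n" "x i = 0"
    and zero: "\<And>z. z \<in> W \<Longrightarrow> z i = 0 \<Longrightarrow> f z = 0" and "e > 0"
  shows "\<exists>d>0. \<forall>z\<in>coord_space n. (\<forall>j<n. norm (z j - x j) < d) \<longrightarrow>
           norm (f z - partial i f x * z i) \<le> e * norm (z i)"
proof -
  have "C_on n m W (partial i f)" using assms(2,4) by simp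
  from continuous_on_box[OF assms(1,3) C_on_continuous[OF this] \<open>e > 0\<close>]
  obtain d where d: "d > 0" "\<And>y. y \<in> coord_space n \<Longrightarrow> \<forall>j<n. norm (y j - x j) < d \<Longrightarrow>
      y \<in> W \<and> norm (partial i f y - partial i f x) < e" by blast
  have "norm (f z - partial i f x * z i) \<le> e * norm (z i)"
    if z: "z \<in> coord_space n" "\<forall>j<n. norm (z j - x j) < d" for z
  proof -
    have near: "z(i := h) \<in> W \<and> norm (partial i f (z(i := h)) - partial i f x) < e" if "h \<in> ball 0 d" for h
      by (rule d(2)) (use upd_coord_space[OF z(1) assms(4)] z(2) that assms(5) in auto)
    define \<phi> where "\<phi> h = f (z(i := h)) - partial i f x * h" for h
    have "norm (\<phi> (z i) - \<phi> 0) \<le> e * norm (z i - 0)"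
    proof (rule field_differentiable_bound[where S = "ball 0 d" and f' = "\<lambda>h. partial i f (z(i := h)) - partial i f x"])
      fix h assume h: "h \<in> ball (0::'k) d"
      have "((\<lambda>h'. f ((z(i := h))(i := h'))) has_field_derivative partial i f (z(i := h))) (at ((z(i := h)) i))"
        using near[OF h] by (intro C_on_partialD[OF assms(2,4)]) auto
      then have "((\<lambda>h'. f (z(i := h'))) has_field_derivative partial i f (z(i := h))) (at h)"
        by simp
      from DERIV_diff[OF this DERIV_cmult_Id[of "partial i f x"]]
      show "(\<phi> has_field_derivative partial i f (z(i := h)) - partial i f x) (at h within ball 0 d)"
        unfolding \<phi>_def by (rule has_field_derivative_at_within)
      show "norm (partial i f (z(i := h)) - partial i f x) \<le> e" using near[OF h] by simp
    qed (use z(2) assms(4,5) d(1) in auto)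
    moreover have "f (z(i := 0)) = 0" using near[of 0] d(1) by (intro zero) auto
    ultimately show ?thesis by (simp add: \<phi>_def)
  qed
  then show ?thesis using d(1) by blast
qed

text \<open>Divided by \<open>t ^ d\<close>, the error of the factorization is a small multiple of a
  bounded quotient. So \<open>f (u t) / t ^ d\<close> tends to the nonzero partial derivative times
  the limit of \<open>u t i / t ^ d\<close>.\<close>

lemma has_order_equation:
  fixes u :: "'k::real_normed_field \<Rightarrow> nat \<Rightarrow> 'k"
  assumes W: "open_in n W" "smooth_on n W f" "u 0 \<in> W" "i < n" "u 0 i = 0"
    and zero: "\<And>z. z \<in> W \<Longrightarrow> z i = 0 \<Longrightarrow> f z = 0" and nz: "partial i f (u 0) \<noteq> 0"
    and u: "\<And>j. j < n \<Longrightarrow> smooth_germ (\<lambda>t. u t j)" "\<forall>\<^sub>F t in nhds 0. u t \<in> coord_space n"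
    and ord: "smooth_germ (\<lambda>t. u t i)" "has_order (\<lambda>t. u t i) d"
  shows "has_order (\<lambda>t. f (u t)) d"
proof -
  have inW: "\<forall>\<^sub>F t in nhds 0. u t \<in> W"
    by (rule eventually_mem_open_in[OF W(1,3) smooth_germ_isCont[OF u(1)] u(2)])
  have sm: "smooth_germ (\<lambda>t. f (u t))"
    by (rule smooth_germ_compose[where u = u, OF W(1,2) u(1) inW])
  obtain c where c: "c \<noteq> 0" "((\<lambda>t. u t i / t ^ d) \<longlongrightarrow> c) (at 0)"
    using has_order_imp_tendsto[OF ord] by blast
  let ?p = "partial i f (u 0)"
  have "((\<lambda>t. f (u t) / t ^ d - ?p * (u t i / t ^ d)) \<longlongrightarrow> 0) (at 0)"
  proof (rule tendstoI)
    fix e :: real assume "e > 0"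
    define L where "L = norm c + 1"
    have L: "L > 0" by (simp add: L_def add_nonneg_pos)
    have pos: "e / L > 0" using \<open>e > 0\<close> L by simp
    have C1: "C_on n (Suc 0) W f" using W(2) unfolding smooth_on_def by blast
    obtain \<delta> where \<delta>: "\<delta> > 0" "\<And>z. z \<in> coord_space n \<Longrightarrow> \<forall>j<n. norm (z j - u 0 j) < \<delta> \<Longrightarrow>
        norm (f z - ?p * z i) \<le> (e / L) * norm (z i)"
      using coordinate_factor_approx[OF W(1) C1 W(3-5) zero pos] by blast
    have "\<forall>\<^sub>F t in at 0. norm (u t i / t ^ d) < L"
      by (rule order_tendstoD(2)[OF tendsto_norm[OF c(2)]]) (simp add: L_def)
    moreover have "\<forall>\<^sub>F t in at 0. \<forall>j<n. norm (u t j - u 0 j) < \<delta>"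
      using eventually_close[where u = u and n = n and t = 0, OF smooth_germ_isCont[OF u(1)] \<delta>(1)]
      by (simp add: eventually_nhds_conv_at)
    moreover have "\<forall>\<^sub>F t in at 0. u t \<in> coord_space n" using u(2) by (simp add: eventually_nhds_conv_at)
    moreover have "\<forall>\<^sub>F t in at (0::'k). t \<noteq> 0" by (rule eventually_neq_at_within)
    ultimately show "\<forall>\<^sub>F t in at 0. dist (f (u t) / t ^ d - ?p * (u t i / t ^ d)) 0 < e"
    proof eventually_elim
      case (elim t)
      have "f (u t) / t ^ d - ?p * (u t i / t ^ d) = (f (u t) - ?p * u t i) / t ^ d"
        by (simp add: diff_divide_distrib)
      then have "norm (f (u t) / t ^ d - ?p * (u t i / t ^ d)) = norm (f (u t) - ?p * u t i) / norm (t ^ d)"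
        by (simp add: norm_divide)
      also have "\<dots> \<le> (e / L) * norm (u t i) / norm (t ^ d)"
        by (intro divide_right_mono \<delta>(2)) (use elim in auto)
      also have "\<dots> = (e / L) * norm (u t i / t ^ d)" by (simp add: norm_divide)
      also have "\<dots> < (e / L) * L" using elim \<open>e > 0\<close> L by (intro mult_strict_left_mono) auto
      finally show ?case using L by (simp add: dist_norm)
    qed
  qed
  from tendsto_add[OF this tendsto_mult[OF tendsto_const[of ?p] c(2)]]
  have "((\<lambda>t. f (u t) / t ^ d) \<longlongrightarrow> ?p * c) (at 0)" by simp
  from has_order_if_tendsto[OF sm this] show ?thesis using c(1) nz by simp
qed

section \<open>Smooth functions in charts, and multiplicities\<close>

context manifold
begin

text \<open>Chart and neighbourhood are explicit, so that the witnesses in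
  \<open>smooth_function\<close> and \<open>local_equation\<close> can be moved to a chart of
  choice.\<close>

definition smooth_near :: "('p, 'k) chart \<Rightarrow> (nat \<Rightarrow> 'k) set \<Rightarrow> ('p \<Rightarrow> 'k) \<Rightarrow> 'p \<Rightarrow> bool" where
  "smooth_near c W f p \<longleftrightarrow> c \<in> \<A> \<and> p \<in> fst c \<and> open_in n W \<and> W \<subseteq> snd c ` fst c \<and> snd c p \<in> W \<and>
     smooth_on n W (f \<circ> inv_into (fst c) (snd c))"

text \<open>The second conclusion keeps the new neighbourhood inside the old one, so that statements
  about its points, such as the zero set of a local equation, survive the change.\<close>

lemma smooth_near_change:
  assumes "smooth_near c' W f p" "c \<in> \<A>" "p \<in> fst c"
  defines "W' \<equiv> {z \<in> snd c ` (fst c \<inter> fst c'). transition c c' z \<in> W}"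
  shows "smooth_near c W' f p"
    "\<And>q. q \<in> fst c \<Longrightarrow> snd c q \<in> W' \<Longrightarrow> q \<in> fst c' \<and> snd c' q \<in> W"
proof -
  note s = assms(1)[unfolded smooth_near_def]
  have c': "c' \<in> \<A>" using s by blast
  let ?I = "snd c ` (fst c \<inter> fst c')"
  have oI: "open_in n ?I" by (rule overlap_open[OF assms(2) c'])
  have oW': "open_in n W'"
    unfolding W'_def
    by (rule open_in_preimage[OF oI _ transition_continuous[OF assms(2) c'] transition_coord_space[OF assms(2) c']])
       (use s in blast)
  have "smooth_on n W' (\<lambda>z. (f \<circ> inv_into (fst c') (snd c')) (transition c c' z))"
  proof (rule smooth_on_compose[where g = "transition c c'" and n = n and W = W])
    fix j assume "j < n"
    from transition_smooth[OF assms(2) c' this] show "smooth_on n W' (\<lambda>z. transition c c' z j)"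
      by (rule smooth_on_subset) (auto simp: W'_def)
  qed (use s oW' in \<open>auto simp: W'_def o_def\<close>)
  moreover have "(f \<circ> inv_into (fst c') (snd c')) (transition c c' z) = (f \<circ> inv_into (fst c) (snd c)) z"
    if z: "z \<in> W'" for z
  proof -
    obtain q where q: "q \<in> fst c" "q \<in> fst c'" "z = snd c q" using z by (auto simp: W'_def)
    then show ?thesis
      using transition_eq[OF assms(2) q(1), of c'] inv_into_f_f[OF chart_inj[OF assms(2)] q(1)]
        inv_into_f_f[OF chart_inj[OF c'] q(2)] by simp
  qed
  ultimately have "smooth_on n W' (f \<circ> inv_into (fst c) (snd c))"
    by (rule smooth_on_cong[OF oW', rotated])
  moreover have "snd c p \<in> W'"
    using s assms(3) transition_eq[OF assms(2,3), of c'] by (auto simp: W'_def)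
  ultimately show "smooth_near c W' f p" unfolding smooth_near_def using oW' assms(2,3) by (auto simp: W'_def)
  fix q assume q: "q \<in> fst c" "snd c q \<in> W'"
  then obtain q' where "q' \<in> fst c" "q' \<in> fst c'" "snd c q = snd c q'" by (auto simp: W'_def)
  then have "q = q'" using inj_onD[OF chart_inj[OF assms(2)]] q(1) by blast
  then show "q \<in> fst c' \<and> snd c' q \<in> W"
    using q \<open>q' \<in> fst c'\<close> transition_eq[OF assms(2) q(1), of c'] by (simp add: W'_def)
qed

lemma smooth_near_eventually:
  assumes "smooth_near c W f p" "\<gamma> t = p" "\<forall>\<^sub>F s in nhds t. \<gamma> s \<in> fst c" "\<And>i. isCont (\<lambda>s. snd c (\<gamma> s) i) t"
  shows "\<forall>\<^sub>F s in nhds t. snd c (\<gamma> s) \<in> W \<and> (f \<circ> inv_into (fst c) (snd c)) (snd c (\<gamma> s)) = f (\<gamma> s)"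
proof -
  note s = assms(1)[unfolded smooth_near_def]
  have "\<forall>\<^sub>F s in nhds t. snd c (\<gamma> s) \<in> W"
  proof (rule eventually_mem_open_in[of n W])
    show "\<forall>\<^sub>F s in nhds t. snd c (\<gamma> s) \<in> coord_space n"
      by (rule eventually_mono[OF assms(3)]) (use coord_mem s in blast)
  qed (use s assms(2,4) in auto)
  then show ?thesis using assms(3)
    by eventually_elim (use inv_into_f_f[OF chart_inj] s in simp)
qed

lemma smooth_near_deriv:
  assumes "smooth_near c W f (\<gamma> t)" "has_velocity c \<gamma> t w"
  shows "((\<lambda>s. f (\<gamma> s)) has_field_derivative
     (\<Sum>l<n. partial l (f \<circ> inv_into (fst c) (snd c)) (snd c (\<gamma> t)) * w l)) (at t)"
proof -
  note s = assms(1)[unfolded smooth_near_def]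
  have v: "\<forall>\<^sub>F s in nhds t. \<gamma> s \<in> fst c" "\<And>i. ((\<lambda>s. snd c (\<gamma> s) i) has_field_derivative w i) (at t)"
    using assms(2) by (auto simp: has_velocity_def)
  have "((\<lambda>s. (f \<circ> inv_into (fst c) (snd c)) (snd c (\<gamma> s))) has_field_derivative
     (\<Sum>l<n. partial l (f \<circ> inv_into (fst c) (snd c)) (snd c (\<gamma> t)) * w l)) (at t)"
  proof (rule smooth_on_chain_rule[where u = "\<lambda>s. snd c (\<gamma> s)"])
    show "\<forall>\<^sub>F s in nhds t. snd c (\<gamma> s) \<in> coord_space n"
      by (rule eventually_mono[OF v(1)]) (use coord_mem s in blast)
  qed (use s v in \<open>auto simp: o_def\<close>)
  moreover have *: "\<forall>\<^sub>F s in nhds t. (f \<circ> inv_into (fst c) (snd c)) (snd c (\<gamma> s)) = f (\<gamma> s)"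
    by (rule eventually_mono[OF smooth_near_eventually[OF assms(1) refl v(1) DERIV_isCont[OF v(2)]]]) simp
  ultimately show ?thesis using DERIV_cong_ev[OF refl * refl] by simp
qed

lemma smooth_near_smooth_germ:
  assumes "smooth_near c W f (\<gamma> 0)" "smooth_in c \<gamma>"
  shows "smooth_germ (\<lambda>t. f (\<gamma> t))"
proof -
  note s = assms(1)[unfolded smooth_near_def]
  have v: "\<forall>\<^sub>F s in nhds 0. \<gamma> s \<in> fst c" "\<And>i. smooth_germ (\<lambda>s. snd c (\<gamma> s) i)"
    using assms(2) by (auto simp: smooth_in_def)
  note ev = smooth_near_eventually[OF assms(1) refl v(1) smooth_germ_isCont[OF v(2)]]
  have "smooth_germ (\<lambda>s. (f \<circ> inv_into (fst c) (snd c)) (snd c (\<gamma> s)))"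
  proof (rule smooth_germ_compose[of n W, where u = "\<lambda>s. snd c (\<gamma> s)"])
    show "\<forall>\<^sub>F t in nhds 0. snd c (\<gamma> t) \<in> W" using ev by (rule eventually_mono) simp
  qed (use s v(2) in \<open>auto simp: o_def\<close>)
  then show ?thesis by (rule smooth_germ_cong[rotated]) (use ev in \<open>rule eventually_mono, simp\<close>)
qed

text \<open>Vanishing of the differential does not depend on the chart: the derivative of
  \<open>f\<close> along the \<open>i\<close>th coordinate line of \<open>c'\<close> is also
  computed by the chain rule in \<open>c\<close>.\<close>

lemma smooth_near_partial_zero:
  assumes "smooth_near c' W f p" "smooth_near c W' f p"
    and zero: "\<And>l. l < n \<Longrightarrow> partial l (f \<circ> inv_into (fst c) (snd c)) (snd c p) = 0" and "i < n"
  shows "partial i (f \<circ> inv_into (fst c') (snd c')) (snd c' p) = 0"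
proof -
  have c: "c \<in> \<A>" "p \<in> fst c" "c' \<in> \<A>" "p \<in> fst c'" using assms(1,2) by (auto simp: smooth_near_def)
  define e where "e = (\<lambda>j. if j = i then 1 else 0 :: 'k)"
  have e: "e \<in> coord_space n" using \<open>i < n\<close> by (simp add: e_def coord_space_def)
  let ?\<gamma> = "line c' p e"
  have 0: "?\<gamma> 0 = p" by (rule line_coords(1)[OF c(3,4) e])
  note h' = line_smooth(2)[OF c(3,4) e]
  note h = has_velocity_change[OF c(3,1) h', unfolded 0, OF c(2)]
  have "(\<Sum>l<n. partial l (f \<circ> inv_into (fst c') (snd c')) (snd c' p) * e l) =
     (\<Sum>l<n. partial l (f \<circ> inv_into (fst c) (snd c)) (snd c p) * jacobian n c' c p e l)"
    using DERIV_unique[OF smooth_near_deriv[OF _ h', of W f] smooth_near_deriv[OF _ h, of W' f]] assms(1,2) 0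
    by simp
  also have "\<dots> = 0" using zero by simp
  finally show ?thesis using \<open>i < n\<close> by (simp add: e_def if_distrib sum.If_cases)
qed

lemma smooth_near_coord:
  assumes "c \<in> \<A>" "p \<in> fst c"
  shows "smooth_near c (snd c ` fst c) (\<lambda>q. snd c q i - x) p"
    "z \<in> snd c ` fst c \<Longrightarrow> j < n \<Longrightarrow>
       partial j ((\<lambda>q. snd c q i - x) \<circ> inv_into (fst c) (snd c)) z = (if i = j then 1 else 0)"
proof -
  note o = chart_open[OF assms(1)]
  have eq: "((\<lambda>q. snd c q i - x) \<circ> inv_into (fst c) (snd c)) z = z i - x" if "z \<in> snd c ` fst c" for z
    using f_inv_into_f[OF that] by simp
  have sm: "smooth_on n (snd c ` fst c) (\<lambda>z. z i - x)"
    by (intro smooth_on_diff o smooth_on_coord smooth_on_const)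
  have "smooth_on n (snd c ` fst c) ((\<lambda>q. snd c q i - x) \<circ> inv_into (fst c) (snd c))"
    by (rule smooth_on_cong[OF o _ sm]) (rule eq[symmetric])
  then show "smooth_near c (snd c ` fst c) (\<lambda>q. snd c q i - x) p"
    using assms o by (simp add: smooth_near_def)
  assume z: "z \<in> snd c ` fst c" "j < n"
  have "partial j ((\<lambda>q. snd c q i - x) \<circ> inv_into (fst c) (snd c)) z = partial j (\<lambda>z. z i - x) z"
    by (rule partial_cong[OF o _ z]) (rule eq)
  also have "\<dots> = (if i = j then 1 else 0)"
  proof (cases "i = j")
    case True
    have "((\<lambda>h. h - x) has_field_derivative 1) (at (z j))" by (auto intro!: derivative_eq_intros)
    then show ?thesis using True by (simp add: partial_def DERIV_imp_deriv)
  qed (simp add: partial_def)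
  finally show "partial j ((\<lambda>q. snd c q i - x) \<circ> inv_into (fst c) (snd c)) z = (if i = j then 1 else 0)" .
qed

end

context monster
begin

lemma smooth_function_iff:
  "smooth_function S k f p \<longleftrightarrow> (\<exists>c W. manifold.smooth_near (k + 2) (At k) c W f p)"
  unfolding smooth_function_def manifold.smooth_near_def[OF mani] open_in_def
  unfolding case_prod_unfold by blast

text \<open>The centered coordinate \<open>x\<close> attains \<open>m\<close>. For any competing
  \<open>f\<close>, the chain rule and the divisibility of all velocities by that of
  \<open>x\<close> write the derivative of \<open>f \<circ> \<gamma>\<close> as the velocity of
  \<open>x\<close> times a function continuous at 0, so the order of \<open>f\<close> is at least
  \<open>m\<close>.\<close>

lemma germ_multiplicity_eq:
  assumes c: "c \<in> At k" "smooth_in c \<gamma>" and x: "x < k + 2"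
    and ord: "has_order (\<lambda>t. snd c (\<gamma> t) x - snd c (\<gamma> 0) x) m"
    and E: "\<And>j. j < k + 2 \<Longrightarrow> \<exists>E. isCont E 0 \<and> (\<forall>\<^sub>F t in at 0. velocity c \<gamma> t j = velocity c \<gamma> t x * E t)"
  shows "germ_multiplicity S k \<gamma> = m"
proof -
  interpret manifold "k + 2" "P k" "At k" by (rule mani)
  have p: "\<gamma> 0 \<in> fst c" by (rule smooth_in_mem[OF c(2)])
  have dX: "deriv (\<lambda>t. snd c (\<gamma> t) x - snd c (\<gamma> 0) x) = (\<lambda>t. velocity c \<gamma> t x)"
    by (simp add: deriv_diff_const velocity_def[abs_def])
  obtain m' where m: "m = Suc m'" "has_order (\<lambda>t. velocity c \<gamma> t x) m'"
    using ord dX by (cases m) (auto simp: has_order_0 has_order_Suc)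
  have sv: "smooth_germ (\<lambda>t. velocity c \<gamma> t j)" for j
    using smooth_germ_deriv[of "\<lambda>t. snd c (\<gamma> t) j"] c(2) by (simp add: smooth_in_def velocity_def[abs_def])
  show ?thesis
    unfolding germ_multiplicity_def
  proof (rule Least_equality)
    show "\<exists>f. smooth_function S k f (\<gamma> 0) \<and> f (\<gamma> 0) = 0 \<and> has_order (f \<circ> \<gamma>) m"
      using smooth_near_coord(1)[OF c(1) p] ord unfolding smooth_function_iff
      by (intro exI[of _ "\<lambda>q. snd c q x - snd c (\<gamma> 0) x"] conjI exI) (auto simp: o_def)
  next
    fix i assume "\<exists>f. smooth_function S k f (\<gamma> 0) \<and> f (\<gamma> 0) = 0 \<and> has_order (f \<circ> \<gamma>) i"
    then obtain f c' W' where f: "smooth_near c' W' f (\<gamma> 0)" "f (\<gamma> 0) = 0" "has_order (\<lambda>t. f (\<gamma> t)) i"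
      unfolding smooth_function_iff comp_def by blast
    define W where "W = {z \<in> snd c ` (fst c \<inter> fst c'). transition c c' z \<in> W'}"
    have W: "smooth_near c W f (\<gamma> 0)" unfolding W_def by (rule smooth_near_change(1)[OF f(1) c(1) p])
    note Wd = W[unfolded smooth_near_def]
    let ?g = "f \<circ> inv_into (fst c) (snd c)"
    obtain i' where i: "i = Suc i'" "has_order (deriv (\<lambda>t. f (\<gamma> t))) i'"
      using f(2,3) by (cases i) (auto simp: has_order_0 has_order_Suc)
    have "\<forall>j\<in>{..<k+2}. \<exists>E. isCont E 0 \<and> (\<forall>\<^sub>F t in at 0. velocity c \<gamma> t j = velocity c \<gamma> t x * E t)"
      using E by blast
    then obtain E where E: "\<And>j. j < k + 2 \<Longrightarrow> isCont (E j) 0"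
      "\<And>j. j < k + 2 \<Longrightarrow> \<forall>\<^sub>F t in at 0. velocity c \<gamma> t j = velocity c \<gamma> t x * E j t"
      unfolding bchoice_iff by auto
    define G where "G t = (\<Sum>j<k+2. partial j ?g (snd c (\<gamma> t)) * E j t)" for t
    have v: "\<forall>\<^sub>F s in nhds 0. \<gamma> s \<in> fst c" "\<And>i. smooth_germ (\<lambda>s. snd c (\<gamma> s) i)"
      using c(2) by (auto simp: smooth_in_def)
    have inW: "\<forall>\<^sub>F t in nhds 0. snd c (\<gamma> t) \<in> W"
      using smooth_near_eventually[OF W refl v(1) smooth_germ_isCont[OF v(2)]] by (rule eventually_mono) simp
    have "isCont (\<lambda>t. partial j ?g (snd c (\<gamma> t))) 0" if "j < k + 2" for j
    proof -
      have o: "open_in (k + 2) W" and sp: "smooth_on (k + 2) W (partial j ?g)"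
        using Wd smooth_on_partial[OF _ that] by blast+
      show ?thesis
        by (rule smooth_germ_isCont[OF smooth_germ_compose[where u = "\<lambda>t. snd c (\<gamma> t)", OF o sp v(2) inW]])
    qed
    then have "isCont G 0"
      unfolding G_def by (intro continuous_sum continuous_mult E(1)) auto
    moreover have "\<forall>\<^sub>F t in at 0. deriv (\<lambda>t. f (\<gamma> t)) t = velocity c \<gamma> t x * G t"
    proof -
      have "\<forall>\<^sub>F t in at 0. \<forall>j\<in>{..<k+2}. velocity c \<gamma> t j = velocity c \<gamma> t x * E j t"
        using E(2) by (intro eventually_ball_finite) auto
      moreover have "\<forall>\<^sub>F t in at 0. has_velocity c \<gamma> t (velocity c \<gamma> t)"
        using smooth_in_has_velocity[OF c] by (simp add: eventually_nhds_conv_at)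
      moreover have "\<forall>\<^sub>F t in at 0. snd c (\<gamma> t) \<in> W" using inW by (simp add: eventually_nhds_conv_at)
      ultimately show ?thesis
      proof eventually_elim
        case (elim t)
        have "smooth_near c W f (\<gamma> t)"
          using Wd elim(3) has_velocity_mem[OF elim(2)] unfolding smooth_near_def by blast
        from DERIV_imp_deriv[OF smooth_near_deriv[OF this elim(2)]]
        have "deriv (\<lambda>t. f (\<gamma> t)) t = (\<Sum>l<k+2. partial l ?g (snd c (\<gamma> t)) * velocity c \<gamma> t l)" .
        also have "\<dots> = (\<Sum>l<k+2. velocity c \<gamma> t x * (partial l ?g (snd c (\<gamma> t)) * E l t))"
          by (intro sum.cong) (use elim(1) in auto)
        finally show ?case by (simp only: G_def sum_distrib_left)
      qed
    qed
    ultimately have "m' \<le> i'"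
      using has_order_mult_ge[OF sv[of x] _ smooth_germ_deriv[OF smooth_near_smooth_germ[OF W c(2)]] m(2) i(2)]
      by blast
    then show "m \<le> i" using m(1) i(1) by simp
  qed
qed

end

section \<open>Centered coordinates and the combinatorics of code words\<close>

definition centered :: "('p, 'k::real_normed_field) chart \<Rightarrow> ('k \<Rightarrow> 'p) \<Rightarrow> nat \<Rightarrow> 'k \<Rightarrow> 'k" where
  "centered c \<gamma> i t = snd c (\<gamma> t) i - snd c (\<gamma> 0) i"

text \<open>A centered coordinate vanishes at 0, so its order is one more than that of its velocity;
  quotients of velocities thus become differences of orders of coordinates.\<close>

lemma has_order_centered:
  "has_order (centered c \<gamma> i) m \<longleftrightarrow> (\<exists>m'. m = Suc m' \<and> has_order (\<lambda>t. velocity c \<gamma> t i) m')"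
proof -
  have "deriv (centered c \<gamma> i) = (\<lambda>t. velocity c \<gamma> t i)"
    by (simp add: centered_def[abs_def] deriv_diff_const velocity_def[abs_def])
  then show ?thesis by (cases m) (simp_all add: has_order_0 has_order_Suc centered_def)
qed

text \<open>The orders of the retained and of the newest coordinate at a level, as determined by the
  symbols of the higher levels: the Euclidean algorithm run backwards.\<close>

fun order_pair :: "rvt list \<Rightarrow> nat \<times> nat" where
  "order_pair [] = (1, 1)"
| "order_pair (V # w) = (let (e, d) = order_pair w in (e + d, e))"
| "order_pair (T # w) = (let (e, d) = order_pair w in (e, d + e))"
| "order_pair (R # w) = (let (e, d) = order_pair w in (e, e))"

lemma length_adjust_word [simp]: "length (adjust_word w) = length w"
proof (cases w rule: adjust_word.cases)
  case (1 w)
  have "length (takeWhile (\<lambda>s. s = T) w) + length (dropWhile (\<lambda>s. s = T) w) = length w"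
    by (metis length_append takeWhile_dropWhile_id)
  then show ?thesis using 1 by simp
qed auto

text \<open>Only a leading \<open>V\<close> and the block of \<open>T\<close>s right after it are
  rewritten. A \<open>V\<close> at a positive position comes after that block, and everything from
  it on is unchanged; no new \<open>V\<close> arises. Vertical orders start with the second symbol,
  so they can be read from either word.\<close>

lemma adjust_word_V:
  assumes "0 < i" "i < length w"
  shows "adjust_word w ! i = V \<longleftrightarrow> w ! i = V" "w ! i = V \<Longrightarrow> drop i (adjust_word w) = drop i w"
proof -
  have "(adjust_word w ! i = V \<longleftrightarrow> w ! i = V) \<and> (w ! i = V \<longrightarrow> drop i (adjust_word w) = drop i w)"
  proof (cases w rule: adjust_word.cases)
    case (1 u)
    let ?t = "takeWhile (\<lambda>s. s = T) u" and ?d = "dropWhile (\<lambda>s. s = T) u"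
    obtain j where j: "i = Suc j" using assms(1) by (cases i) auto
    have u: "u = ?t @ ?d" by simp
    show ?thesis
    proof (cases "j < length ?t")
      case True
      have "?t ! j \<in> set ?t" using True by (rule nth_mem)
      then have "?t ! j = T" by (blast dest: set_takeWhileD)
      then have "w ! i = T" using 1 j True by (metis nth_Cons_Suc takeWhile_nth)
      moreover have "adjust_word w ! i = R" using 1 j True by (simp add: nth_append)
      ultimately show ?thesis by simp
    next
      case False
      have "w ! i = ?d ! (j - length ?t)" using nth_append[of ?t ?d j] 1 j False by simp
      moreover have "adjust_word w ! i = ?d ! (j - length ?t)" using 1 j False by (simp add: nth_append)
      moreover have "drop i w = drop (j - length ?t) ?d"
        unfolding 1 j drop_Suc_Cons by (subst u, subst drop_append) (use False in simp)
      moreover have "drop i (adjust_word w) = drop (j - length ?t) ?d"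
        using 1 j False by simp
      ultimately show ?thesis by simp
    qed
  qed auto
  then show "adjust_word w ! i = V \<longleftrightarrow> w ! i = V" "w ! i = V \<Longrightarrow> drop i (adjust_word w) = drop i w"
    by auto
qed

context monster
begin

lemma proj_smooth_curve:
  assumes "smooth_curve (At (Suc k)) \<gamma>"
  shows "smooth_curve (At k) (proj \<circ> \<gamma>)"
proof -
  obtain K where K: "K \<in> At (Suc k)" "smooth_in K \<gamma>" using assms unfolding smooth_curve_iff by blast
  from K(1) obtain c a b where c: "K = ch k c a b" "c \<in> At k"
    unfolding tower_Suc(2) prolong_atlas_def by blast
  have "smooth_in c (proj \<circ> \<gamma>)" by (rule distribution.smooth_in_proj[OF dist c(2) K(2)[unfolded c(1)]])
  then show ?thesis unfolding smooth_curve_iff using c(2) by blast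
qed

text \<open>In the chart retaining \<open>b\<close> the fiber coordinate is an equation of the
  divisor. Off the divisor it is nonzero, so the slope can be inverted, which leads to the chart
  retaining \<open>a\<close>.\<close>

lemma adapted_step_N:
  assumes "adapted (Suc l) c a b" "proj Q \<in> fst c" "Q \<in> P (Suc (Suc l))" "Q \<notin> N l 1"
  shows "Q \<in> fst (ch (Suc l) c a b)"
proof (rule ccontr)
  assume no: "Q \<notin> fst (ch (Suc l) c a b)"
  then have Q: "Q \<in> fst (ch (Suc l) c b a)" using adapted_step[OF assms(1-3)] by blast
  have "proj Q \<in> N l 0" using proj_mem[OF assms(3)] by (simp add: N_0)
  then have "snd (ch (Suc l) c b a) Q (Suc l + 2) \<noteq> 0"
    using N_chart(2)[of l 0 c a b Q] assms(1,2,4) Q by simp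
  then have "Q \<in> fst (ch (Suc l) c a b)"
    using distribution.mem_pc_swap[OF dist adapted_atlas(1)[OF assms(1)] Q] by blast
  then show False using no by blast
qed

lemma local_equation_iff:
  "local_equation S j f p \<longleftrightarrow> (\<exists>c W. manifold.smooth_near (j + 2) (At j) c W f p \<and>
     (\<forall>q\<in>fst c. snd c q \<in> W \<longrightarrow> (q \<in> divisor S j 0 \<longleftrightarrow> f q = 0)) \<and>
     (p \<in> divisor S j 0 \<longrightarrow> (\<exists>i<j + 2. partial i (f \<circ> inv_into (fst c) (snd c)) (snd c p) \<noteq> 0)))"
  unfolding local_equation_def manifold.smooth_near_def[OF mani] open_in_def case_prod_unfold by blast

text \<open>A local equation vanishes on the hyperplane of coordinate \<open>i\<close>, so its
  differential has no component other than the \<open>i\<close>th, which is then nonzero. Thus all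
  local equations share the order of that coordinate, and the vertical order is well
  defined.\<close>

lemma local_equation_order:
  assumes K: "K \<in> At j" "smooth_in K \<gamma>" "i < j + 2" "snd K (\<gamma> 0) i = 0"
    and div: "\<And>q. q \<in> fst K \<Longrightarrow> q \<in> divisor S j 0 \<longleftrightarrow> snd K q i = 0"
    and ord: "has_order (\<lambda>t. snd K (\<gamma> t) i) d" and f: "local_equation S j f (\<gamma> 0)"
  shows "has_order (\<lambda>t. f (\<gamma> t)) d"
proof -
  interpret manifold "j + 2" "P j" "At j" by (rule mani)
  obtain c' W' where c': "smooth_near c' W' f (\<gamma> 0)"
    "\<And>q. q \<in> fst c' \<Longrightarrow> snd c' q \<in> W' \<Longrightarrow> q \<in> divisor S j 0 \<longleftrightarrow> f q = 0"
    "\<gamma> 0 \<in> divisor S j 0 \<Longrightarrow> \<exists>i<j + 2. partial i (f \<circ> inv_into (fst c') (snd c')) (snd c' (\<gamma> 0)) \<noteq> 0"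
    using f unfolding local_equation_iff by blast
  have p: "\<gamma> 0 \<in> fst K" by (rule smooth_in_mem[OF K(2)])
  define W where "W = {z \<in> snd K ` (fst K \<inter> fst c'). transition K c' z \<in> W'}"
  note ch = smooth_near_change[OF c'(1) K(1) p, folded W_def]
  note Wd = ch(1)[unfolded smooth_near_def]
  have oW: "open_in (j + 2) W" and pW: "snd K (\<gamma> 0) \<in> W"
    and sW: "smooth_on (j + 2) W (f \<circ> inv_into (fst K) (snd K))" using Wd by blast+
  let ?g = "f \<circ> inv_into (fst K) (snd K)"
  have zero: "?g z = 0" if z: "z \<in> W" "z i = 0" for z
  proof -
    obtain q where q: "q \<in> fst K" "z = snd K q" using z(1) Wd by blast
    then have "q \<in> divisor S j 0" using div z(2) by simp
    then have "f q = 0" using c'(2) ch(2)[OF q(1)] z(1) q(2) by blast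
    then show ?thesis using inv_into_f_f[OF chart_inj[OF K(1)] q(1)] q(2) by simp
  qed
  have nz: "partial i ?g (snd K (\<gamma> 0)) \<noteq> 0"
  proof
    assume i0: "partial i ?g (snd K (\<gamma> 0)) = 0"
    have "partial l ?g (snd K (\<gamma> 0)) = 0" if l: "l < j + 2" for l
    proof (cases "l = i")
      case False
      have "\<forall>\<^sub>F h in nhds (snd K (\<gamma> 0) l). ?g ((snd K (\<gamma> 0))(l := h)) = 0"
        using eventually_upd[OF oW pW l] by (rule eventually_mono) (intro zero, use False K(4) in auto)
      from deriv_cong_ev[OF this refl] show ?thesis by (simp add: partial_def)
    qed (use i0 in simp)
    then have "partial l (f \<circ> inv_into (fst c') (snd c')) (snd c' (\<gamma> 0)) = 0" if "l < j + 2" for l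
      using smooth_near_partial_zero[OF c'(1) ch(1) _ that] by blast
    moreover have "\<gamma> 0 \<in> divisor S j 0" using div[OF p] K(4) by simp
    ultimately show False using c'(3) by blast
  qed
  have sm: "smooth_germ (\<lambda>t. snd K (\<gamma> t) l)" for l using K(2) by (simp add: smooth_in_def)
  have ev: "\<forall>\<^sub>F t in nhds 0. \<gamma> t \<in> fst K" using K(2) by (simp add: smooth_in_def)
  have evc: "\<forall>\<^sub>F t in nhds 0. snd K (\<gamma> t) \<in> coord_space (j + 2)"
    using ev by (rule eventually_mono) (rule coord_mem[OF K(1)])
  have "has_order (\<lambda>t. ?g (snd K (\<gamma> t))) d"
    by (rule has_order_equation[where u = "\<lambda>t. snd K (\<gamma> t)", OF oW sW pW K(3,4) zero nz sm evc sm ord])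
  moreover have "\<forall>\<^sub>F t in nhds 0. ?g (snd K (\<gamma> t)) = f (\<gamma> t)"
    using ev by (rule eventually_mono) (simp add: inv_into_f_f[OF chart_inj[OF K(1)]])
  note has_order_cong[OF this, of d]
  ultimately show ?thesis by (rule iffD1[rotated])
qed

end

section \<open>Orders along the lifts of a regularizable germ\<close>

locale lifted = monster S
  for S :: "('a::{t2_space,second_countable_topology}, 'k::real_normed_field) chart set" +
  fixes k :: nat and C :: "nat \<Rightarrow> 'k \<Rightarrow> ('a, 'k) pt"
  assumes lift: "lifted_germ S k C" and regularizable: "regularizable S k C"
begin

abbreviation "r \<equiv> reg_level S k C"
abbreviation "raw \<equiv> raw_symbol S k C"

lemma is_lift_C: "k \<le> j \<Longrightarrow> is_lift S j (C j) (C (Suc j))"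
  using lift by (simp add: lifted_germ_def)

lemma focal_C: "k \<le> j \<Longrightarrow> focal_germ S j (C j)"
proof (cases "j = k")
  case False
  assume "k \<le> j"
  with False obtain i where "j = Suc i" "k \<le> i" by (cases j) auto
  then show ?thesis using is_lift_C[of i] by (simp add: is_lift_def)
qed (use lift in \<open>simp add: lifted_germ_def\<close>)

lemma smooth_C: "k \<le> j \<Longrightarrow> smooth_curve (At j) (C j)"
  using focal_C by (simp add: focal_germ_def)

lemma smooth_in_C:
  assumes "k \<le> j" "c \<in> At j" "C j 0 \<in> fst c"
  shows "smooth_in c (C j)"
proof -
  obtain c' where c': "c' \<in> At j" "smooth_in c' (C j)"
    using smooth_C[OF assms(1)] unfolding smooth_curve_iff by blast
  show ?thesis by (rule manifold.smooth_in_change[OF mani c'(1) assms(2) c'(2)]) (rule assms(3))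
qed

lemma C_mem: "k \<le> j \<Longrightarrow> C j 0 \<in> P j"
  using smooth_C smooth_in_mem manifold.inM[OF mani] unfolding smooth_curve_iff by metis

text \<open>Off 0 this is part of being a lift; at 0 it is uniqueness of limits for two smooth
  curves that agree off 0.\<close>

lemma proj_C:
  assumes "k \<le> j"
  shows "\<forall>\<^sub>F t in nhds 0. proj (C (Suc j) t) = C j t"
proof -
  have *: "\<forall>\<^sub>F t in at 0. (proj \<circ> C (Suc j)) t = C j t"
    using is_lift_C[OF assms] unfolding is_lift_def
    by (auto elim!: eventually_mono simp: tangent_direction_def)
  have "(proj \<circ> C (Suc j)) 0 = C j 0"
    by (rule unique_limit[OF proj_smooth_curve[OF smooth_C] smooth_C[OF assms] *]) (use assms in simp)
  then show ?thesis using * by (simp add: eventually_nhds_conv_at)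
qed

lemma proj_C_0: "k \<le> j \<Longrightarrow> proj (C (Suc j) 0) = C j 0"
  using eventually_nhds_x_imp_x[OF proj_C] .

text \<open>Off 0 the lift is the tangent line, so its fiber coordinate is the quotient of the
  velocities of \<open>y\<close> and \<open>x\<close>, and the frame coefficients, taken at the
  lift, express every velocity as a multiple of that of \<open>x\<close>. They are continuous at 0
  because the lift is smooth there.\<close>

lemma lift_relations:
  assumes j: "k \<le> j" and c: "adapted j c a b" "C j 0 \<in> fst c"
    and xy: "x = a \<and> y = b \<or> x = b \<and> y = a" and K: "C (Suc j) 0 \<in> fst (ch j c x y)"
  shows "smooth_in (ch j c x y) (C (Suc j))"
    "\<forall>\<^sub>F t in nhds 0. \<forall>i<j + 2. snd (ch j c x y) (C (Suc j) t) i = snd c (C j t) i"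
    "i < j + 2 \<Longrightarrow> \<exists>E. isCont E 0 \<and> (\<forall>\<^sub>F t in at 0. velocity c (C j) t i = velocity c (C j) t x * E t)"
    "\<forall>\<^sub>F t in at 0. velocity c (C j) t y = snd (ch j c x y) (C (Suc j) t) (j + 2) * velocity c (C j) t x"
proof -
  interpret distribution "j + 2" "P j" "At j" "F j" by (rule dist)
  let ?K = "ch j c x y"
  have cA: "c \<in> At j" "x < j + 2" "y < j + 2" using adapted_atlas[OF c(1)] xy by auto
  have KA: "?K \<in> At (Suc j)" by (rule pc_atlas[OF cA])
  show sK: "smooth_in ?K (C (Suc j))" by (rule smooth_in_C[OF _ KA K]) (use j in simp)
  have sc: "smooth_in c (C j)" by (rule smooth_in_C[OF j cA(1) c(2)])
  have evK: "\<forall>\<^sub>F t in nhds 0. C (Suc j) t \<in> fst ?K" using sK by (simp add: smooth_in_def)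
  show "\<forall>\<^sub>F t in nhds 0. \<forall>i<j + 2. snd ?K (C (Suc j) t) i = snd c (C j t) i"
    using evK proj_C[OF j] by eventually_elim (use pc_coord[OF cA(1)] in auto)
  have "\<forall>\<^sub>F t in at 0. tangent (At j) (C j) t \<in> F j (C j t) \<and>
      C (Suc j) t = Dir (C j t) (line_through (tangent (At j) (C j) t))"
  proof -
    have "\<forall>\<^sub>F t in at 0. nonsingular_at S j (C j) t \<longrightarrow> tangent (At j) (C j) t \<in> F j (C j t)"
      using focal_C[OF j] by (simp add: focal_germ_def eventually_nhds_conv_at)
    moreover have "\<forall>\<^sub>F t in at 0. nonsingular_at S j (C j) t \<and> C (Suc j) t = tangent_direction S j (C j) t"
      using is_lift_C[OF j] by (simp add: is_lift_def)
    ultimately show ?thesis by eventually_elim (simp add: tangent_direction_def)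
  qed
  moreover have "\<forall>\<^sub>F t in at 0. has_velocity c (C j) t (velocity c (C j) t)"
    using smooth_in_has_velocity[OF cA(1) sc] by (simp add: eventually_nhds_conv_at)
  moreover have "\<forall>\<^sub>F t in at 0. C (Suc j) t \<in> fst ?K" using evK by (simp add: eventually_nhds_conv_at)
  ultimately have ev: "\<forall>\<^sub>F t in at 0. \<exists>v\<in>F j (C j t). C (Suc j) t = Dir (C j t) (line_through v) \<and> C j t \<in> fst c \<and>
      d c (C j t) v = velocity c (C j) t \<and> indep c x y (C j t) \<and> d c (C j t) v x \<noteq> 0"
  proof eventually_elim
    case (elim t)
    have m: "C j t \<in> fst c" by (rule has_velocity_mem[OF elim(2)])
    have dt: "d c (C j t) (tangent (At j) (C j) t) = velocity c (C j) t" by (rule d_coord_tangent[OF cA(1) elim(2)])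
    show ?case
      using mem_pc[OF cA(1) inM[OF cA(1) m], of "tangent (At j) (C j) t" x y] elim(1,3) m dt
      by (intro bexI[of _ "tangent (At j) (C j) t"]) auto
  qed
  show "\<forall>\<^sub>F t in at 0. velocity c (C j) t y = snd ?K (C (Suc j) t) (j + 2) * velocity c (C j) t x"
    using ev
  proof eventually_elim
    case (elim t)
    then obtain v where v: "v \<in> F j (C j t)" "C (Suc j) t = Dir (C j t) (line_through v)" "C j t \<in> fst c"
      "d c (C j t) v = velocity c (C j) t" "d c (C j t) v x \<noteq> 0" by blast
    have "snd ?K (C (Suc j) t) (j + 2) = velocity c (C j) t y / velocity c (C j) t x"
      using fun_cong[OF snd_pc[OF cA(1) v(3,1,5), of y], of "j + 2"] v(2,4) by (simp only: fun_upd_same)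
    then show ?case using v(4,5) by simp
  qed
  assume i: "i < j + 2"
  obtain E where E: "framed (Suc (j + 2)) (At (Suc j)) (F (Suc j)) ?K x (j + 2) E (\<lambda>i z. if i = j + 2 then 1 else 0)"
    "\<And>p v i. p \<in> fst c \<Longrightarrow> indep c x y p \<Longrightarrow> v \<in> F j p \<Longrightarrow>
        d c p v x \<noteq> 0 \<Longrightarrow> i < j + 2 \<Longrightarrow> d c p v i = d c p v x * E i (snd ?K (Dir p (line_through v)))"
    by (rule framed_ch[OF cA]) blast
  have o: "open_in (Suc (j + 2)) (snd ?K ` fst ?K)"
    using manifold.chart_open[OF mani KA] by (simp only: add_Suc)
  have sE: "smooth_on (Suc (j + 2)) (snd ?K ` fst ?K) (E i)" using E(1) i unfolding framed_def by simp
  have "smooth_germ (\<lambda>t. E i (snd ?K (C (Suc j) t)))"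
  proof (rule smooth_germ_compose[where u = "\<lambda>t. snd ?K (C (Suc j) t)", OF o sE])
    show "smooth_germ (\<lambda>t. snd ?K (C (Suc j) t) l)" for l using sK by (simp add: smooth_in_def)
    show "\<forall>\<^sub>F t in nhds 0. snd ?K (C (Suc j) t) \<in> snd ?K ` fst ?K" using evK by (rule eventually_mono) blast
  qed
  moreover have "\<forall>\<^sub>F t in at 0. velocity c (C j) t i = velocity c (C j) t x * E i (snd ?K (C (Suc j) t))"
    using ev
  proof eventually_elim
    case (elim t)
    then obtain v where v: "v \<in> F j (C j t)" "C (Suc j) t = Dir (C j t) (line_through v)" "C j t \<in> fst c"
      "d c (C j t) v = velocity c (C j) t" "indep c x y (C j t)" "d c (C j t) v x \<noteq> 0" by blast
    show ?case using E(2)[OF v(3,5,1,6) i] unfolding v(2,4) .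
  qed
  ultimately show "\<exists>E. isCont E 0 \<and> (\<forall>\<^sub>F t in at 0. velocity c (C j) t i = velocity c (C j) t x * E t)"
    using smooth_germ_isCont by (intro exI[of _ "\<lambda>t. E i (snd ?K (C (Suc j) t))"]) blast
qed

text \<open>One step of the recursion: coordinate \<open>x\<close> is common to both levels, and the
  velocity of \<open>y\<close> is the slope times that of \<open>x\<close>, so their orders
  add.\<close>

lemma order_transfer:
  assumes "k \<le> j" "adapted j c a b" "C j 0 \<in> fst c" "x = a \<and> y = b \<or> x = b \<and> y = a" "C (Suc j) 0 \<in> fst (ch j c x y)"
    and e: "has_order (centered (ch j c x y) (C (Suc j)) x) e"
  shows "has_order (centered c (C j) x) e"
    "has_order (\<lambda>t. snd (ch j c x y) (C (Suc j) t) (j + 2)) d \<Longrightarrow> has_order (centered c (C j) y) (d + e)"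
proof -
  note lr = lift_relations[OF assms(1-5)]
  have x: "x < j + 2" "y < j + 2" using adapted_atlas[OF assms(2)] assms(4) by auto
  have sc: "smooth_in c (C j)" by (rule smooth_in_C[OF assms(1) adapted_atlas(1)[OF assms(2)] assms(3)])
  have x0: "snd (ch j c x y) (C (Suc j) 0) x = snd c (C j 0) x"
    using eventually_nhds_x_imp_x[OF lr(2)] x by blast
  have "\<forall>\<^sub>F t in nhds 0. centered (ch j c x y) (C (Suc j)) x t = centered c (C j) x t"
    using lr(2) by (rule eventually_mono) (simp only: centered_def x0 x)
  from has_order_cong[OF this] e show xe: "has_order (centered c (C j) x) e" by simp
  assume d: "has_order (\<lambda>t. snd (ch j c x y) (C (Suc j) t) (j + 2)) d"
  obtain e' where e': "e = Suc e'" "has_order (\<lambda>t. velocity c (C j) t x) e'"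
    using xe unfolding has_order_centered by blast
  have sv: "smooth_germ (\<lambda>t. velocity c (C j) t i)" for i
    using smooth_germ_deriv[of "\<lambda>t. snd c (C j t) i"] sc by (simp add: smooth_in_def velocity_def[abs_def])
  have "has_order (\<lambda>t. velocity c (C j) t y) (d + e')"
    by (rule has_order_mult[OF _ sv sv d e'(2) lr(4)]) (use lr(1) in \<open>simp add: smooth_in_def\<close>)
  then show "has_order (centered c (C j) y) (d + e)" unfolding has_order_centered e'(1) by simp
qed

lemma regular_r: "k \<le> r" "regular_germ S r (C r)"
proof -
  have "k \<le> r \<and> regular_germ S r (C r)"
    unfolding reg_level_def by (rule LeastI_ex) (use regularizable in \<open>auto simp: regularizable_def\<close>)
  then show "k \<le> r" "regular_germ S r (C r)" by auto
qed

lemma raw_eq_V: "raw j = V \<longleftrightarrow> 2 \<le> j \<and> C j 0 \<in> divisor S j 0"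
  by (simp add: raw_symbol_def)

lemma raw_neq_R:
  assumes "raw j \<noteq> R" "k + 1 \<le> j"
  obtains l m where "j = Suc (l + Suc m)" "C j 0 \<in> N l (Suc m)" "k + 1 \<le> l + 2"
proof -
  obtain h m where h: "k + 1 \<le> h" "2 \<le> h" "h + m = j" "C j 0 \<in> divisor S h m"
    using assms by (force simp: raw_symbol_def split: if_splits)
  then obtain l where l: "h = l + 2" by (metis add.commute le_Suc_ex)
  then have "C j 0 \<in> N l (Suc m)" using h(4) divisor_eq by simp
  then show thesis using that[of l m] h l by simp
qed

lemma raw_T:
  assumes "raw j = T"
  obtains l m where "j = Suc (l + Suc (Suc m))" "C j 0 \<in> N l (Suc (Suc m))" "k + 1 \<le> l + 2"
proof -
  obtain h i where h: "k + 1 \<le> h" "2 \<le> h" "1 \<le> i" "h + i = j" "C j 0 \<in> divisor S h i"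
    using assms by (force simp: raw_symbol_def split: if_splits)
  then obtain l where l: "h = l + 2" by (metis add.commute le_Suc_ex)
  obtain m where m: "i = Suc m" using h(3) by (cases i) auto
  then have "C j 0 \<in> N l (Suc (Suc m))" using h(5) l divisor_eq by simp
  then show thesis using that[of l m] h l m by simp
qed

lemma raw_R:
  assumes "raw j = R" "C j 0 \<in> N l (Suc m)" "j = Suc (l + Suc m)" "k + 1 \<le> l + 2"
  shows False
proof (cases m)
  case 0
  then have "raw j = V" using assms(2,3) divisor_eq[of l 0] by (simp add: raw_eq_V numeral_2_eq_2)
  then show ?thesis using assms(1) by simp
next
  case (Suc i)
  have "C j 0 \<in> divisor S (l + 2) m" using assms(2) divisor_eq by simp
  then have "\<exists>h l. k + 1 \<le> h \<and> 2 \<le> h \<and> 1 \<le> l \<and> h + l = j \<and> C j 0 \<in> divisor S h l"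
    using assms(3,4) Suc by (intro exI[of _ "l + 2"] exI[of _ m]) auto
  then show ?thesis using assms(1) by (auto simp: raw_symbol_def split: if_splits)
qed

text \<open>If the velocity of this coordinate were 0, the tangent direction would lie on the next
  prolongation and hence be critical. For \<open>i = 0\<close> the submanifold is the whole level,
  which settles the retained coordinate; for \<open>i > 0\<close> the newest coordinate is settled
  on a prolonged divisor. Both give the initial value 1.\<close>

lemma regular_not_tangent:
  assumes "adapted r c a b" "C r 0 \<in> fst c" "r = Suc (l + i)" "C r 0 \<in> N l i"
  shows "has_order (centered c (C r) (if i = 0 then a else b)) 1"
proof -
  interpret distribution "r + 2" "P r" "At r" "F r" by (rule dist)
  have cA: "c \<in> At r" by (rule adapted_atlas(1)[OF assms(1)])
  have sc: "smooth_in c (C r)" by (rule smooth_in_C[OF regular_r(1) cA assms(2)])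
  note h = smooth_in_has_velocity_0[OF cA sc]
  let ?v = "tangent (At r) (C r) 0"
  have dv: "d c (C r 0) ?v = velocity c (C r) 0" by (rule d_coord_tangent[OF cA h])
  have v: "?v \<noteq> (\<lambda>_. 0)" using regular_r(2) by (simp add: regular_germ_def nonsingular_at_def)
  have vF: "?v \<in> F r (C r 0)"
    using eventually_nhds_x_imp_x[of _ "0::'k"] focal_C[OF regular_r(1)] v
    unfolding focal_germ_def nonsingular_at_def by blast
  let ?Q = "Dir (C r 0) (line_through ?v)"
  have "velocity c (C r) 0 (if i = 0 then a else b) \<noteq> 0"
  proof
    assume "velocity c (C r) 0 (if i = 0 then a else b) = 0"
    then have "?Q \<in> N l (Suc i)"
      using N_mem[of l i c a b "C r 0" ?v] assms vF v dv by metis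
    moreover have "?Q \<in> P (Suc r)"
      unfolding tower_Suc(1) projectivization_def using C_mem[OF regular_r(1)] vF v by blast
    ultimately have "critical_direction S r ?Q" using critical_direction_N[of ?Q l i] assms(3) by simp
    then show False using regular_r(2) by (simp add: regular_germ_def tangent_direction_def)
  qed
  then show ?thesis by (simp add: has_order_centered has_order_0)
qed

text \<open>Downward induction from the regularization level. All adapted charts are covered at
  once, because the position of the lift decides which chart occurs one level higher.\<close>

lemma orders:
  assumes "k + 1 \<le> i" "i \<le> r"
  shows "\<forall>c a b. adapted i c a b \<longrightarrow> C i 0 \<in> fst c \<longrightarrow>
    has_order (centered c (C i) a) (fst (order_pair (map raw [i + 1..<r + 1]))) \<and>
    (raw i \<noteq> R \<longrightarrow> has_order (centered c (C i) b) (snd (order_pair (map raw [i + 1..<r + 1]))))"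
  using assms(2,1)
proof (induction i rule: inc_induct)
  case base
  show ?case
  proof (intro allI impI conjI)
    fix c a b assume c: "adapted r c a b" "C r 0 \<in> fst c"
    \<comment> \<open>The level is positive since \<open>k + 1 \<le> r\<close>; the summand 0
      selects the whole level as submanifold, with the vertical directions as ruling.\<close>
    obtain l where l: "r = Suc (l + 0)" using base by (cases r) auto
    have "C r 0 \<in> N l 0" using C_mem[OF regular_r(1)] l by (simp add: N_0)
    from regular_not_tangent[OF c l this]
    show "has_order (centered c (C r) a) (fst (order_pair (map raw [r + 1..<r + 1])))" by simp
    assume "raw r \<noteq> R"
    then obtain l m where "r = Suc (l + Suc m)" "C r 0 \<in> N l (Suc m)" by (rule raw_neq_R) (use base in auto)
    from regular_not_tangent[OF c this]
    show "has_order (centered c (C r) b) (snd (order_pair (map raw [r + 1..<r + 1])))" by simp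
  qed
next
  case (step i)
  let ?w = "map raw [Suc i + 1..<r + 1]"
  obtain e d where ed: "order_pair ?w = (e, d)" by (cases "order_pair ?w")
  have w: "map raw [i + 1..<r + 1] = raw (Suc i) # ?w"
    using step.hyps(2) by (simp add: upt_conv_Cons del: upt_Suc)
  have IH0: "\<forall>c a b. adapted (Suc i) c a b \<longrightarrow> C (Suc i) 0 \<in> fst c \<longrightarrow>
    has_order (centered c (C (Suc i)) a) e \<and> (raw (Suc i) \<noteq> R \<longrightarrow> has_order (centered c (C (Suc i)) b) d)"
    by (rule step.IH[unfolded ed fst_conv snd_conv]) (use step.prems in simp)
  have IH: "has_order (centered K (C (Suc i)) x) e \<and> (raw (Suc i) \<noteq> R \<longrightarrow> has_order (centered K (C (Suc i)) y) d)"
    if "adapted (Suc i) K x y" "C (Suc i) 0 \<in> fst K" for K x y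
    using IH0 that by blast
  have ki: "k \<le> i" using step.prems by simp
  show ?case
  proof (intro allI impI)
    fix c a b assume c: "adapted i c a b" "C i 0 \<in> fst c"
    have Q: "C (Suc i) 0 \<in> P (Suc i)" "proj (C (Suc i) 0) = C i 0"
      using C_mem[of "Suc i"] proj_C_0[OF ki] ki by auto
    \<comment> \<open>On a (prolonged) divisor the fiber coordinate is 0 at the location, so it is
      already centered: its order as a slope is its order as newest coordinate of the level
      above.\<close>
    have new: "has_order (\<lambda>t. snd K (C (Suc i) t) (i + 2)) n \<longleftrightarrow> has_order (centered K (C (Suc i)) (i + 2)) n"
      if "snd K (C (Suc i) 0) (i + 2) = 0" for K n
      using that by (simp add: centered_def[abs_def])
    have "has_order (centered c (C i) a) (fst (order_pair (raw (Suc i) # ?w))) \<and>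
      (raw i \<noteq> R \<longrightarrow> has_order (centered c (C i) b) (snd (order_pair (raw (Suc i) # ?w))))"
    proof (cases "raw (Suc i)")
      case R
      obtain l where l: "i = Suc l" using step.prems by (cases i) auto
      have no: "C (Suc i) 0 \<notin> N l 1"
        using raw_R[of "Suc i" l 0] R l step.prems by auto
      have K: "C (Suc i) 0 \<in> fst (ch i c a b)"
        using adapted_step_N[of l c a b "C (Suc i) 0"] c Q no l by simp
      note ot = order_transfer[OF ki c _ K conjunct1[OF IH[OF adapted.step[OF c(1)] K]]]
      \<comment> \<open>The location is on a prolonged divisor, but that of the lift is not on the
        next prolongation. So the slope is a unit and both coordinates have the same order.\<close>
      have "has_order (centered c (C i) b) e" if "raw i \<noteq> R"
      proof -
        obtain l m where lm: "i = Suc (l + Suc m)" "C i 0 \<in> N l (Suc m)" "k + 1 \<le> l + 2"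
          by (rule raw_neq_R[OF \<open>raw i \<noteq> R\<close>]) (use step.prems in auto)
        have "C (Suc i) 0 \<notin> N l (Suc (Suc m))"
          using raw_R[of "Suc i" l "Suc m"] R lm by auto
        then have "snd (ch i c a b) (C (Suc i) 0) (i + 2) \<noteq> 0"
          using N_chart(2)[of l "Suc m" c a b "C (Suc i) 0"] c Q K lm by simp
        then have "has_order (\<lambda>t. snd (ch i c a b) (C (Suc i) t) (i + 2)) 0" by (simp add: has_order_0)
        from ot(2)[OF _ this] show ?thesis by simp
      qed
      then show ?thesis using ot(1) R ed by simp
    next
      case V
      \<comment> \<open>Now \<open>b\<close> gets retained and has order \<open>e\<close>; the slope
        of \<open>a\<close> against \<open>b\<close> has order \<open>d\<close>, which gives
        \<open>d + e\<close> for \<open>a\<close>.\<close>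
      then have dv: "C (Suc i) 0 \<in> divisor S (Suc i) 0" by (simp add: raw_eq_V)
      obtain l where l: "i = Suc l" using step.prems by (cases i) auto
      have N1: "C (Suc i) 0 \<in> N l (Suc 0)" using dv l divisor_eq[of l 0] by simp
      have N0: "proj (C (Suc i) 0) \<in> N l 0" by (rule N_proj[OF N1])
      have K: "C (Suc i) 0 \<in> fst (ch i c b a)"
        using N_chart(1)[of l 0 c a b "C (Suc i) 0"] c Q N0 N1 l by simp
      have z: "snd (ch i c b a) (C (Suc i) 0) (i + 2) = 0"
        using N_chart(2)[of l 0 c a b "C (Suc i) 0"] c Q N0 N1 l K by simp
      note IH' = IH[OF adapted.step'[OF c(1)] K]
      note ot = order_transfer[OF ki c _ K conjunct1[OF IH']]
      have "has_order (\<lambda>t. snd (ch i c b a) (C (Suc i) t) (i + 2)) d"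
        unfolding new[OF z] using IH' V by simp
      from ot(2)[OF _ this] ot(1) show ?thesis using V ed by (simp add: add.commute)
    next
      case T
      \<comment> \<open>Now \<open>a\<close> stays retained with order \<open>e\<close>, and the
        slope of \<open>b\<close> against it vanishes to order \<open>d\<close>.\<close>
      then obtain l m where lm: "Suc i = Suc (l + Suc (Suc m))" "C (Suc i) 0 \<in> N l (Suc (Suc m))"
        by (rule raw_T)
      note N1 = N_proj[OF lm(2)]
      have K: "C (Suc i) 0 \<in> fst (ch i c a b)"
        using N_chart(1)[of l "Suc m" c a b "C (Suc i) 0"] c Q N1 lm by simp
      have z: "snd (ch i c a b) (C (Suc i) 0) (i + 2) = 0"
        using N_chart(2)[of l "Suc m" c a b "C (Suc i) 0"] c Q N1 lm K by simp
      note IH' = IH[OF adapted.step[OF c(1)] K]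
      note ot = order_transfer[OF ki c _ K conjunct1[OF IH']]
      have "has_order (\<lambda>t. snd (ch i c a b) (C (Suc i) t) (i + 2)) d"
        unfolding new[OF z] using IH' T by simp
      from ot(2)[OF _ this] ot(1) show ?thesis using T ed by simp
    qed
    then show "has_order (centered c (C i) a) (fst (order_pair (map raw [i + 1..<r + 1]))) \<and>
      (raw i \<noteq> R \<longrightarrow> has_order (centered c (C i) b) (snd (order_pair (map raw [i + 1..<r + 1]))))"
      unfolding w .
  qed
qed

text \<open>The chart containing the lift tells which coordinate has the dividing velocity. That one
  is retained, and its order is known at level \<open>i + 1\<close>; hence the bound
  \<open>i < r\<close>, and a word that starts with the symbol of level
  \<open>i + 2\<close>.\<close>

lemma multiplicity:
  assumes "k \<le> i" "i < r"
  shows "germ_multiplicity S i (C i) = fst (order_pair (map raw [i + 2..<r + 1]))"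
proof -
  obtain c a b where c: "adapted i c a b" "C i 0 \<in> fst c" using adapted_cover[OF C_mem[OF assms(1)]] by blast
  have Q: "C (Suc i) 0 \<in> P (Suc i)" "proj (C (Suc i) 0) = C i 0"
    using C_mem[of "Suc i"] proj_C_0 assms(1) by auto
  obtain x y where xy: "x = a \<and> y = b \<or> x = b \<and> y = a" "C (Suc i) 0 \<in> fst (ch i c x y)"
    using adapted_step[OF c(1) _ Q(1)] c(2) Q(2) by metis
  have "adapted (Suc i) (ch i c x y) x (i + 2)" using xy(1) c(1) adapted.step adapted.step' by blast
  then have "has_order (centered (ch i c x y) (C (Suc i)) x) (fst (order_pair (map raw [Suc i + 1..<r + 1])))"
    using orders[of "Suc i", THEN spec, THEN spec, THEN spec] assms xy(2) by (metis Suc_eq_plus1 Suc_leI Suc_le_mono)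
  then have ord: "has_order (centered c (C i) x) (fst (order_pair (map raw [Suc i + 1..<r + 1])))"
    by (rule order_transfer(1)[OF assms(1) c xy])
  have cA: "c \<in> At i" "x < i + 2" using adapted_atlas[OF c(1)] xy(1) by auto
  have "germ_multiplicity S i (C i) = fst (order_pair (map raw [Suc i + 1..<r + 1]))"
    by (rule germ_multiplicity_eq[OF cA(1) smooth_in_C[OF assms(1) cA(1) c(2)] cA(2)
          ord[unfolded centered_def[abs_def]] lift_relations(3)[OF assms(1) c xy]])
  then show ?thesis by simp
qed

lemma proj_funpow_C:
  assumes "k \<le> j"
  shows "\<forall>\<^sub>F t in nhds 0. (proj ^^ n) (C (j + n) t) = C j t"
proof (induction n)
  case (Suc n)
  have "\<forall>\<^sub>F t in nhds 0. proj (C (Suc (j + n)) t) = C (j + n) t" by (rule proj_C) (use assms in simp)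
  with Suc show ?case by eventually_elim (simp add: funpow_swap1)
qed simp

text \<open>The iterated projection of \<open>C r\<close> agrees with \<open>C j\<close> near 0, so
  orders are taken on \<open>C j\<close>. On the divisor the newest coordinate of a suitable chart
  is a local equation, off it the constant 1 is; the definite description also requires that every
  other local equation gives the same order.\<close>

lemma vertical_order:
  assumes "k + 2 \<le> j" "j \<le> r"
  shows "vertical_order S k C j = (if raw j = V then snd (order_pair (map raw [j + 1..<r + 1])) else 0)"
proof -
  let ?d = "if raw j = V then snd (order_pair (map raw [j + 1..<r + 1])) else 0"
  let ?\<pi> = "proj ^^ (r - j)"
  have "\<forall>\<^sub>F t in nhds 0. ?\<pi> (C r t) = C j t" using proj_funpow_C[of j "r - j"] assms by simp
  then have ev: "\<forall>\<^sub>F t in nhds 0. (f \<circ> ?\<pi> \<circ> C r) t = f (C j t)" for f :: "('a, 'k) pt \<Rightarrow> 'k"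
    by (rule eventually_mono) simp
  have \<pi>0: "?\<pi> (C r 0) = C j 0" using eventually_nhds_x_imp_x[OF \<open>\<forall>\<^sub>F t in nhds 0. ?\<pi> (C r t) = C j t\<close>] .
  have "j = Suc (Suc (j - 2))" using assms(1) by simp
  then obtain l where l: "j = Suc (Suc l)" by blast
  have div: "divisor S j 0 = N l (Suc 0)" using divisor_eq[of l 0] l by simp
  have V: "raw j = V \<longleftrightarrow> C j 0 \<in> N l (Suc 0)" using raw_eq_V[of j] div l by simp
  have kl: "k \<le> Suc l" "k \<le> j" using assms(1) l by auto
  obtain c a b where c: "adapted (Suc l) c a b" "C (Suc l) 0 \<in> fst c" using adapted_cover[OF C_mem[OF kl(1)]] by blast
  have cA: "c \<in> At (Suc l)" "a < Suc l + 2" "b < Suc l + 2" using adapted_atlas[OF c(1)] by auto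
  have Q: "C j 0 \<in> P (Suc (Suc l))" "proj (C j 0) = C (Suc l) 0" using C_mem[OF kl(2)] proj_C_0[OF kl(1)] l by auto
  have pN: "proj q \<in> N l 0" if "q \<in> fst (ch (Suc l) c x y)" for q x y
    using ch_restrict(1)[OF cA(1) that] inP[OF c(1)] by (simp add: N_0)
  have "(\<exists>f. local_equation S j f (C j 0) \<and> has_order (\<lambda>t. f (C j t)) ?d) \<and>
      (\<forall>f n. local_equation S j f (C j 0) \<longrightarrow> has_order (\<lambda>t. f (C j t)) n \<longrightarrow> n = ?d)"
  proof (cases "raw j = V")
    case True
    let ?K = "ch (Suc l) c b a"
    have N1: "C j 0 \<in> N l (Suc 0)" using True V by simp
    have K: "C j 0 \<in> fst ?K" using N_chart(1)[of l 0 c a b "C j 0"] c Q(2) N_proj[OF N1] N1 by simp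
    have KA: "?K \<in> At j" using pc_atlas[OF cA(1,3,2)] l by simp
    have divK: "q \<in> divisor S j 0 \<longleftrightarrow> snd ?K q (Suc l + 2) = 0" if "q \<in> fst ?K" for q
      using N_chart(2)[of l 0 c a b q] c(1) pN[OF that] ch_restrict(1)[OF cA(1) that] that div by simp
    have z: "snd ?K (C j 0) (Suc l + 2) = 0" using divK[OF K] N1 div by simp
    have "adapted j ?K b (Suc l + 2)" using adapted.step'[OF c(1)] l by (simp only:)
    moreover have "k + 1 \<le> j" using assms(1) by simp
    ultimately have "has_order (centered ?K (C j) (Suc l + 2)) (snd (order_pair (map raw [j + 1..<r + 1])))"
      using orders[OF _ assms(2)] True K by (metis rvt.distinct(1))
    then have "has_order (centered ?K (C j) (Suc l + 2)) ?d" using True by (simp only: if_True simp_thms)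
    then have ord: "has_order (\<lambda>t. snd ?K (C j t) (Suc l + 2)) ?d" using z by (simp add: centered_def[abs_def])
    note sK = smooth_in_C[OF kl(2) KA K]
    have l3: "Suc l + 2 < j + 2" using l by simp
    have uniq: "n = ?d" if "local_equation S j f (C j 0)" "has_order (\<lambda>t. f (C j t)) n" for f n
      using local_equation_order[OF KA sK l3 z divK ord that(1)] has_order_unique that(2) by blast
    interpret manifold "j + 2" "P j" "At j" by (rule mani)
    \<comment> \<open>Subtracting 0 matches the form of functions in
      \<open>smooth_near_coord\<close>.\<close>
    let ?f = "\<lambda>q. snd ?K q (Suc l + 2) - 0"
    have "local_equation S j ?f (C j 0)"
      unfolding local_equation_iff
    proof (intro exI conjI ballI impI)
      show "smooth_near ?K (snd ?K ` fst ?K) ?f (C j 0)" by (rule smooth_near_coord(1)[OF KA K])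
      show "Suc l + 2 < j + 2" by (rule l3)
      show "partial (Suc l + 2) (?f \<circ> inv_into (fst ?K) (snd ?K)) (snd ?K (C j 0)) \<noteq> 0"
        using smooth_near_coord(2)[OF KA K _ l3, of "snd ?K (C j 0)" "Suc l + 2" 0] K by simp
    qed (use divK in simp)
    moreover have "has_order (\<lambda>t. ?f (C j t)) ?d" using ord by simp
    ultimately show ?thesis using uniq by blast
  next
    case False
    let ?K = "ch (Suc l) c a b"
    have N1: "C j 0 \<notin> N l (Suc 0)" using False V by simp
    have K: "C j 0 \<in> fst ?K" using adapted_step_N[OF c(1) _ Q(1)] c(2) Q(2) N1 by simp
    have KA: "?K \<in> At j" using pc_atlas[OF cA] l by simp
    \<comment> \<open>The chart that retains \<open>a\<close> misses the divisor altogether, so a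
      nonvanishing constant is a local equation on all of it.\<close>
    have disj: "q \<notin> divisor S j 0" if "q \<in> fst ?K" for q
      using N_chart(1)[of l 0 c a b q] c(1) pN[OF that] ch_restrict(1)[OF cA(1) that] that div by auto
    interpret manifold "j + 2" "P j" "At j" by (rule mani)
    have "smooth_near ?K (snd ?K ` fst ?K) (\<lambda>q. 1) (C j 0)"
      unfolding smooth_near_def using KA K chart_open[OF KA] smooth_on_const[of _ _ 1] by (simp add: o_def)
    then have "local_equation S j (\<lambda>q. 1) (C j 0)"
      unfolding local_equation_iff using disj K by (intro exI[of _ ?K] exI[of _ "snd ?K ` fst ?K"]) auto
    moreover have "has_order (\<lambda>t. 1 :: 'k) ?d" using False by (simp add: has_order_0)
    moreover have "n = ?d" if f: "local_equation S j f (C j 0)" "has_order (\<lambda>t. f (C j t)) n" for f n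
    proof -
      have "f (C j 0) \<noteq> 0"
        using f(1) disj[OF K] unfolding local_equation_iff smooth_near_def by blast
      then have "has_order (\<lambda>t. f (C j t)) 0" by (simp add: has_order_0)
      then show ?thesis using has_order_unique f(2) False by auto
    qed
    ultimately show ?thesis by blast
  qed
  then have "(THE n. \<exists>f. local_equation S j f (C j 0) \<and> has_order (\<lambda>t. f (C j t)) n) = ?d"
    by (intro the_equality) blast+
  then show ?thesis
    unfolding vertical_order_def Let_def \<pi>0 has_order_cong[OF ev] .
qed

text \<open>The two multiplicities are the first components of \<open>order_pair\<close> with and
  without the symbol of level \<open>j + 2\<close>. Prepending \<open>V\<close> raises this
  component by \<open>d\<close>, while \<open>R\<close> and \<open>T\<close> leave it
  unchanged.\<close>

lemma vertical_order_multiplicity: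
  assumes "k \<le> j" "j + 2 \<le> r"
  shows "int (vertical_order S k C (j + 2)) =
    int (germ_multiplicity S j (C j)) - int (germ_multiplicity S (j + 1) (C (j + 1)))"
proof -
  let ?w = "map raw [j + 2 + 1..<r + 1]"
  obtain e d where ed: "order_pair ?w = (e, d)" by (cases "order_pair ?w")
  have "map raw [j + 2..<r + 1] = raw (j + 2) # ?w"
    using assms(2) by (simp add: upt_conv_Cons del: upt_Suc)
  then have "germ_multiplicity S j (C j) = fst (order_pair (raw (j + 2) # ?w))"
    using multiplicity[of j] assms by simp
  moreover have "germ_multiplicity S (j + 1) (C (j + 1)) = e"
    using multiplicity[of "j + 1"] assms ed by (simp add: numeral_3_eq_3)
  moreover have "vertical_order S k C (j + 2) = (if raw (j + 2) = V then d else 0)"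
    using vertical_order[of "j + 2"] assms ed by simp
  ultimately show ?thesis using ed by (cases "raw (j + 2)") auto
qed

lemma length_code_word: "length (code_word S k C) = r - k"
  by (simp add: code_word_def del: upt_Suc)

text \<open>Position \<open>i - 1\<close> holds the symbol of level \<open>k + i\<close>, and
  \<open>drop i\<close> leaves the symbols of the levels above it. The bound
  \<open>2 \<le> i\<close> keeps the position positive, where rewriting the initial block neither
  creates nor removes a \<open>V\<close>.\<close>

lemma vertical_order_code_word:
  assumes "2 \<le> i" "i \<le> r - k"
  shows "vertical_order S k C (k + i) =
    (if code_word S k C ! (i - 1) = V then snd (order_pair (drop i (code_word S k C))) else 0)"
proof -
  let ?w = "map raw [k + 1..<r + 1]"
  have i: "0 < i - 1" "i - 1 < length ?w" using assms by auto
  have nth: "?w ! (i - 1) = raw (k + i)" using assms by (simp add: nth_append del: upt_Suc)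
  have dr: "drop i ?w = map raw [k + i + 1..<r + 1]"
    by (simp add: drop_map drop_upt add.commute add.left_commute del: upt_Suc)
  have "drop i (code_word S k C) = drop i ?w" if "raw (k + i) = V"
  proof -
    have "drop (i - 1) (code_word S k C) = drop (i - 1) ?w"
      unfolding code_word_def by (rule adjust_word_V(2)[OF i]) (use nth that in simp)
    then have "drop 1 (drop (i - 1) (code_word S k C)) = drop 1 (drop (i - 1) ?w)" by simp
    then show ?thesis using assms(1) by (simp add: drop_drop del: upt_Suc)
  qed
  moreover have "code_word S k C ! (i - 1) = V \<longleftrightarrow> raw (k + i) = V"
    unfolding code_word_def using adjust_word_V(1)[OF i] nth by simp
  ultimately show ?thesis using vertical_order[of "k + i"] assms dr by (simp del: upt_Suc)
qed

end

theorem theorem33: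
  fixes S :: "('a::{t2_space,second_countable_topology}, 'k::real_normed_field) chart set"
    and k :: nat
    and C :: "nat \<Rightarrow> 'k \<Rightarrow> ('a, 'k) pt"
  assumes "smooth_surface S"
    and "lifted_germ S k C"
    and "regularizable S k C"
  shows "(\<forall>j. k \<le> j \<and> j + 2 \<le> reg_level S k C \<longrightarrow>
            int (vertical_order S k C (j + 2)) =
              int (germ_multiplicity S j (C j)) - int (germ_multiplicity S (j + 1) (C (j + 1)))) \<and>
         (\<forall>(S' :: ('b::{t2_space,second_countable_topology}, 'k) chart set) k' C'.
            smooth_surface S' \<and> lifted_germ S' k' C' \<and> regularizable S' k' C' \<and>
            code_word S' k' C' = code_word S k C \<longrightarrow>
              (\<forall>i. 2 \<le> i \<and> i \<le> reg_level S k C - k \<longrightarrow>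
                 vertical_order S' k' C' (k' + i) = vertical_order S k C (k + i)))"
proof -
  interpret lifted S k C
    using assms by (simp add: lifted_def lifted_axioms_def monster_def)
  show ?thesis
  proof (intro conjI allI impI)
    fix j assume "k \<le> j \<and> j + 2 \<le> reg_level S k C"
    then show "int (vertical_order S k C (j + 2)) =
              int (germ_multiplicity S j (C j)) - int (germ_multiplicity S (j + 1) (C (j + 1)))"
      using vertical_order_multiplicity by blast
  next
    fix S' :: "('b, 'k) chart set" and k' C' i
    assume S': "smooth_surface S' \<and> lifted_germ S' k' C' \<and> regularizable S' k' C' \<and>
            code_word S' k' C' = code_word S k C" and i: "2 \<le> i \<and> i \<le> reg_level S k C - k"
    interpret L': lifted S' k' C'
      using S' by (simp add: lifted_def lifted_axioms_def monster_def)
    \<comment> \<open>Both differences are the length of the common word, so the admissible range of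
      \<open>i\<close> is the same for both germs.\<close>
    have "reg_level S' k' C' - k' = reg_level S k C - k"
      using length_code_word L'.length_code_word S' by simp
    then show "vertical_order S' k' C' (k' + i) = vertical_order S k C (k + i)"
      using vertical_order_code_word[of i] L'.vertical_order_code_word[of i] S' i by simp
  qed
qed

end
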